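(* Any algorithm $\mathcal{A}$ for the Tree Relaxation problem can be transformed (in polynomial time) into an algorithm $\mathcal{A}'$ for the Rectangulation problem such that for all inputs $X$ of size $n$ we have $\mathcal{A}'(X) = O(\mathcal{A}(X)+n)$.
   Context: Permutation point sets: for a permutation $(x_1,\dots,x_n)$ of $[n]$, $X=\{(x_i,i): i\in[n]\}$ (we also write $x_i$ for the point $(x_i,i)$). An algorithm for a problem takes any permutation point set $X$ and outputs a feasible solution; $\mathcal{A}(X)$ is its cost. Tree Relaxation problem: a monotone tree on $X$ is a rooted tree with vertex set $X$ such that for every edge $\{a,b\}$, $a$ is closer to the root (in graph distance) than $b$ iff $a.y<b.y$ (so $x_1$ is the root). The treap on $X$ is the binary search tree with $x$-coordinates as keys and $y$-coordinates as heap priorities (lowest point is the root, points to its left form the left subtree, points to its right the right subtree, recursively). The path on $X$ connects $x_1,x_2,\dots,x_n$ in this order. A valid edge-flip in a monotone tree $T$: take a vertex $r$ with at least two children, sort its children by $x$-coordinate, and let $a,b$ be two children adjacent in this order with $a.y<b.y$; the edge-flip $(a\to b)$ adds edge $(a,b)$ and removes edge $(r,b)$. An algorithm transforms the treap on $X$ into the path on $X$ by valid edge-flips; its cost is the number of edge-flips. Rectangulation problem: let $S=\{0,\dots,n+1\}^2$, corner points $C=\{(0,0),(0,n+1),(n+1,0),(n+1,n+1)\}$, margin points $M=\{(i,0),(i,n+1),(0,i),(n+1,i): i\in[n]\}$; points of $[n]\times[n]$ are non-margin. A state $(P,L)$ consists of $P\subseteq S\setminus C$ and a set $L$ of horizontal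 and vertical segments with endpoints in $P$. It is valid iff (i) each segment of $L$ contains exactly two points of $P$, its endpoints; (ii) no two segments of $L$ intersect except possibly at endpoints; (iii) each non-margin point of $P$ lies on at least two segments of $L$, and if on exactly two, they have the same orientation. Initial state: $P_0=X\cup M$, $L_0$ contains for each $(x,y)\in X$ the segments $[(x,0),(x,y)]$, $[(x,y),(x,n+1)]$. End state: a valid state $(P^*,L^* )$ with $P^*\supseteq P_0$ and all segments horizontal, covering $\{0,\dots,n+1\}\times[n]$. A flip $\langle a,b\rangle$ ($a,b\in S\setminus C$) sets $P'=P\cup\{a,b\}$, $L'=L\cup\{[a,b]\}$, splitting any segment containing $a$ (resp. $b$) in its interior at $a$ (resp. $b$); it is valid if $[a,b]$ is axis-parallel and the result is valid; afterwards any number of segments may be removed as long as the state stays valid (free of cost). An algorithm transforms the initial state into an end state by valid flips; its cost is the number of flips. *)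

theory Defs
  imports "HOL-Library.Tree" "HOL-Computational_Algebra.Polynomial"
begin

section \<open>Inputs and algorithms\<close>

type_synonym point = "nat \<times> nat"

text \<open>A nonempty permutation of \<open>{1..n}\<close> with \<open>n = length xs\<close>; list positions are shifted by
  one, i.e. the \<open>i\<close>-th entry in mathematical counting is \<open>xs ! (i - 1)\<close>.\<close>

definition is_perm :: "nat list \<Rightarrow> bool" where
  "is_perm xs \<longleftrightarrow> xs \<noteq> [] \<and> distinct xs \<and> set xs = {1..length xs}"

text \<open>The points \<open>(x\<^sub>1,1), (x\<^sub>2,2), \<dots>, (x\<^sub>n,n)\<close>, in order of increasing \<open>y\<close>-coordinate.\<close>

definition points :: "nat list \<Rightarrow> point list" where
  "points xs = zip xs [1..<Suc (length xs)]"

text \<open>\<open>exec step s ms t\<close>: performing the moves \<open>ms\<close> one after the other leads from \<open>s\<close> to \<open>t\<close>.\<close>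

inductive exec :: "('s \<Rightarrow> 'm \<Rightarrow> 's \<Rightarrow> bool) \<Rightarrow> 's \<Rightarrow> 'm list \<Rightarrow> 's \<Rightarrow> bool"
  for step where
  exec_Nil: "exec step s [] s"
| exec_Cons: "step s m s' \<Longrightarrow> exec step s' ms t \<Longrightarrow> exec step s (m # ms) t"


section \<open>Tree Relaxation\<close>

text \<open>A rooted tree is given by its set of edges, each directed from parent to child.\<close>

type_synonym edge = "point \<times> point"

definition rooted_tree :: "point set \<Rightarrow> point \<Rightarrow> edge set \<Rightarrow> bool" where
  "rooted_tree V r E \<longleftrightarrow>
     finite V \<and> r \<in> V \<and> E \<subseteq> V \<times> V \<and>
     (\<forall>p. (p, r) \<notin> E) \<and>
     (\<forall>v \<in> V - {r}. \<exists>!p. (p, v) \<in> E) \<and>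
     (\<forall>v \<in> V. (r, v) \<in> E\<^sup>*)"

definition graph_dist :: "edge set \<Rightarrow> point \<Rightarrow> point \<Rightarrow> nat" where
  "graph_dist E u v = (LEAST k. (u, v) \<in> (E \<union> E\<inverse>) ^^ k)"

definition monotone_tree :: "point set \<Rightarrow> edge set \<Rightarrow> bool" where
  "monotone_tree X E \<longleftrightarrow>
     (\<exists>r. rooted_tree X r E \<and>
          (\<forall>(a, b) \<in> E \<union> E\<inverse>. graph_dist E r a < graph_dist E r b \<longleftrightarrow> snd a < snd b))"

text \<open>The argument list is ordered by \<open>y\<close>-coordinate, so its head is the lowest point.\<close>

fun treap :: "point list \<Rightarrow> point tree" where
  "treap [] = Leaf"
| "treap (p # ps) =
     Node (treap (filter (\<lambda>q. fst q < fst p) ps)) p (treap (filter (\<lambda>q. fst q > fst p) ps))"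

fun root_set :: "'a tree \<Rightarrow> 'a set" where
  "root_set Leaf = {}"
| "root_set (Node l a r) = {a}"

fun tree_edges :: "'a tree \<Rightarrow> ('a \<times> 'a) set" where
  "tree_edges Leaf = {}"
| "tree_edges (Node l a r) = {a} \<times> (root_set l \<union> root_set r) \<union> tree_edges l \<union> tree_edges r"

definition path_edges :: "'a list \<Rightarrow> ('a \<times> 'a) set" where
  "path_edges ps = set (zip ps (tl ps))"

definition edge_flip :: "point set \<Rightarrow> edge set \<Rightarrow> point \<times> point \<Rightarrow> edge set \<Rightarrow> bool" where
  "edge_flip X E = (\<lambda>(a, b) E'.
     monotone_tree X E \<and>
     (\<exists>r. (r, a) \<in> E \<and> (r, b) \<in> E \<and> snd a < snd b \<and>
          (\<nexists>c. (r, c) \<in> E \<and> min (fst a) (fst b) < fst c \<and> fst c < max (fst a) (fst b)) \<and>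
          E' = insert (a, b) E - {(r, b)}))"

text \<open>A solution is the list of its edge-flips \<open>(a \<rightarrow> b)\<close>, written \<open>(a, b)\<close>; its cost is its length.\<close>

definition tree_solution :: "nat list \<Rightarrow> (point \<times> point) list \<Rightarrow> bool" where
  "tree_solution xs fs \<longleftrightarrow>
     exec (edge_flip (set (points xs))) (tree_edges (treap (points xs))) fs
       (path_edges (points xs))"

definition tree_algorithm :: "(nat list \<Rightarrow> (point \<times> point) list) \<Rightarrow> bool" where
  "tree_algorithm A \<longleftrightarrow> (\<forall>xs. is_perm xs \<longrightarrow> tree_solution xs (A xs))"


section \<open>Rectangulation\<close>

text \<open>A segment is the pair of its endpoints, the left (horizontal case) or lower (vertical case)
  endpoint first. It is identified with its set of grid points: endpoints are grid points and
  segments are axis-parallel, so two distinct segments which overlap or cross share a grid point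
  that is not an endpoint of both.\<close>

type_synonym segment = "point \<times> point"

type_synonym state = "point set \<times> segment set"

definition horizontal :: "segment \<Rightarrow> bool" where
  "horizontal = (\<lambda>((x, y), (x', y')). y = y' \<and> x < x')"

definition vertical :: "segment \<Rightarrow> bool" where
  "vertical = (\<lambda>((x, y), (x', y')). x = x' \<and> y < y')"

definition endpoints :: "segment \<Rightarrow> point set" where
  "endpoints s = {fst s, snd s}"

definition seg_points :: "segment \<Rightarrow> point set" where
  "seg_points = (\<lambda>((x, y), (x', y')). {x..x'} \<times> {y..y'})"

definition axis_parallel :: "point \<Rightarrow> point \<Rightarrow> bool" where
  "axis_parallel a b \<longleftrightarrow> a \<noteq> b \<and> (fst a = fst b \<or> snd a = snd b)"

text \<open>The segment \<open>[a, b]\<close> for axis-parallel \<open>a\<close>, \<open>b\<close>.\<close>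

definition mk_seg :: "point \<Rightarrow> point \<Rightarrow> segment" where
  "mk_seg a b = (if fst a < fst b \<or> snd a < snd b then (a, b) else (b, a))"

definition grid :: "nat \<Rightarrow> point set" where
  "grid n = {0..n+1} \<times> {0..n+1}"

definition corners :: "nat \<Rightarrow> point set" where
  "corners n = {(0, 0), (0, n+1), (n+1, 0), (n+1, n+1)}"

definition margin :: "nat \<Rightarrow> point set" where
  "margin n = (\<Union>i\<in>{1..n}. {(i, 0), (i, n+1), (0, i), (n+1, i)})"

definition non_margin :: "nat \<Rightarrow> point set" where
  "non_margin n = {1..n} \<times> {1..n}"

definition valid_state :: "nat \<Rightarrow> state \<Rightarrow> bool" where
  "valid_state n = (\<lambda>(P, L).
     P \<subseteq> grid n - corners n \<and>
     (\<forall>s\<in>L. (horizontal s \<or> vertical s) \<and> endpoints s \<subseteq> P) \<and>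
     (\<forall>s\<in>L. seg_points s \<inter> P = endpoints s) \<and>
     (\<forall>s\<in>L. \<forall>t\<in>L. s \<noteq> t \<longrightarrow> seg_points s \<inter> seg_points t \<subseteq> endpoints s \<inter> endpoints t) \<and>
     (\<forall>p \<in> P \<inter> non_margin n.
        let Lp = {s\<in>L. p \<in> seg_points s}
        in card Lp \<ge> 2 \<and>
           (card Lp = 2 \<longrightarrow> (\<forall>s\<in>Lp. horizontal s) \<or> (\<forall>s\<in>Lp. vertical s))))"

definition init_state :: "nat list \<Rightarrow> state" where
  "init_state xs =
     (let n = length xs; X = set (points xs)
      in (X \<union> margin n,
          (\<Union>(x, y)\<in>X. {((x, 0), (x, y)), ((x, y), (x, n+1))})))"

definition end_state :: "nat list \<Rightarrow> state \<Rightarrow> bool" where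
  "end_state xs = (\<lambda>(P, L).
     valid_state (length xs) (P, L) \<and>
     fst (init_state xs) \<subseteq> P \<and>
     (\<forall>s\<in>L. horizontal s) \<and>
     {0..length xs + 1} \<times> {1..length xs} \<subseteq> (\<Union>s\<in>L. seg_points s))"

definition split_at :: "point \<Rightarrow> segment set \<Rightarrow> segment set" where
  "split_at p L =
     (\<Union>s\<in>L. if p \<in> seg_points s - endpoints s then {(fst s, p), (p, snd s)} else {s})"

definition flip_result :: "state \<Rightarrow> point \<Rightarrow> point \<Rightarrow> state" where
  "flip_result = (\<lambda>(P, L) a b. (P \<union> {a, b}, split_at b (split_at a (insert (mk_seg a b) L))))"

text \<open>A move \<open>(a, b, R)\<close> is the flip \<open>\<langle>a, b\<rangle>\<close> followed by the removal of the segments in \<open>R\<close>.\<close>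

type_synonym rect_move = "point \<times> point \<times> segment list"

definition rect_step :: "nat \<Rightarrow> state \<Rightarrow> rect_move \<Rightarrow> state \<Rightarrow> bool" where
  "rect_step n s = (\<lambda>(a, b, R) s'.
     a \<in> grid n - corners n \<and> b \<in> grid n - corners n \<and> axis_parallel a b \<and>
     (case flip_result s a b of (P, L) \<Rightarrow>
        valid_state n (P, L) \<and> set R \<subseteq> L \<and> s' = (P, L - set R) \<and> valid_state n s'))"

text \<open>The cost of a solution is its number of flips, i.e. the length of the list of moves.\<close>

definition rect_solution :: "nat list \<Rightarrow> rect_move list \<Rightarrow> bool" where
  "rect_solution xs ms \<longleftrightarrow>
     (\<exists>t. exec (rect_step (length xs)) (init_state xs) ms t \<and> end_state xs t)"

definition rect_algorithm :: "(nat list \<Rightarrow> rect_move list) \<Rightarrow> bool" where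
  "rect_algorithm A \<longleftrightarrow> (\<forall>xs. is_perm xs \<longrightarrow> rect_solution xs (A xs))"


section \<open>Polynomial time\<close>

text \<open>
  Running times are measured in a small programming language with bounded loops over binary trees
  whose leaves carry natural numbers. Numbers have their unary size; all numbers occurring in an
  instance of size \<open>n\<close> are at most \<open>n + 1\<close>, so this changes the input size only polynomially.

  Every operation is charged the full size of its argument. Hence a program is simulated by a
  Turing machine with polynomial overhead over \<open>prog_time\<close>. Conversely, a clocked simulation
  by nested loops shows that every polynomial-time function on these trees is computed by some
  program of polynomially bounded \<open>prog_time\<close>.
\<close>

datatype val = Num nat | Pair val val

primrec val_size :: "val \<Rightarrow> nat" where
  "val_size (Num n) = n + 1"
| "val_size (Pair u v) = val_size u + val_size v + 1"

datatype prog =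
    Ident
  | Const nat
  | Succ
  | Pred
  | Less
  | Eq
  | Is_Pair
  | Size
  | First
  | Second
  | Fork prog prog
  | Seq prog prog
  | Cond prog prog prog
  | Loop prog

text \<open>The values over which a loop with bound \<open>v\<close> runs: the elements of the list
  \<open>v = Pair x\<^sub>1 (Pair x\<^sub>2 (\<dots> (Num 0)))\<close>, or the numbers below \<open>n\<close> if \<open>v = Num n\<close>.\<close>

primrec loop_range :: "val \<Rightarrow> val list" where
  "loop_range (Num n) = map Num [0..<n]"
| "loop_range (Pair x xs) = x # loop_range xs"

primrec loop_result :: "(val \<Rightarrow> val) \<Rightarrow> val list \<Rightarrow> val \<Rightarrow> val" where
  "loop_result f [] = (\<lambda>s. s)"
| "loop_result f (x # xs) = (\<lambda>s. loop_result f xs (f (Pair x s)))"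

primrec loop_time :: "(val \<Rightarrow> val) \<Rightarrow> (val \<Rightarrow> nat) \<Rightarrow> val list \<Rightarrow> val \<Rightarrow> nat" where
  "loop_time f t [] = (\<lambda>s. 0)"
| "loop_time f t (x # xs) = (\<lambda>s. t (Pair x s) + loop_time f t xs (f (Pair x s)))"

definition of_truth :: "bool \<Rightarrow> val" where
  "of_truth b = Num (if b then 1 else 0)"

text \<open>Operations applied to an argument of the wrong shape return \<open>Num 0\<close>;
  in conditionals, \<open>Num 0\<close> counts as false and everything else as true.\<close>

primrec run :: "prog \<Rightarrow> val \<Rightarrow> val" where
  "run Ident = (\<lambda>v. v)"
| "run (Const n) = (\<lambda>v. Num n)"
| "run Succ = (\<lambda>v. case v of Num n \<Rightarrow> Num (n + 1) | _ \<Rightarrow> Num 0)"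
| "run Pred = (\<lambda>v. case v of Num n \<Rightarrow> Num (n - 1) | _ \<Rightarrow> Num 0)"
| "run Less = (\<lambda>v. case v of Pair (Num m) (Num n) \<Rightarrow> of_truth (m < n) | _ \<Rightarrow> Num 0)"
| "run Eq = (\<lambda>v. case v of Pair u w \<Rightarrow> of_truth (u = w) | _ \<Rightarrow> Num 0)"
| "run Is_Pair = (\<lambda>v. case v of Pair u w \<Rightarrow> of_truth True | _ \<Rightarrow> of_truth False)"
| "run Size = (\<lambda>v. Num (val_size v))"
| "run First = (\<lambda>v. case v of Pair u w \<Rightarrow> u | _ \<Rightarrow> Num 0)"
| "run Second = (\<lambda>v. case v of Pair u w \<Rightarrow> w | _ \<Rightarrow> Num 0)"
| "run (Fork p q) = (\<lambda>v. Pair (run p v) (run q v))"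
| "run (Seq p q) = (\<lambda>v. run q (run p v))"
| "run (Cond b p q) = (\<lambda>v. if run b v \<noteq> Num 0 then run p v else run q v)"
| "run (Loop p) = (\<lambda>v. case v of Pair xs s \<Rightarrow> loop_result (run p) (loop_range xs) s | _ \<Rightarrow> Num 0)"

primrec prog_time :: "prog \<Rightarrow> val \<Rightarrow> nat" where
  "prog_time Ident = val_size"
| "prog_time (Const n) = val_size"
| "prog_time Succ = val_size"
| "prog_time Pred = val_size"
| "prog_time Less = val_size"
| "prog_time Eq = val_size"
| "prog_time Is_Pair = val_size"
| "prog_time Size = val_size"
| "prog_time First = val_size"
| "prog_time Second = val_size"
| "prog_time (Fork p q) = (\<lambda>v. val_size v + prog_time p v + prog_time q v)"
| "prog_time (Seq p q) = (\<lambda>v. val_size v + prog_time p v + prog_time q (run p v))"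
| "prog_time (Cond b p q) = (\<lambda>v. val_size v + prog_time b v +
     (if run b v \<noteq> Num 0 then prog_time p v else prog_time q v))"
| "prog_time (Loop p) = (\<lambda>v. val_size v +
     (case v of Pair xs s \<Rightarrow> loop_time (run p) (prog_time p) (loop_range xs) s | _ \<Rightarrow> 0))"

primrec enc_list :: "('a \<Rightarrow> val) \<Rightarrow> 'a list \<Rightarrow> val" where
  "enc_list e [] = Num 0"
| "enc_list e (x # xs) = Pair (e x) (enc_list e xs)"

definition enc_pair :: "('a \<Rightarrow> val) \<Rightarrow> ('b \<Rightarrow> val) \<Rightarrow> 'a \<times> 'b \<Rightarrow> val" where
  "enc_pair d e = (\<lambda>(x, y). Pair (d x) (e y))"

definition enc_point :: "point \<Rightarrow> val" where
  "enc_point = enc_pair Num Num"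

definition enc_tree_run :: "nat list \<times> (point \<times> point) list \<Rightarrow> val" where
  "enc_tree_run = enc_pair (enc_list Num) (enc_list (enc_pair enc_point enc_point))"

definition enc_rect_run :: "rect_move list \<Rightarrow> val" where
  "enc_rect_run =
     enc_list (enc_pair enc_point (enc_pair enc_point (enc_list (enc_pair enc_point enc_point))))"

text \<open>The program \<open>p\<close> computes the function \<open>f\<close> on the arguments in \<open>D\<close>, in polynomial time.\<close>

definition computes_in_poly_time ::
    "prog \<Rightarrow> ('a \<Rightarrow> val) \<Rightarrow> ('b \<Rightarrow> val) \<Rightarrow> 'a set \<Rightarrow> ('a \<Rightarrow> 'b) \<Rightarrow> bool" where
  "computes_in_poly_time p d e D f \<longleftrightarrow>
     (\<exists>b :: nat poly. \<forall>x\<in>D. run p (d x) = e (f x) \<and> prog_time p (d x) \<le> poly b (val_size (d x)))"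

text \<open>A solution transformation maps an input together with a Tree Relaxation solution for it to
  a list of Rectangulation moves.\<close>

definition poly_time_transformation ::
    "(nat list \<times> (point \<times> point) list \<Rightarrow> rect_move list) \<Rightarrow> bool" where
  "poly_time_transformation F \<longleftrightarrow>
     (\<exists>p. computes_in_poly_time p enc_tree_run enc_rect_run
            {(xs, fs). is_perm xs \<and> tree_solution xs fs} F)"

end

theory Submission
  imports Defs
begin

text \<open>
  Every row \<open>y\<close> of the grid carries an interval \<open>[l y, r y]\<close> around the point \<open>x y\<close>, and a column \<open>w\<close>
  is a wall, from the highest row crossing it up to the top, as long as some interval ends at \<open>w\<close>.
  Such a family of intervals, in which all rows ending at a column lie above all rows crossing it,
  describes a valid rectangulation state, and extending an interval to the next wall is a single flip.
  The intervals then form a laminar family, hence a tree. Drawing the rows from top to bottom, each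
  up to the nearest lower columns, produces the treap. The edge-flip \<open>(a \<rightarrow> b)\<close> extends row \<open>a\<close> over the
  interval of \<open>b\<close>; since walls supporting no end of a row have been removed, at most two walls are
  crossed. For the path the intervals are nested, and two further flips per row complete all rows.
\<close>

section \<open>Polynomial-time functions\<close>

text \<open>Rows ending at a column lie above those crossing it, so a wall is one ray to the top
  margin with its foot on the highest crossing row or on the bottom margin. For an edge-flip
  \<open>(a \<rightarrow> b)\<close> the same invariant forces every row above the parent and inside
  its interval into the interval of some child; adjacency of \<open>a\<close> and \<open>b\<close>
  then leaves no wall strictly between \<open>r a\<close> and \<open>l b\<close> (if
  \<open>b\<close> is to the right). Walls strictly inside the interval of \<open>b\<close> start at
  row \<open>b\<close> or higher, so row \<open>a\<close> passes below them. Hence the two ends of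
  \<open>b\<close> are the only stops.

  The running time needs a separate argument. Polynomial time is proved for \<open>transform\<close>
  as a total function, hence also on lists that are no permutations and on flips that are not valid;
  the size bounds therefore cannot rest on correctness. The danger is the list of vertical segments,
  which repeated splitting lengthens. Its total length is never increased, and since each segment
  has positive length, this bounds their number.\<close>

class encodable =
  fixes encode :: "'a \<Rightarrow> val"
  assumes inj_encode: "inj encode"

lemma enc_eq_iff [simp]: "encode x = encode y \<longleftrightarrow> x = (y :: 'a :: encodable)"
  using inj_encode by (auto dest: injD)

instantiation nat :: encodable
begin
definition encode_nat :: "nat \<Rightarrow> val" where "encode_nat = Num"
instance by standard (simp add: encode_nat_def inj_def)
end

instantiation bool :: encodable
begin
definition encode_bool :: "bool \<Rightarrow> val" where "encode_bool = of_truth"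
instance by standard (simp add: encode_bool_def of_truth_def inj_def)
end

instantiation prod :: (encodable, encodable) encodable
begin
definition encode_prod :: "'a \<times> 'b \<Rightarrow> val" where "encode_prod = enc_pair encode encode"
instance by standard (simp add: encode_prod_def enc_pair_def inj_def)
end

instantiation list :: (encodable) encodable
begin
definition encode_list :: "'a list \<Rightarrow> val" where "encode_list = enc_list encode"
instance proof
  show "inj (encode :: 'a list \<Rightarrow> val)"
  proof (rule injI)
    fix xs ys :: "'a list"
    show "encode xs = encode ys \<Longrightarrow> xs = ys"
      unfolding encode_list_def
      by (induction xs arbitrary: ys; case_tac ys) auto
  qed
qed
end

lemma enc_simps [simp]:
  "encode n = Num n" "encode b = of_truth b" "encode (x, y) = Pair (encode x) (encode y)"
  "encode [] = Num 0" "encode (z # zs) = Pair (encode z) (encode zs)"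
  by (simp_all add: encode_nat_def encode_bool_def encode_prod_def enc_pair_def encode_list_def)

section \<open>Sizes of encodings and polynomial bounds\<close>

definition size_enc :: "'a :: encodable \<Rightarrow> nat" where
  "size_enc x = val_size (encode x)"

lemma size_enc_simps [simp]:
  "size_enc (n :: nat) = n + 1"
  "size_enc (x, y) = size_enc x + size_enc y + 1"
  "size_enc [] = 1"
  "size_enc (z # zs) = size_enc z + size_enc zs + 1"
  by (simp_all add: size_enc_def)

lemma val_size_pos: "val_size v > 0"
  by (cases v) auto

lemma size_enc_pos [simp]: "size_enc x > 0"
  by (simp add: size_enc_def val_size_pos)

lemma size_enc_append: "size_enc (xs @ ys) + 1 = size_enc xs + size_enc ys"
  by (induction xs) auto

lemma size_enc_mem: "x \<in> set xs \<Longrightarrow> size_enc x < size_enc xs"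
  by (induction xs) auto

lemma length_less_size_enc: "length xs < size_enc xs"
  by (induction xs) auto

lemma size_enc_list_le:
  "(\<And>x. x \<in> set xs \<Longrightarrow> size_enc x \<le> B) \<Longrightarrow> size_enc xs \<le> length xs * (B + 1) + 1"
  by (induction xs) (fastforce simp: algebra_simps)+

definition poly_bounded :: "('a :: encodable \<Rightarrow> nat) \<Rightarrow> bool" where
  "poly_bounded g \<longleftrightarrow> (\<exists>b :: nat poly. \<forall>x. g x \<le> poly b (size_enc x))"

lemma poly_nat_mono: "x \<le> y \<Longrightarrow> poly p x \<le> poly (p :: nat poly) y"
  by (induction p) (auto intro!: add_mono mult_mono)

lemma poly_bounded_mono:
  "poly_bounded g \<Longrightarrow> (\<And>x. f x \<le> g x) \<Longrightarrow> poly_bounded f"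
  unfolding poly_bounded_def by (meson le_trans)

lemma poly_bounded_const [intro]: "poly_bounded (\<lambda>x. c)"
  unfolding poly_bounded_def by (rule exI[of _ "[:c:]"]) simp

lemma poly_bounded_size [intro]: "poly_bounded size_enc"
  unfolding poly_bounded_def by (rule exI[of _ "[:0, 1:]"]) simp

lemma poly_bounded_add [intro]:
  assumes "poly_bounded f" "poly_bounded g"
  shows "poly_bounded (\<lambda>x. f x + g x)"
proof -
  from assms obtain b c :: "nat poly" where
    "\<And>x. f x \<le> poly b (size_enc x)" "\<And>x. g x \<le> poly c (size_enc x)"
    unfolding poly_bounded_def by blast
  then show ?thesis
    unfolding poly_bounded_def by (intro exI[of _ "b + c"]) (simp add: add_mono)
qed

lemma poly_bounded_mult [intro]:
  assumes "poly_bounded f" "poly_bounded g"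
  shows "poly_bounded (\<lambda>x. f x * g x)"
proof -
  from assms obtain b c :: "nat poly" where
    "\<And>x. f x \<le> poly b (size_enc x)" "\<And>x. g x \<le> poly c (size_enc x)"
    unfolding poly_bounded_def by blast
  then show ?thesis
    unfolding poly_bounded_def by (intro exI[of _ "b * c"]) (simp add: mult_mono)
qed

lemma poly_bounded_poly [intro]:
  assumes "poly_bounded f"
  shows "poly_bounded (\<lambda>x. poly (c :: nat poly) (f x))"
proof -
  from assms obtain b :: "nat poly" where "\<And>x. f x \<le> poly b (size_enc x)"
    unfolding poly_bounded_def by blast
  then show ?thesis
    unfolding poly_bounded_def
    by (intro exI[of _ "pcompose c b"]) (simp add: poly_pcompose poly_nat_mono)
qed

lemmas poly_bounded_intros =
  poly_bounded_const poly_bounded_size poly_bounded_add poly_bounded_mult poly_bounded_poly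

text \<open>The bound is demanded on the whole type rather than on a domain, so that closure under
  composition has no side conditions. The price is that all size estimates must cover malformed
  inputs too.\<close>

definition ptime :: "('a :: encodable \<Rightarrow> 'b :: encodable) \<Rightarrow> bool" where
  "ptime f \<longleftrightarrow>
     (\<exists>p. (\<forall>x. run p (encode x) = encode (f x)) \<and> poly_bounded (\<lambda>x :: 'a. prog_time p (encode x)))"

lemma ptimeI:
  fixes f :: "'a :: encodable \<Rightarrow> 'b :: encodable" and g :: "'a \<Rightarrow> nat"
  assumes "\<And>x. run p (encode x) = encode (f x)" "\<And>x :: 'a. prog_time p (encode x) \<le> g x" "poly_bounded g"
  shows "ptime f"
  unfolding ptime_def using assms poly_bounded_mono[of g "\<lambda>x. prog_time p (encode x)"] by blast

lemma val_size_loop_result: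
  assumes "\<And>v. val_size (f v) \<le> c * t v"
  shows "val_size (loop_result f xs s) \<le> val_size s + c * loop_time f t xs s"
proof (induction xs arbitrary: s)
  case (Cons x xs)
  show ?case
    using Cons[of "f (Pair x s)"] assms[of "Pair x s"] by (simp add: algebra_simps)
qed simp

text \<open>Every operation is charged the size of its argument, so a program cannot output more
  than a constant multiple of what it has paid. The running time thereby controls the size of the
  result, which is the input size of the next program in a composition.\<close>

lemma val_size_run: "\<exists>c>0. \<forall>v. val_size (run p v) \<le> c * prog_time p v"
proof (induction p)
  case (Const n)
  show ?case
  proof (intro exI[of _ "n + 1"] conjI allI)
    fix v show "val_size (run (Const n) v) \<le> (n + 1) * prog_time (Const n) v"
      using val_size_pos[of v] by (cases "val_size v") auto
  qed simp
next
  case Size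
  show ?case
  proof (intro exI[of _ 2] conjI allI)
    fix v show "val_size (run Size v) \<le> 2 * prog_time Size v"
      using val_size_pos[of v] by simp
  qed simp
next
  case (Fork p q)
  then obtain c d where "c > 0" "d > 0" and
    cd: "\<And>v. val_size (run p v) \<le> c * prog_time p v" "\<And>v. val_size (run q v) \<le> d * prog_time q v"
    by blast
  show ?case
  proof (intro exI[of _ "c + d + 1"] conjI allI)
    fix v show "val_size (run (Fork p q) v) \<le> (c + d + 1) * prog_time (Fork p q) v"
      using cd[of v] val_size_pos[of v] by (simp add: algebra_simps)
  qed simp
next
  case (Seq p q)
  then obtain d where "d > 0" and
    d: "\<And>v. val_size (run q v) \<le> d * prog_time q v"
    by blast
  show ?case
  proof (intro exI[of _ d] conjI allI)
    fix v show "val_size (run (Seq p q) v) \<le> d * prog_time (Seq p q) v"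
      using d[of "run p v"] by (simp add: algebra_simps)
  qed (use \<open>d > 0\<close> in simp)
next
  case (Cond b p q)
  then obtain c d where "c > 0" "d > 0" and
    cd: "\<And>v. val_size (run p v) \<le> c * prog_time p v" "\<And>v. val_size (run q v) \<le> d * prog_time q v"
    by blast
  show ?case
  proof (intro exI[of _ "c + d"] conjI allI)
    fix v show "val_size (run (Cond b p q) v) \<le> (c + d) * prog_time (Cond b p q) v"
      using cd[of v] by (simp add: algebra_simps)
  qed (use \<open>d > 0\<close> in simp)
next
  case (Loop p)
  then obtain c where "c > 0" and c: "\<And>v. val_size (run p v) \<le> c * prog_time p v"
    by blast
  show ?case
  proof (intro exI[of _ "c + 1"] conjI allI)
    fix v show "val_size (run (Loop p) v) \<le> (c + 1) * prog_time (Loop p) v"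
    proof (cases v)
      case (Pair xs s)
      then show ?thesis
        using val_size_loop_result[of "run p" c "prog_time p" "loop_range xs" s] c
        by (simp add: algebra_simps)
    qed simp
  qed simp
qed (rule exI[of _ 1]; auto split: val.splits simp: of_truth_def val_size_pos Suc_leI; fail |
     rule exI[of _ 2]; auto split: val.splits simp: of_truth_def val_size_pos Suc_leI; fail)+

text \<open>Scaling the time bound by the constant of \<open>val_size_run\<close> gives a single
  polynomial that bounds running time and output size at once.\<close>

lemma ptime_obtain:
  fixes f :: "'a :: encodable \<Rightarrow> 'b :: encodable"
  assumes "ptime f"
  obtains p b where "\<And>x. run p (encode x) = encode (f x)"
    "\<And>x :: 'a. prog_time p (encode x) \<le> poly b (size_enc x)" "\<And>x. size_enc (f x) \<le> poly b (size_enc x)"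
proof -
  from assms obtain p b where p: "\<And>x. run p (encode x) = encode (f x)"
    and b: "\<And>x :: 'a. prog_time p (encode x) \<le> poly b (size_enc x)"
    unfolding ptime_def poly_bounded_def by blast
  from val_size_run[of p] obtain c where "c > 0"
    and c: "\<And>v. val_size (run p v) \<le> c * prog_time p v" by blast
  have "prog_time p (encode x) \<le> poly (smult c b) (size_enc x)" for x :: 'a
  proof -
    have "prog_time p (encode x) \<le> c * poly b (size_enc x)"
      using b[of x] \<open>c > 0\<close> by (cases c) auto
    then show ?thesis by simp
  qed
  moreover have "size_enc (f x) \<le> poly (smult c b) (size_enc x)" for x :: 'a
    using order_trans[OF c[of "encode x"] mult_le_mono2[OF b[of x]]] by (simp add: p size_enc_def)
  ultimately show ?thesis
    using p that by blast
qed

lemma poly_bounded_comp: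
  fixes f :: "'a :: encodable \<Rightarrow> 'b :: encodable"
  assumes "ptime f" "poly_bounded g"
  shows "poly_bounded (\<lambda>x. g (f x))"
proof -
  from assms(1) obtain b where b: "\<And>x. size_enc (f x) \<le> poly b (size_enc x)"
    by (rule ptime_obtain) blast
  from assms(2) obtain c where c: "\<And>x. g x \<le> poly c (size_enc x)"
    unfolding poly_bounded_def by blast
  have "g (f x) \<le> poly (pcompose c b) (size_enc x)" for x :: 'a
    using c[of "f x"] poly_nat_mono[OF b[of x], of c] by (simp add: poly_pcompose)
  then show ?thesis
    unfolding poly_bounded_def by blast
qed

lemmas poly_bounded_size_comp = poly_bounded_comp[OF _ poly_bounded_size]

section \<open>Closure properties: composition, basic operations and case distinction\<close>

lemma ptime_id: "ptime (\<lambda>x. x)"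
  by (rule ptimeI[of Ident _ size_enc]) (auto simp: size_enc_def)

lemma ptime_comp:
  fixes f :: "'a :: encodable \<Rightarrow> 'b :: encodable" and g :: "'b \<Rightarrow> 'c :: encodable"
  assumes "ptime f" "ptime g"
  shows "ptime (\<lambda>x. g (f x))"
proof -
  obtain p b where p: "\<And>x. run p (encode x) = encode (f x)"
    "\<And>x :: 'a. prog_time p (encode x) \<le> poly b (size_enc x)" "\<And>x. size_enc (f x) \<le> poly b (size_enc x)"
    using assms(1) by (rule ptime_obtain) blast
  obtain q c where q: "\<And>x. run q (encode x) = encode (g x)"
    "\<And>x :: 'b. prog_time q (encode x) \<le> poly c (size_enc x)"
    using assms(2) by (rule ptime_obtain) blast
  show ?thesis
  proof (rule ptimeI)
    show "run (Seq p q) (encode x) = encode (g (f x))" for x :: 'a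
      by (simp add: p q)
    show "prog_time (Seq p q) (encode x) \<le>
        size_enc x + poly b (size_enc x) + poly c (poly b (size_enc x))" for x :: 'a
      using p(2)[of x] order_trans[OF q(2)[of "f x"] poly_nat_mono[OF p(3)[of x]]]
      by (simp add: p(1) size_enc_def)
  qed (intro poly_bounded_intros)
qed

lemma ptime_nat: "ptime (\<lambda>x. n :: nat)"
  by (rule ptimeI[of "Const n" _ size_enc]) (auto simp: size_enc_def)

lemma ptime_Nil: "ptime (\<lambda>x. [])"
  by (rule ptimeI[of "Const 0" _ size_enc]) (auto simp: size_enc_def)

lemma ptime_bool: "ptime (\<lambda>x. b :: bool)"
  by (rule ptimeI[of "Const (if b then 1 else 0)" _ size_enc])
    (auto simp: size_enc_def of_truth_def)

lemma ptime_Pair: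
  fixes f :: "'a :: encodable \<Rightarrow> 'b :: encodable" and g :: "'a \<Rightarrow> 'c :: encodable"
  assumes "ptime f" "ptime g"
  shows "ptime (\<lambda>x. (f x, g x))"
proof -
  obtain p b where p: "\<And>x. run p (encode x) = encode (f x)"
    "\<And>x :: 'a. prog_time p (encode x) \<le> poly b (size_enc x)"
    using assms(1) by (rule ptime_obtain) blast
  obtain q c where q: "\<And>x. run q (encode x) = encode (g x)"
    "\<And>x :: 'a. prog_time q (encode x) \<le> poly c (size_enc x)"
    using assms(2) by (rule ptime_obtain) blast
  show ?thesis
  proof (rule ptimeI)
    show "run (Fork p q) (encode x) = encode (f x, g x)" for x :: 'a
      by (simp add: p q)
    show "prog_time (Fork p q) (encode x) \<le>
        size_enc x + poly b (size_enc x) + poly c (size_enc x)" for x :: 'a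
      using p(2)[of x] q(2)[of x] by (simp add: size_enc_def)
  qed (intro poly_bounded_intros)
qed

lemma ptime_fst: "ptime f \<Longrightarrow> ptime (\<lambda>x. fst (f x))"
  by (rule ptime_comp[of f fst], assumption, rule ptimeI[of First _ size_enc])
    (auto simp: size_enc_def)

lemma ptime_snd: "ptime f \<Longrightarrow> ptime (\<lambda>x. snd (f x))"
  by (rule ptime_comp[of f snd], assumption, rule ptimeI[of Second _ size_enc])
    (auto simp: size_enc_def)

lemma ptime_Suc: "ptime f \<Longrightarrow> ptime (\<lambda>x. Suc (f x))"
  by (rule ptime_comp[of f Suc], assumption, rule ptimeI[of Succ _ size_enc])
    (auto simp: size_enc_def)

text \<open>A list cell and a pair have the same encoding, so the program for pairs serves
  unchanged.\<close>

lemma ptime_Cons: "ptime f \<Longrightarrow> ptime g \<Longrightarrow> ptime (\<lambda>x. f x # g x)"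
  using ptime_Pair[of f g] by (simp add: ptime_def)

lemma ptime_less:
  "ptime f \<Longrightarrow> ptime g \<Longrightarrow> ptime (\<lambda>x. f x < (g x :: nat))"
  using ptime_comp[of "\<lambda>x. (f x, g x)" "\<lambda>(m, n). m < n"] ptime_Pair[of f g]
    ptimeI[of Less "\<lambda>(m, n). m < (n :: nat)" size_enc]
  by (auto simp: size_enc_def poly_bounded_size)

text \<open>The program compares encodings; injectivity of \<open>encode\<close> makes this a
  comparison of the arguments.\<close>

lemma ptime_eq:
  "ptime f \<Longrightarrow> ptime g \<Longrightarrow> ptime (\<lambda>x. f x = g x)"
  using ptime_comp[of "\<lambda>x. (f x, g x)" "\<lambda>(m, n). m = n"] ptime_Pair[of f g]
    ptimeI[of Eq "\<lambda>(m, n). m = n" size_enc]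
  by (auto simp: size_enc_def poly_bounded_size)

lemma ptime_If:
  fixes f g :: "'a :: encodable \<Rightarrow> 'b :: encodable"
  assumes "ptime t" "ptime f" "ptime g"
  shows "ptime (\<lambda>x. if t x then f x else g x)"
proof -
  obtain r a where r: "\<And>x. run r (encode x) = encode (t x)"
    "\<And>x :: 'a. prog_time r (encode x) \<le> poly a (size_enc x)"
    using assms(1) by (rule ptime_obtain) blast
  obtain p b where p: "\<And>x. run p (encode x) = encode (f x)"
    "\<And>x :: 'a. prog_time p (encode x) \<le> poly b (size_enc x)"
    using assms(2) by (rule ptime_obtain) blast
  obtain q c where q: "\<And>x. run q (encode x) = encode (g x)"
    "\<And>x :: 'a. prog_time q (encode x) \<le> poly c (size_enc x)"
    using assms(3) by (rule ptime_obtain) blast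
  show ?thesis
  proof (rule ptimeI)
    show "run (Cond r p q) (encode x) = encode (if t x then f x else g x)" for x :: 'a
      by (simp add: p q r of_truth_def)
    show "prog_time (Cond r p q) (encode x) \<le>
        size_enc x + poly a (size_enc x) + poly b (size_enc x) + poly c (size_enc x)" for x :: 'a
      using p(2)[of x] q(2)[of x] r(2)[of x] by (simp add: size_enc_def)
  qed (intro poly_bounded_intros)
qed

lemma ptime_Not: "ptime f \<Longrightarrow> ptime (\<lambda>x. \<not> f x)"
  using ptime_If[of f "\<lambda>x. False" "\<lambda>x. True"] by (simp add: ptime_bool if_bool_eq_conj)

lemma ptime_conj:
  assumes "ptime f" "ptime g"
  shows "ptime (\<lambda>x. f x \<and> g x)"
proof -
  have "(\<lambda>x. f x \<and> g x) = (\<lambda>x. if f x then g x else False)" by auto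
  then show ?thesis
    by (simp only:) (intro ptime_If assms ptime_bool)
qed

lemma ptime_disj: "ptime f \<Longrightarrow> ptime g \<Longrightarrow> ptime (\<lambda>x. f x \<or> g x)"
  using ptime_Not[OF ptime_conj[OF ptime_Not ptime_Not, of f g]] by simp

lemma ptime_max:
  assumes "ptime f" "ptime g"
  shows "ptime (\<lambda>x. max (f x) (g x :: nat))"
proof -
  have "(\<lambda>x. max (f x) (g x)) = (\<lambda>x. if f x < g x then g x else f x)" by auto
  then show ?thesis
    by (simp only:) (intro ptime_If ptime_less assms)
qed

lemma ptime_min:
  assumes "ptime f" "ptime g"
  shows "ptime (\<lambda>x. min (f x) (g x :: nat))"
proof -
  have "(\<lambda>x. min (f x) (g x)) = (\<lambda>x. if f x < g x then f x else g x)" by auto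
  then show ?thesis
    by (simp only:) (intro ptime_If ptime_less assms)
qed

section \<open>Bounded loops as folds, and the list operations obtained from them\<close>

lemma loop_result_fold:
  assumes "\<And>a s. run p (Pair (encode a) (Pair (encode x) (encode s))) =
    Pair (encode x) (encode (step a s))"
  shows "loop_result (run p) (loop_range (encode xs)) (Pair (encode x) (encode s)) =
    Pair (encode x) (encode (fold step xs s))"
  by (induction xs arbitrary: s) (simp_all add: assms)

lemma loop_time_fold:
  assumes run: "\<And>a s. run p (Pair (encode a) (Pair (encode x) (encode s))) =
      Pair (encode x) (encode (step a s))"
    and time: "\<And>k a s. I k s \<Longrightarrow> k < m \<Longrightarrow> a \<in> set xs \<Longrightarrow>
      prog_time p (Pair (encode a) (Pair (encode x) (encode s))) \<le> B"
    and inv: "\<And>k a s. I k s \<Longrightarrow> k < m \<Longrightarrow> a \<in> set xs \<Longrightarrow> I (Suc k) (step a s)"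
    and "I k s" "k + length xs \<le> m"
  shows "loop_time (run p) (prog_time p) (loop_range (encode xs)) (Pair (encode x) (encode s))
      \<le> length xs * B"
  using time inv assms(4,5)
proof (induction xs arbitrary: s k)
  case (Cons a xs)
  have "loop_time (run p) (prog_time p) (loop_range (encode xs))
      (Pair (encode x) (encode (step a s))) \<le> length xs * B"
    by (rule Cons.IH[of "Suc k"]) (use Cons.prems in auto)
  moreover have "prog_time p (Pair (encode a) (Pair (encode x) (encode s))) \<le> B"
    using Cons.prems by auto
  ultimately show ?case by (simp add: run)
qed simp

text \<open>Polynomially many polynomial-time steps may still build exponentially large values, for
  instance by doubling the accumulator. The invariant \<open>I\<close>, indexed by the number of
  completed steps, exists to bound every intermediate accumulator by \<open>g x\<close>.\<close>

lemma ptime_fold: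
  fixes xs :: "'b :: encodable \<Rightarrow> 'a :: encodable list" and s0 :: "'b \<Rightarrow> 's :: encodable"
  assumes xs: "ptime xs" and s0: "ptime s0"
    and step: "ptime (\<lambda>y. step (fst (snd y)) (fst y) (snd (snd y)))"
    and init: "\<And>x. I x 0 (s0 x)"
    and inv: "\<And>x k a s. I x k s \<Longrightarrow> k < length (xs x) \<Longrightarrow> a \<in> set (xs x) \<Longrightarrow> I x (Suc k) (step x a s)"
    and bound: "\<And>x k s. I x k s \<Longrightarrow> k \<le> length (xs x) \<Longrightarrow> size_enc s \<le> g x"
    and g: "poly_bounded g"
  shows "ptime (\<lambda>x. fold (step x) (xs x) (s0 x))"
proof -
  obtain p b where p: "\<And>x. run p (encode x) = encode (xs x)"
    "\<And>x :: 'b. prog_time p (encode x) \<le> poly b (size_enc x)"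
    "\<And>x. size_enc (xs x) \<le> poly b (size_enc x)"
    using xs by (rule ptime_obtain) blast
  obtain q c where q: "\<And>x. run q (encode x) = encode (s0 x)"
    "\<And>x :: 'b. prog_time q (encode x) \<le> poly c (size_enc x)"
    "\<And>x. size_enc (s0 x) \<le> poly c (size_enc x)"
    using s0 by (rule ptime_obtain) blast
  obtain r d where r: "\<And>y. run r (encode y) = encode (step (fst (snd y)) (fst y) (snd (snd y)))"
    "\<And>y :: 'a \<times> 'b \<times> 's. prog_time r (encode y) \<le> poly d (size_enc y)"
    using step by (rule ptime_obtain) blast
  \<comment> \<open>A loop body sees only the current element and the loop state, so the state
    carries the input \<open>x\<close> along; \<open>Seq Second First\<close> copies it.\<close>
  define body where "body = Fork (Seq Second First) r"
  define M where "M x = poly b (size_enc x) + size_enc x + g x + 2" for x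
  \<comment> \<open>The bookkeeping in \<open>body\<close> costs at most four times the size of its
    argument; the polynomial term pays for one run of \<open>r\<close>.\<close>
  define B where "B x = 5 * M x + poly d (M x)" for x
  have run: "run body (Pair (encode a) (Pair (encode x) (encode s))) =
      Pair (encode x) (encode (step x a s))" for x a s
    using r(1)[of "(a, x, s)"] by (simp add: body_def)
  have time: "prog_time body (Pair (encode a) (Pair (encode x) (encode s))) \<le> B x"
    if "I x k s" "k < length (xs x)" "a \<in> set (xs x)" for x k a s
  proof -
    have "size_enc (a, x, s) \<le> M x"
      using size_enc_mem[OF that(3)] p(3)[of x] bound[of x k s] that by (simp add: M_def)
    then have "prog_time r (encode (a, x, s)) \<le> poly d (M x)"
      and "val_size (encode (a, x, s)) \<le> M x"
      using order_trans[OF r(2) poly_nat_mono] by (auto simp only: size_enc_def)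
    then show ?thesis
      by (simp add: body_def B_def)
  qed
  show ?thesis
  proof (rule ptimeI)
    fix x :: 'b
    let ?q = "Seq (Seq (Fork p (Fork Ident q)) (Loop body)) Second"
    have result: "loop_result (run body) (loop_range (encode (xs x)))
          (Pair (encode x) (encode (s0 x))) =
        Pair (encode x) (encode (fold (step x) (xs x) (s0 x)))"
      by (rule loop_result_fold) (rule run)
    then show "run ?q (encode x) = encode (fold (step x) (xs x) (s0 x))"
      by (simp add: p q)
    have "I x (length (xs x)) (fold (step x) (xs x) (s0 x))"
    proof -
      have "I x (k + length ys) (fold (step x) ys s)"
        if "I x k s" "k + length ys \<le> length (xs x)" "set ys \<subseteq> set (xs x)" for k ys s
        using that
      proof (induction ys arbitrary: k s)
        case (Cons a ys)
        then show ?case using Cons.IH[of "Suc k"] inv[of x k s a] by simp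
      qed simp
      from this[of 0 "s0 x" "xs x"] show ?thesis using init by simp
    qed
    then have "size_enc (fold (step x) (xs x) (s0 x)) \<le> g x"
      using bound by blast
    moreover
    {
      have "loop_time (run body) (prog_time body) (loop_range (encode (xs x)))
          (Pair (encode x) (encode (s0 x))) \<le> length (xs x) * B x"
        by (rule loop_time_fold[where I = "I x" and m = "length (xs x)" and k = 0 and step = "step x"])
          (auto simp: init run intro: time inv)
      also have "\<dots> \<le> poly b (size_enc x) * B x"
        using length_less_size_enc[of "xs x"] p(3)[of x] by (intro mult_right_mono) auto
      finally have "loop_time (run body) (prog_time body) (loop_range (encode (xs x)))
          (Pair (encode x) (encode (s0 x))) \<le> \<dots>" .
    }
    ultimately show "prog_time ?q (encode x) \<le>
        9 * size_enc x + 3 * poly b (size_enc x) + 3 * poly c (size_enc x) + g x +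
        poly b (size_enc x) * B x + 9"
      using p(2,3)[of x] q(2,3)[of x] by (simp add: p(1) q(1) result size_enc_def)
  qed (unfold B_def M_def, intro poly_bounded_intros g poly_bounded_size[simplified])
qed

lemma ptime_rev: 
  assumes "ptime f"
  shows "ptime (\<lambda>x. rev (f x))"
proof -
  have "ptime (\<lambda>x. fold (#) (f x) [])"
  proof (rule ptime_fold[where I = "\<lambda>x k s. length s \<le> k \<and> set s \<subseteq> set (f x)"
        and g = "\<lambda>x. size_enc (f x) * (size_enc (f x) + 1) + 1"])
    fix x k and s :: "'b list"
    assume s: "length s \<le> k \<and> set s \<subseteq> set (f x)" "k \<le> length (f x)"
    then have "size_enc s \<le> length s * (size_enc (f x) + 1) + 1"
      by (intro size_enc_list_le) (meson less_imp_le size_enc_mem subsetD)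
    also have "\<dots> \<le> size_enc (f x) * (size_enc (f x) + 1) + 1"
      using s length_less_size_enc[of "f x"] by (intro add_right_mono mult_right_mono) auto
    finally show "size_enc s \<le> \<dots>" .
  qed (intro assms ptime_Nil ptime_Cons ptime_fst ptime_snd ptime_id poly_bounded_intros
      poly_bounded_size_comp | force)+
  then show ?thesis
    by (simp add: fold_Cons_rev)
qed

lemma ptime_append:
  assumes "ptime f" "ptime g"
  shows "ptime (\<lambda>x. f x @ g x)"
proof -
  have "ptime (\<lambda>x. fold (#) (rev (f x)) (g x))"
  proof (rule ptime_fold[where I = "\<lambda>x k s. size_enc s \<le> k * (size_enc (f x) + 1) + size_enc (g x)"
        and g = "\<lambda>x. size_enc (f x) * (size_enc (f x) + 1) + size_enc (g x)"])
    fix x k and s :: "'b list"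
    assume s: "size_enc s \<le> k * (size_enc (f x) + 1) + size_enc (g x)" "k \<le> length (rev (f x))"
    have "k * (size_enc (f x) + 1) \<le> size_enc (f x) * (size_enc (f x) + 1)"
      using s(2) length_less_size_enc[of "f x"] by (intro mult_right_mono) auto
    then show "size_enc s \<le> size_enc (f x) * (size_enc (f x) + 1) + size_enc (g x)"
      using s(1) by simp
  next
    fix x k a and s :: "'b list"
    assume "a \<in> set (rev (f x))"
    then have "size_enc a < size_enc (f x)" by (auto intro: size_enc_mem)
    moreover assume "size_enc s \<le> k * (size_enc (f x) + 1) + size_enc (g x)"
    ultimately show "size_enc (a # s) \<le> Suc k * (size_enc (f x) + 1) + size_enc (g x)"
      by simp
  qed (intro assms ptime_rev ptime_Cons ptime_fst ptime_snd ptime_id poly_bounded_intros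
      poly_bounded_size_comp | simp)+
  then show ?thesis
    by (simp add: fold_Cons_rev)
qed

text \<open>Elements of \<open>xs x\<close> are smaller than the list itself, so one bound
  \<open>B x\<close> serves all pieces and the accumulator grows linearly. Maps, filters and
  existence tests are instances and need no further size estimate.\<close>

lemma ptime_concat_map:
  fixes f :: "'a :: encodable \<Rightarrow> 'b :: encodable \<Rightarrow> 'c :: encodable list"
  assumes "ptime xs" "ptime (\<lambda>y. f (snd y) (fst y))"
  shows "ptime (\<lambda>x. concat (map (f x) (xs x)))"
proof -
  obtain b where b: "\<And>y. size_enc (f (snd y) (fst y)) \<le> poly b (size_enc (y :: 'b \<times> 'a))"
    using assms(2) by (rule ptime_obtain) blast
  define B where "B x = poly b (size_enc (xs x) + size_enc x)" for x
  have B: "size_enc (f x a) \<le> B x" if "a \<in> set (xs x)" for x a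
    using b[of "(a, x)"] poly_nat_mono[of "size_enc (a, x)" "size_enc (xs x) + size_enc x" b]
      size_enc_mem[OF that] by (simp add: B_def)
  have "ptime (\<lambda>x. fold (\<lambda>a s. s @ f x a) (xs x) [])"
  proof (rule ptime_fold[where I = "\<lambda>x k s. size_enc s \<le> k * B x + 1"
        and g = "\<lambda>x. size_enc (xs x) * B x + 1"])
    fix x k and s :: "'c list"
    assume s: "size_enc s \<le> k * B x + 1" "k \<le> length (xs x)"
    have "k * B x \<le> size_enc (xs x) * B x"
      using s(2) length_less_size_enc[of "xs x"] by (intro mult_right_mono) auto
    then show "size_enc s \<le> size_enc (xs x) * B x + 1"
      using s(1) by linarith
  next
    fix x k a and s :: "'c list"
    assume "a \<in> set (xs x)" "size_enc s \<le> k * B x + 1"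
    then show "size_enc (s @ f x a) \<le> Suc k * B x + 1"
      using B[of a x] size_enc_append[of s "f x a"] by simp
  next
    have "ptime (\<lambda>y :: 'b \<times> 'a \<times> 'c list. f (snd (fst y, fst (snd y))) (fst (fst y, fst (snd y))))"
      by (rule ptime_comp[OF _ assms(2)]) (intro ptime_Pair ptime_fst ptime_snd ptime_id)
    then show "ptime (\<lambda>y :: 'b \<times> 'a \<times> 'c list. snd (snd y) @ f (fst (snd y)) (fst y))"
      by (intro ptime_append ptime_snd ptime_id) simp
    show "poly_bounded (\<lambda>x. size_enc (xs x) * B x + 1)"
      unfolding B_def by (intro assms poly_bounded_intros poly_bounded_size_comp)
  qed (intro assms ptime_Nil | simp)+
  moreover have "fold (\<lambda>a s. s @ f x a) ys s = s @ concat (map (f x) ys)" for x ys s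
    by (induction ys arbitrary: s) auto
  ultimately show ?thesis by simp
qed

lemma ptime_map:
  assumes "ptime xs" "ptime (\<lambda>y. f (snd y) (fst y))"
  shows "ptime (\<lambda>x. map (f x) (xs x))"
proof -
  have "map (f x) (xs x) = concat (map (\<lambda>a. [f x a]) (xs x))" for x by simp
  then show ?thesis
    by (simp only:) (intro ptime_concat_map ptime_Cons ptime_Nil assms)
qed

lemma ptime_filter:
  assumes "ptime xs" "ptime (\<lambda>y. P (snd y) (fst y))"
  shows "ptime (\<lambda>x. filter (P x) (xs x))"
proof -
  have "filter (P x) ys = concat (map (\<lambda>a. if P x a then [a] else []) ys)" for x ys
    by (induction ys) auto
  then show ?thesis
    by (simp only:) (intro ptime_concat_map ptime_Cons ptime_Nil ptime_If ptime_fst ptime_id assms)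
qed

lemma ptime_list_ex:
  assumes "ptime xs" "ptime (\<lambda>y. P (snd y) (fst y))"
  shows "ptime (\<lambda>x. list_ex (P x) (xs x))"
proof -
  have "list_ex (P x) (xs x) \<longleftrightarrow> filter (P x) (xs x) \<noteq> []" for x
    by (simp add: list_ex_iff filter_empty_conv)
  then show ?thesis
    by (simp only:) (intro ptime_Not ptime_eq ptime_filter ptime_Nil assms)
qed

lemma ptime_fold_max:
  assumes "ptime xs" "ptime m"
  shows "ptime (\<lambda>x. fold max (xs x) (m x :: nat))"
  by (rule ptime_fold[where I = "\<lambda>x k s. s < size_enc (xs x) + size_enc (m x)"
        and g = "\<lambda>x. size_enc (xs x) + size_enc (m x)"])
    (intro assms ptime_max ptime_fst ptime_snd ptime_id poly_bounded_intros poly_bounded_size_comp |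
      fastforce dest: size_enc_mem)+

lemma ptime_fold_min:
  assumes "ptime xs" "ptime m"
  shows "ptime (\<lambda>x. fold min (xs x) (m x :: nat))"
  by (rule ptime_fold[where I = "\<lambda>x k s. s < size_enc (m x)" and g = "\<lambda>x. size_enc (m x)"])
    (intro assms ptime_min ptime_fst ptime_snd ptime_id poly_bounded_intros poly_bounded_size_comp |
      simp add: min_less_iff_disj)+

section \<open>Laminar families of intervals\<close>

definition touches :: "nat set \<Rightarrow> (nat \<Rightarrow> 'a :: linorder) \<Rightarrow> (nat \<Rightarrow> 'a) \<Rightarrow> 'a \<Rightarrow> nat \<Rightarrow> bool" where
  "touches Y l r w y \<longleftrightarrow> y \<in> Y \<and> (l y = w \<or> r y = w)"

definition crosses :: "nat set \<Rightarrow> (nat \<Rightarrow> 'a :: linorder) \<Rightarrow> (nat \<Rightarrow> 'a) \<Rightarrow> 'a \<Rightarrow> nat \<Rightarrow> bool" where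
  "crosses Y l r w y \<longleftrightarrow> y \<in> Y \<and> l y < w \<and> w < r y"

definition nested :: "(nat \<Rightarrow> 'a :: linorder) \<Rightarrow> (nat \<Rightarrow> 'a) \<Rightarrow> nat \<Rightarrow> nat \<Rightarrow> bool" where
  "nested l r v u \<longleftrightarrow> l u \<le> l v \<and> r v \<le> r u"

text \<open>Intervals of different rows may coincide, so inclusion alone is no strict order; the
  heights decide which row is the ancestor.\<close>

definition parent :: "nat set \<Rightarrow> (nat \<Rightarrow> 'a :: linorder) \<Rightarrow> (nat \<Rightarrow> 'a) \<Rightarrow> nat \<Rightarrow> nat \<Rightarrow> bool" where
  "parent Y l r u v \<longleftrightarrow> u \<in> Y \<and> v \<in> Y \<and> u < v \<and> nested l r v u \<and>
     (\<forall>w\<in>Y. u < w \<and> w < v \<longrightarrow> \<not> nested l r v w)"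

lemma parent_unique: "parent Y l r u v \<Longrightarrow> parent Y l r u' v \<Longrightarrow> u = u'"
  unfolding parent_def by (metis linorder_neqE_nat)

text \<open>Ends are integers although columns are natural numbers: reflection is then negation, and
  \<open>mirror\<close> reduces flips to the left to flips to the right.\<close>

locale laminar =
  fixes Y :: "nat set" and x l r :: "nat \<Rightarrow> int"
  assumes bounds: "y \<in> Y \<Longrightarrow> l y < x y \<and> x y < r y"
    and crosses_less_touches: "crosses Y l r w y \<Longrightarrow> touches Y l r w y' \<Longrightarrow> y < y'"
begin

lemma mirror: "laminar Y (\<lambda>y. - x y) (\<lambda>y. - r y) (\<lambda>y. - l y)"
proof
  show "y < y'" if "crosses Y (\<lambda>y. - r y) (\<lambda>y. - l y) w y" "touches Y (\<lambda>y. - r y) (\<lambda>y. - l y) w y'"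
    for w y y'
    by (rule crosses_less_touches[of "- w"]) (use that in \<open>auto simp: crosses_def touches_def\<close>)
qed (use bounds in auto)

text \<open>An end of the lower interval strictly inside the upper one would be a column that the
  upper row crosses and at which the lower row ends, against
  \<open>crosses_less_touches\<close>.\<close>

lemma laminar:
  assumes "u \<in> Y" "v \<in> Y" "u < v"
  shows "nested l r v u \<or> r v \<le> l u \<or> r u \<le> l v"
  using crosses_less_touches[of "l u" v u] crosses_less_touches[of "r u" v u] assms
  by (auto simp: crosses_def touches_def nested_def not_less) (meson not_le)+

text \<open>If \<open>v\<close> were between \<open>p\<close> and \<open>a\<close> in height, the
  two intervals could not be disjoint, so \<open>v\<close> would contain \<open>a\<close> and
  \<open>p\<close> would not be its parent.\<close>

lemma nested_less:
  assumes "parent Y l r p a" "nested l r v a" "v \<in> Y" "v \<noteq> a" "p < v"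
  shows "a < v"
proof (rule ccontr)
  assume "\<not> a < v"
  then show False
    using laminar[of v a] assms bounds[of v] bounds[of a]
    unfolding parent_def nested_def by force
qed

end

text \<open>The situation of an edge-flip \<open>(a \<rightarrow> b)\<close> below \<open>p\<close> in which \<open>b\<close> is to the right of \<open>a\<close>.\<close>

locale adjacent_children = laminar +
  fixes p a b :: nat
  assumes pa: "parent Y l r p a" and pb: "parent Y l r p b"
    and ab: "a < b" "x a < x b"
    and adjacent: "parent Y l r p c \<Longrightarrow> \<not> (x a < x c \<and> x c < x b)"
begin

lemma in_Y: "p \<in> Y" "a \<in> Y" "b \<in> Y"
  using pa pb by (auto simp: parent_def)

lemma siblings_disjoint:
  assumes "parent Y l r p c" "parent Y l r p d" "c < d"
  shows "r d \<le> l c \<or> r c \<le> l d"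
  using laminar[of c d] assms unfolding parent_def by auto

lemma r_le_l: "r a \<le> l b"
  using siblings_disjoint[OF pa pb ab(1)] ab bounds[of a] bounds[of b] in_Y by auto

text \<open>The lowest row above \<open>p\<close> that contains \<open>v\<close> is a child of
  \<open>p\<close>. Siblings are disjoint, and adjacency excludes a child between \<open>a\<close>
  and \<open>b\<close>, so any other child lies outside the span from \<open>l a\<close> to
  \<open>r b\<close>.\<close>

lemma gap:
  assumes "v \<in> Y" "p < v" "nested l r v p"
  shows "nested l r v a \<or> nested l r v b \<or> r v \<le> l a \<or> r b \<le> l v"
proof -
  let ?P = "\<lambda>c. c \<in> Y \<and> p < c \<and> nested l r v c"
  define c where "c = (LEAST c. ?P c)"
  have "?P v"
    using assms by (simp add: nested_def)
  then have "?P c"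
    unfolding c_def by (rule LeastI)
  then have c: "c \<in> Y" "p < c" "nested l r v c" by auto
  have min: "c \<le> d" if "?P d" for d
    unfolding c_def using that by (rule Least_le)
  have "nested l r c p"
    using laminar[OF in_Y(1) c(1,2)] c(3) assms(3) bounds[OF assms(1)]
    by (auto simp: nested_def)
  then have pc: "parent Y l r p c"
    using in_Y c min unfolding parent_def nested_def by (meson leD order_trans)
  show ?thesis
  proof (cases "c = a \<or> c = b")
    case False
    then have "r a \<le> l c \<or> r c \<le> l a" "r b \<le> l c \<or> r c \<le> l b"
      using siblings_disjoint[OF pa pc] siblings_disjoint[OF pc pa]
        siblings_disjoint[OF pb pc] siblings_disjoint[OF pc pb] by linarith+
    then show ?thesis
      using adjacent[OF pc] c(3) bounds[OF c(1)] bounds[OF in_Y(2)] bounds[OF in_Y(3)]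
      by (auto simp: nested_def)
  qed (use c(3) in auto)
qed

text \<open>Row \<open>p\<close> crosses every column from \<open>r a\<close> to \<open>l b\<close>,
  so a row ending there is above \<open>p\<close> and inside it. By \<open>gap\<close> it is inside
  \<open>a\<close> or \<open>b\<close>, and these intervals reach the strip only at its
  borders.\<close>

lemma touches_gap:
  assumes "touches Y l r w v" "r a \<le> w" "w \<le> l b" "v \<noteq> a"
  shows "a < v" "w = r a \<or> w = l b"
proof -
  have "crosses Y l r w p"
    using pa pb assms(2,3) bounds[OF in_Y(2)] bounds[OF in_Y(3)] in_Y
    unfolding parent_def nested_def crosses_def by auto
  from crosses_less_touches[OF this assms(1)] have "p < v" .
  moreover have v: "v \<in> Y" using assms(1) by (simp add: touches_def)
  ultimately have "nested l r v p"
    using laminar[OF in_Y(1) v \<open>p < v\<close>] \<open>crosses Y l r w p\<close> assms(1) bounds[OF v]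
    unfolding touches_def crosses_def by fastforce
  from gap[OF v \<open>p < v\<close> this] have or: "nested l r v a \<or> nested l r v b"
    using assms bounds[OF in_Y(2)] bounds[OF in_Y(3)] bounds[OF v]
    unfolding touches_def by auto
  then show "w = r a \<or> w = l b"
    using assms(1-3) bounds[OF v] unfolding touches_def nested_def by auto
  from or show "a < v"
    using nested_less[OF pa _ v assms(4) \<open>p < v\<close>] nested_less[OF pb _ v _ \<open>p < v\<close>] ab(1)
    by (metis order.strict_trans)
qed

text \<open>A crossing row must be below \<open>b\<close>. Were it also above \<open>a\<close>, it
  would contain \<open>b\<close> and lie above \<open>p\<close>, against \<open>p\<close> being the
  parent of \<open>b\<close>. This makes both ends of \<open>b\<close> admissible targets for row
  \<open>a\<close>.\<close>

lemma crosses_ends: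
  assumes "crosses Y l r w c" "w = l b \<or> w = r b"
  shows "c < a"
proof -
  have c: "c \<in> Y" and "c < b"
    using crosses_less_touches[OF assms(1), of b] assms in_Y by (auto simp: touches_def crosses_def)
  have "c \<noteq> a"
    using assms r_le_l bounds[OF in_Y(3)] by (auto simp: crosses_def)
  moreover have "\<not> a < c"
    using laminar[OF c in_Y(3) \<open>c < b\<close>] assms pa pb \<open>c < b\<close> c bounds[OF c] bounds[OF in_Y(3)]
    by (auto simp: crosses_def parent_def)
  ultimately show ?thesis by simp
qed

text \<open>Enlarging the interval of \<open>a\<close> performs exactly the edge-flip on the tree.
  Rows containing \<open>a\<close> from below also contain \<open>p\<close>, hence the enlarged
  interval (\<open>upper\<close>); above \<open>a\<close>, the rows gained are just those inside
  \<open>b\<close> (\<open>lower\<close>).\<close>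

lemma flip_parent:
  "parent Y l (r(a := r b)) u v \<longleftrightarrow> parent Y l r u v \<and> (u, v) \<noteq> (p, b) \<or> (u, v) = (a, b)"
proof -
  let ?r = "r(a := r b)"
  have p: "p < a" "nested l r a p" "nested l r b p" using pa pb by (auto simp: parent_def)
  have between: "\<not> nested l r a w" if "w \<in> Y" "p < w" "w < a" for w
    using pa that by (auto simp: parent_def)
  have between': "\<not> nested l r b w" if "w \<in> Y" "p < w" "w < b" for w
    using pb that by (auto simp: parent_def)
  have other: "nested l ?r v u \<longleftrightarrow> nested l r v u" if "v \<noteq> a" "u \<noteq> a" for u v
    using that by (simp add: nested_def)
  have upper: "nested l ?r a u \<longleftrightarrow> nested l r a u" if "u \<in> Y" "u < a" for u
  proof
    assume "nested l ?r a u"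
    then show "nested l r a u"
      using that r_le_l bounds[OF in_Y(3)] by (simp add: nested_def)
  next
    assume u: "nested l r a u"
    then have "u \<le> p" using between[OF that(1)] that by fastforce
    moreover have "nested l r p u" if "u < p"
      using laminar[OF \<open>u \<in> Y\<close> in_Y(1) that] u p bounds[OF in_Y(2)] by (auto simp: nested_def)
    ultimately show "nested l ?r a u"
      using u p \<open>u < a\<close> by (cases "u = p") (auto simp: nested_def)
  qed
  have lower: "nested l ?r v a \<longleftrightarrow> nested l r v a \<or> nested l r v b" if "v \<in> Y" "a < v" for v
  proof
    assume v: "nested l ?r v a"
    show "nested l r v a \<or> nested l r v b"
    proof (cases "nested l r v a")
      case False
      then have "r a \<le> l v"
        using laminar[OF in_Y(2) that] v bounds[OF that(1)] by (auto simp: nested_def)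
      then have "nested l r v p"
        using v p that(2) r_le_l bounds[OF that(1)] bounds[OF in_Y(2)] by (auto simp: nested_def)
      from gap[OF that(1) _ this] show ?thesis
        using v p that r_le_l bounds[OF that(1)] bounds[OF in_Y(2)] bounds[OF in_Y(3)]
        by (auto simp: nested_def)
    qed simp
  next
    assume "nested l r v a \<or> nested l r v b"
    then show "nested l ?r v a"
      using that r_le_l bounds[OF in_Y(2)] bounds[OF in_Y(3)] by (auto simp: nested_def)
  qed
  have b_self: "nested l r b b" by (simp add: nested_def)
  consider "v = a" | "v = b" | "v \<noteq> a" "v \<noteq> b" by blast
  then show ?thesis
  proof cases
    case 1
    then show ?thesis
      using upper ab unfolding parent_def by auto
  next
    case 2
    show ?thesis
    proof (cases "u = a")
      case True
      have "\<forall>w\<in>Y. a < w \<and> w < b \<longrightarrow> \<not> nested l ?r b w"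
        using between' other[of b] p ab by fastforce
      then show ?thesis
        using 2 True lower[OF in_Y(3) ab(1)] b_self in_Y ab unfolding parent_def by auto
    next
      case False
      have "\<not> parent Y l ?r u b"
      proof
        assume u: "parent Y l ?r u b"
        then have "nested l r b u" "u < b" "u \<in> Y"
          using other[of b u] False ab unfolding parent_def by auto
        then have "u \<le> p" using between' by fastforce
        then have "\<not> nested l ?r b a"
          using u in_Y ab p unfolding parent_def by auto
        then show False
          using lower[OF in_Y(3) ab(1)] b_self by blast
      qed
      moreover have "parent Y l r u b \<Longrightarrow> u = p"
        using parent_unique pb by metis
      ultimately show ?thesis using 2 False by auto
    qed
  next
    case 3
    show ?thesis
    \<comment> \<open>A row above and inside \<open>b\<close> has its parent at \<open>b\<close> or
      higher, where no interval has changed. For every other row the set of lower rows containing it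
      is the same as before.\<close>
    proof (cases "v \<in> Y \<and> b < v \<and> nested l r v b")
      case True
      then have "nested l ?r v b" using other[of v b] 3 ab by simp
      then have "parent Y l ?r u v \<Longrightarrow> b \<le> u" "parent Y l r u v \<Longrightarrow> b \<le> u"
        using True in_Y unfolding parent_def by (meson not_le)+
      moreover have "parent Y l ?r u v \<longleftrightarrow> parent Y l r u v" if "b \<le> u"
      proof -
        have "nested l ?r v w \<longleftrightarrow> nested l r v w" if "b \<le> w" for w
          using other[of v w] 3 ab that by auto
        then show ?thesis
          using that unfolding parent_def by (auto dest: less_imp_le)
      qed
      ultimately show ?thesis using 3 by auto
    next
      case False
      have "nested l ?r v w \<longleftrightarrow> nested l r v w" if "w \<in> Y" "w < v" "v \<in> Y" for w
      proof (cases "w = a")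
        case True
        have "\<not> nested l r v b" if "v < b"
        proof
          assume "nested l r v b"
          then show False
            using nested_less[OF pb _ \<open>v \<in> Y\<close> 3(2)] p(1) True \<open>w < v\<close> that by force
        qed
        then show ?thesis
          using lower[of v] that True False 3 by (cases "v < b") auto
      qed (use other 3 in auto)
      then have "parent Y l ?r u v \<longleftrightarrow> parent Y l r u v"
        unfolding parent_def by auto
      then show ?thesis using 3 by simp
    qed
  qed
qed

end

section \<open>Rectangulation states from intervals\<close>

definition consec :: "nat set \<Rightarrow> nat \<Rightarrow> nat \<Rightarrow> bool" where
  "consec S u v \<longleftrightarrow> u \<in> S \<and> v \<in> S \<and> u < v \<and> (\<forall>z. u < z \<and> z < v \<longrightarrow> z \<notin> S)"

lemma consec_above:
  assumes "u \<in> S" "t \<in> S" "u < t"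
  obtains v where "consec S u v" "v \<le> t"
proof
  let ?P = "\<lambda>v. v \<in> S \<and> u < v"
  have "?P t" using assms by simp
  then show "(LEAST v. ?P v) \<le> t" by (rule Least_le)
  have "?P (LEAST v. ?P v)" using \<open>?P t\<close> by (rule LeastI)
  then show "consec S u (LEAST v. ?P v)"
    unfolding consec_def using assms not_less_Least[of _ ?P] by blast
qed

lemma consec_below:
  assumes "v \<in> S" "t \<in> S" "t < v"
  obtains u where "consec S u v" "t \<le> u"
proof -
  define A where "A = {u \<in> S. u < v}"
  have A: "finite A" "t \<in> A" using assms by (auto simp: A_def)
  then have "Max A \<in> A" "t \<le> Max A" and max: "\<And>z. z \<in> A \<Longrightarrow> z \<le> Max A"
    using Max_in[OF A(1)] Max_ge[OF A(1)] by blast+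
  moreover have "z \<notin> S" if "Max A < z" "z < v" for z
  proof
    assume "z \<in> S"
    then have "z \<in> A" using that by (simp add: A_def)
    from max[OF this] that show False by simp
  qed
  ultimately have "consec S (Max A) v"
    using assms(1) unfolding consec_def A_def by blast
  then show ?thesis using that \<open>t \<le> Max A\<close> by blast
qed

text \<open>The gaps between consecutive elements of \<open>S\<close> are disjoint; this rules out
  overlaps of collinear segments.\<close>

lemma consec_unique:
  assumes "consec S u v" "consec S u' v'" "z \<notin> S" "u \<le> z" "z \<le> v" "u' \<le> z" "z \<le> v'"
  shows "u = u' \<and> v = v'"
proof -
  have "u < z" "z < v" "u' < z" "z < v'"
    using assms by (auto simp: consec_def le_less)
  then have "\<not> u < u'" "\<not> u' < u" "\<not> v < v'" "\<not> v' < v"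
    using assms(1,2) unfolding consec_def by (blast dest: less_trans)+
  then show ?thesis by simp
qed

definition row_segs :: "nat \<Rightarrow> point set \<Rightarrow> (nat \<Rightarrow> nat) \<Rightarrow> (nat \<Rightarrow> nat) \<Rightarrow> segment set" where
  "row_segs n P l r =
     {((u, y), (v, y)) | u v y. y \<in> {1..n} \<and> l y \<le> u \<and> v \<le> r y \<and> consec {z. (z, y) \<in> P} u v}"

text \<open>Testing \<open>W\<close> at the lower end suffices because the predicates used are
  closed upwards: a wall never stops before the top.\<close>

definition col_segs :: "nat \<Rightarrow> point set \<Rightarrow> (nat \<Rightarrow> nat \<Rightarrow> bool) \<Rightarrow> segment set" where
  "col_segs n P W =
     {((w, u), (w, v)) | w u v. w \<in> {1..n} \<and> W w u \<and> v \<le> n + 1 \<and> consec {z. (w, z) \<in> P} u v}"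

definition segs :: "nat \<Rightarrow> point set \<Rightarrow> (nat \<Rightarrow> nat) \<Rightarrow> (nat \<Rightarrow> nat) \<Rightarrow> (nat \<Rightarrow> nat \<Rightarrow> bool) \<Rightarrow> segment set"
  where "segs n P l r W = row_segs n P l r \<union> col_segs n P W"

definition wall :: "nat \<Rightarrow> (nat \<Rightarrow> nat) \<Rightarrow> (nat \<Rightarrow> nat) \<Rightarrow> nat \<Rightarrow> nat \<Rightarrow> bool" where
  "wall n l r w y \<longleftrightarrow>
     (\<exists>t. touches {1..n} l r w t) \<and> (\<forall>c. crosses {1..n} l r w c \<longrightarrow> c \<le> y)"

text \<open>Two distinct segments of equal orientation settle the degree condition at a point: if
  there are exactly two segments, they are these.\<close>

lemma two_in_finite:
  assumes "finite A" "s \<in> A" "t \<in> A" "s \<noteq> t"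
  shows "2 \<le> card A" "card A = 2 \<Longrightarrow> A = {s, t}"
proof -
  have "card {s, t} \<le> card A" using assms by (intro card_mono) auto
  then show "2 \<le> card A" using assms by simp
  show "A = {s, t}" if "card A = 2"
    using card_subset_eq[of A "{s, t}"] that assms by auto
qed

text \<open>The wall predicate is a parameter because each move needs validity twice: directly after
  the flip with the old walls, and after the removal with the new ones. \<open>straight\<close>
  supplies two collinear segments at every inner point, and \<open>crossing\<close> makes rows and
  walls meet in points only.\<close>

locale cover =
  fixes n :: nat and P :: "point set" and l r :: "nat \<Rightarrow> nat" and W :: "nat \<Rightarrow> nat \<Rightarrow> bool"
  assumes P_subset: "P \<subseteq> grid n - corners n" and margin_subset: "margin n \<subseteq> P"
    and l_le_r: "y \<in> {1..n} \<Longrightarrow> l y \<le> r y" and r_le: "y \<in> {1..n} \<Longrightarrow> r y \<le> n + 1"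
    and ends: "y \<in> {1..n} \<Longrightarrow> (l y, y) \<in> P" "y \<in> {1..n} \<Longrightarrow> (r y, y) \<in> P"
    and W_upward: "W w y \<Longrightarrow> y \<le> y' \<Longrightarrow> W w y'"
    and crossing: "w \<in> {1..n} \<Longrightarrow> crosses {1..n} l r w y \<Longrightarrow> W w y0 \<Longrightarrow> y0 < y \<Longrightarrow> (w, y) \<in> P"
    and straight: "(w, y) \<in> P \<Longrightarrow> w \<in> {1..n} \<Longrightarrow> y \<in> {1..n} \<Longrightarrow>
      crosses {1..n} l r w y \<or> (\<exists>y0<y. (w, y0) \<in> P \<and> W w y0)"
begin

lemma top: "w \<in> {1..n} \<Longrightarrow> (w, n + 1) \<in> P"
  using margin_subset by (auto simp: margin_def)

text \<open>Collinear segments are gaps between consecutive points and share points only. A row and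
  a wall meeting elsewhere would cross above a lower point of that wall, where
  \<open>crossing\<close> demands a point.\<close>

lemma in_P:
  assumes s: "s \<in> segs n P l r W" and t: "t \<in> segs n P l r W" and "s \<noteq> t"
    and p: "p \<in> seg_points s" "p \<in> seg_points t"
  shows "p \<in> P"
proof (rule ccontr)
  assume nP: "p \<notin> P"
  have False if s: "s \<in> row_segs n P l r" and t: "t \<in> col_segs n P W"
      and p: "p \<in> seg_points s" "p \<in> seg_points t" for s t
  proof -
    from s obtain u v y where s: "s = ((u, y), (v, y))" "y \<in> {1..n}" "l y \<le> u" "v \<le> r y"
        "consec {z. (z, y) \<in> P} u v" unfolding row_segs_def by auto
    from t obtain w a b where t: "t = ((w, a), (w, b))" "w \<in> {1..n}" "W w a"
        "consec {z. (w, z) \<in> P} a b" unfolding col_segs_def by auto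
    from p s t have p: "p = (w, y)" "u \<le> w" "w \<le> v" "a \<le> y" "y \<le> b"
      by (cases p; auto simp: seg_points_def)+
    have "crosses {1..n} l r w y" using ends[OF s(2)] s(2-4) p nP
      by (auto simp: crosses_def le_less)
    moreover have "a < y" using p t nP by (auto simp: consec_def le_less)
    ultimately show False using crossing[OF t(2) _ t(3)] nP p by blast
  qed
  note mixed = this
  have False if "s \<in> row_segs n P l r" "t \<in> row_segs n P l r"
  proof -
    obtain a b where [simp]: "p = (a, b)" by (cases p)
    from that p \<open>s \<noteq> t\<close> nP consec_unique[of "{z. (z, b) \<in> P}" _ _ _ _ a] show False
      unfolding row_segs_def by (fastforce simp: seg_points_def)
  qed
  moreover have False if "s \<in> col_segs n P W" "t \<in> col_segs n P W"
  proof -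
    obtain a b where [simp]: "p = (a, b)" by (cases p)
    from that p \<open>s \<noteq> t\<close> nP consec_unique[of "{z. (a, z) \<in> P}" _ _ _ _ b] show False
      unfolding col_segs_def by (fastforce simp: seg_points_def)
  qed
  ultimately show False
    using mixed[of s t] mixed[of t s] s t p unfolding segs_def by blast
qed

lemma seg_props:
  assumes "s \<in> segs n P l r W"
  shows "horizontal s \<or> vertical s" "endpoints s \<subseteq> P" "seg_points s \<inter> P = endpoints s"
proof -
  have interior: "a = u \<or> a = v" if "consec S u v" "u \<le> a" "a \<le> v" "a \<in> S" for S u v a
    using that by (auto simp: consec_def le_less)
  from assms consider u v y where "s = ((u, y), (v, y))" "consec {z. (z, y) \<in> P} u v"
    | w u v where "s = ((w, u), (w, v))" "consec {z. (w, z) \<in> P} u v"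
    unfolding segs_def row_segs_def col_segs_def by blast
  then have "(horizontal s \<or> vertical s) \<and> endpoints s \<subseteq> P \<and> seg_points s \<inter> P = endpoints s"
  proof cases
    case 1
    then have "u < v" "(u, y) \<in> P" "(v, y) \<in> P" by (auto simp: consec_def)
    then show ?thesis
      using 1(1)
      by (auto simp: horizontal_def endpoints_def seg_points_def dest: interior[OF 1(2)])
  next
    case 2
    then have "u < v" "(w, u) \<in> P" "(w, v) \<in> P" by (auto simp: consec_def)
    then show ?thesis
      using 2(1)
      by (auto simp: vertical_def endpoints_def seg_points_def dest: interior[OF 2(2)])
  qed
  then show "horizontal s \<or> vertical s" "endpoints s \<subseteq> P" "seg_points s \<inter> P = endpoints s"
    by blast+
qed

lemma finite_segs: "finite (segs n P l r W)"
proof (rule finite_subset)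
  show "segs n P l r W \<subseteq> grid n \<times> grid n"
    using seg_props(2) P_subset by (force simp: endpoints_def)
qed (simp add: grid_def)

lemma degree:
  assumes "p \<in> P" "p \<in> non_margin n"
  defines "Lp \<equiv> {s \<in> segs n P l r W. p \<in> seg_points s}"
  shows "card Lp \<ge> 2 \<and> (card Lp = 2 \<longrightarrow> (\<forall>s\<in>Lp. horizontal s) \<or> (\<forall>s\<in>Lp. vertical s))"
proof -
  obtain w y where p: "p = (w, y)" by (cases p)
  then have wy: "w \<in> {1..n}" "y \<in> {1..n}" using assms(2) by (auto simp: non_margin_def)
  have fin: "finite Lp" unfolding Lp_def using finite_segs by simp
  from straight[OF _ wy] assms(1) p consider "crosses {1..n} l r w y"
    | y0 where "y0 < y" "(w, y0) \<in> P" "W w y0" by blast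
  then show ?thesis
  proof cases
    case 1
    obtain u where u: "consec {z. (z, y) \<in> P} u w" "l y \<le> u"
      by (rule consec_below[of w "{z. (z, y) \<in> P}" "l y"])
        (use 1 ends wy assms p in \<open>auto simp: crosses_def\<close>)
    obtain v where v: "consec {z. (z, y) \<in> P} w v" "v \<le> r y"
      by (rule consec_above[of w "{z. (z, y) \<in> P}" "r y"])
        (use 1 ends wy assms p in \<open>auto simp: crosses_def\<close>)
    have *: "u < w" "w < v" using u v by (auto simp: consec_def)
    have "((u, y), (w, y)) \<in> Lp" "((w, y), (v, y)) \<in> Lp"
      unfolding Lp_def segs_def row_segs_def
      using u v wy 1 p * by (auto simp: seg_points_def crosses_def)
    from two_in_finite[OF fin this] * show ?thesis
      by (auto simp: horizontal_def)
  next
    case 2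
    obtain u where u: "consec {z. (w, z) \<in> P} u y" "y0 \<le> u"
      by (rule consec_below[of y "{z. (w, z) \<in> P}" y0]) (use 2 assms p in auto)
    obtain v where v: "consec {z. (w, z) \<in> P} y v" "v \<le> n + 1"
      by (rule consec_above[of y "{z. (w, z) \<in> P}" "n + 1"]) (use top wy assms p in auto)
    have *: "u < y" "y < v" using u v by (auto simp: consec_def)
    have "W w u" "W w y" using W_upward 2(1,3) u(2) by (meson less_imp_le)+
    then have "((w, u), (w, y)) \<in> Lp" "((w, y), (w, v)) \<in> Lp"
      unfolding Lp_def segs_def col_segs_def
      using u v wy p * by (auto simp: seg_points_def)
    from two_in_finite[OF fin this] * show ?thesis
      by (auto simp: vertical_def)
  qed
qed

lemma valid: "valid_state n (P, segs n P l r W)"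
proof -
  have "seg_points s \<inter> seg_points t \<subseteq> endpoints s \<inter> endpoints t"
    if "s \<in> segs n P l r W" "t \<in> segs n P l r W" "s \<noteq> t" for s t
    using in_P[OF that] seg_props(3)[OF that(1)] seg_props(3)[OF that(2)] by blast
  then show ?thesis
    unfolding valid_state_def split Let_def
    using P_subset seg_props degree by simp
qed

end

section \<open>Splitting segments at a new point\<close>

lemma split_at_Un: "split_at p (A \<union> B) = split_at p A \<union> split_at p B"
  by (simp only: split_at_def UN_Un)

lemma split_at_id: "(\<And>s. s \<in> L \<Longrightarrow> p \<notin> seg_points s - endpoints s) \<Longrightarrow> split_at p L = L"
  by (auto simp: split_at_def)

text \<open>The wall point below \<open>(z, y)\<close> and the margin point at the top guarantee
  that both pieces at the new point come from one segment already present. Without a lower wall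
  point, the piece above \<open>(z, y)\<close> could belong to the right-hand side without arising
  from a split.\<close>

lemma split_col_segs:
  assumes upward: "\<And>w y y'. W w y \<Longrightarrow> y \<le> y' \<Longrightarrow> W w y'"
    and z: "z \<in> {1..n} \<Longrightarrow> (z, n + 1) \<in> P \<and> (\<exists>y0<y. (z, y0) \<in> P \<and> W z y0)"
    and "y < n + 1"
  shows "split_at (z, y) (col_segs n P W) = col_segs n (insert (z, y) P) W"
proof (cases "z \<in> {1..n} \<and> (z, y) \<notin> P")
  case True
  let ?S = "{v. (z, v) \<in> P}"
  from z True obtain y0 where y0: "y0 < y" "(z, y0) \<in> P" "W z y0" and top: "(z, n + 1) \<in> P" by blast
  have yS: "y \<notin> ?S" using True by simp
  have other: "{v. (w, v) = (z, y) \<or> (w, v) \<in> P} = {v. (w, v) \<in> P}" if "w \<noteq> z" for w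
    using that by auto
  have this_col: "{v. (z, v) = (z, y) \<or> (z, v) \<in> P} = insert y ?S" by auto
  show ?thesis
  proof (intro equalityI subsetI)
    fix s assume "s \<in> split_at (z, y) (col_segs n P W)"
    then obtain w u v where w: "w \<in> {1..n}" "W w u" "v \<le> n + 1" "consec {v. (w, v) \<in> P} u v"
      and s: "s \<in> (if (z, y) \<in> seg_points ((w, u), (w, v)) - endpoints ((w, u), (w, v))
          then {((w, u), (z, y)), ((z, y), (w, v))} else {((w, u), (w, v))})"
      unfolding split_at_def col_segs_def by auto
    show "s \<in> col_segs n (insert (z, y) P) W"
    proof (cases "w = z \<and> u < y \<and> y < v")
      case True
      then have "s = ((z, u), (z, y)) \<or> s = ((z, y), (z, v))"
        using s by (auto simp: seg_points_def endpoints_def)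
      moreover have "consec (insert y ?S) u y" "consec (insert y ?S) y v" "W z y" "y \<le> n + 1"
        using w True upward[of z u y] by (auto simp: consec_def)
      ultimately show ?thesis
        using w True unfolding col_segs_def insert_iff by (auto simp: this_col[simplified])
    next
      case False
      then have "s = ((w, u), (w, v))"
        using s by (auto simp: seg_points_def endpoints_def split: if_splits)
      moreover have "consec {v. (w, v) = (z, y) \<or> (w, v) \<in> P} u v"
        using w(4) False by (auto simp: consec_def)
      ultimately show ?thesis
        using w unfolding col_segs_def insert_iff by auto
    qed
  next
    fix s assume "s \<in> col_segs n (insert (z, y) P) W"
    then obtain w u v where w: "w \<in> {1..n}" "W w u" "v \<le> n + 1"
      "consec {v. (w, v) = (z, y) \<or> (w, v) \<in> P} u v" and s: "s = ((w, u), (w, v))"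
      unfolding col_segs_def insert_iff by blast
    have split: "((z, u), (z, y)) \<in> split_at (z, y) (col_segs n P W) \<and>
        ((z, y), (z, v)) \<in> split_at (z, y) (col_segs n P W)"
      if "consec ?S u v" "u < y" "y < v" "W z u" "v \<le> n + 1" for u v
    proof -
      have "((z, u), (z, v)) \<in> col_segs n P W"
        using that True unfolding col_segs_def by blast
      then show ?thesis
        using that unfolding split_at_def by (force simp: seg_points_def endpoints_def)
    qed
    consider "w = z" "v = y" | "w = z" "u = y" | "w \<noteq> z \<or> u \<noteq> y \<and> v \<noteq> y" by blast
    then show "s \<in> split_at (z, y) (col_segs n P W)"
    proof cases
      case 1
      then have u: "u \<in> ?S" "u < y" "\<And>t. u < t \<Longrightarrow> t < y \<Longrightarrow> t \<notin> ?S"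
        using w(4) yS by (auto simp: consec_def)
      obtain v' where v': "consec ?S u v'" "v' \<le> n + 1"
        by (rule consec_above[of u ?S "n + 1"]) (use u top \<open>y < n + 1\<close> in auto)
      then have "y < v'"
        using u(3) yS by (metis consec_def linorder_neqE_nat)
      then show ?thesis
        using split[OF v'(1) u(2) _ _ v'(2)] w s 1 by blast
    next
      case 2
      then have v: "v \<in> ?S" "y < v" "\<And>t. y < t \<Longrightarrow> t < v \<Longrightarrow> t \<notin> ?S"
        using w(4) yS by (auto simp: consec_def)
      obtain u' where u': "consec ?S u' v" "y0 \<le> u'"
        by (rule consec_below[of v ?S y0]) (use v y0 in auto)
      then have "u' < y"
        using v(3) yS by (metis consec_def linorder_neqE_nat)
      then show ?thesis
        using split[OF u'(1) _ v(2) upward[OF y0(3) u'(2)] w(3)] w s 2 by blast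
    next
      case 3
      then have "consec {v. (w, v) \<in> P} u v" "\<not> (w = z \<and> u < y \<and> y < v)"
        using w(4) by (auto simp: consec_def)
      then have "s \<in> col_segs n P W" "(z, y) \<notin> seg_points s - endpoints s"
        using w(1-3) s unfolding col_segs_def
        by (auto simp: seg_points_def endpoints_def)
      then show ?thesis
        unfolding split_at_def by force
    qed
  qed
next
  case False
  have "(z, y) \<notin> seg_points s - endpoints s" if "s \<in> col_segs n P W" for s
    using that False unfolding col_segs_def
    by (auto simp: seg_points_def endpoints_def consec_def) (metis le_neq_implies_less)+
  then have "split_at (z, y) (col_segs n P W) = col_segs n P W"
    by (intro split_at_id) auto
  moreover
  {
    have "{v. (w, v) = (z, y) \<or> (w, v) \<in> P} = {v. (w, v) \<in> P}" if "w \<in> {1..n}" for w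
      using that False by auto
    then have "consec {v. (w, v) = (z, y) \<or> (w, v) \<in> P} u v \<longleftrightarrow> consec {v. (w, v) \<in> P} u v"
      if "w \<in> {1..n}" for w u v using that by presburger
    then have "col_segs n (insert (z, y) P) W = col_segs n P W"
      unfolding col_segs_def insert_iff by blast
  }
  ultimately show ?thesis by simp
qed

text \<open>The weak inequalities in \<open>bounds\<close> admit rows not yet drawn, with
  \<open>l y = x y = r y\<close>. \<open>base\<close> demands a point at the foot of each wall.
  \<open>P_covered\<close> keeps inner points on the closed intervals of their rows, so that the
  stretch drawn by a later extension contains no old point in its interior.\<close>

locale config =
  fixes n :: nat and x :: "nat \<Rightarrow> nat" and P :: "point set" and l r :: "nat \<Rightarrow> nat"
  assumes P_subset: "P \<subseteq> grid n - corners n" and margin_subset: "margin n \<subseteq> P"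
    and x_in: "y \<in> {1..n} \<Longrightarrow> x y \<in> {1..n}"
    and bounds: "y \<in> {1..n} \<Longrightarrow> l y \<le> x y \<and> x y \<le> r y \<and> r y \<le> n + 1"
    and ends: "y \<in> {1..n} \<Longrightarrow> (l y, y) \<in> P \<and> (r y, y) \<in> P"
    and crosses_less_touches: "crosses {1..n} l r w c \<Longrightarrow> touches {1..n} l r w t \<Longrightarrow> c < t"
    and base: "touches {1..n} l r w t \<Longrightarrow> crosses {1..n} l r w c \<Longrightarrow>
      (\<And>d. crosses {1..n} l r w d \<Longrightarrow> d \<le> c) \<Longrightarrow> w \<in> {1..n} \<Longrightarrow> (w, c) \<in> P"
    and P_covered: "(w, y) \<in> P \<Longrightarrow> w \<in> {1..n} \<Longrightarrow> y \<in> {1..n} \<Longrightarrow>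
      crosses {1..n} l r w y \<or> touches {1..n} l r w y"
begin

lemma bottom: "w \<in> {1..n} \<Longrightarrow> (w, 0) \<in> P" and top: "w \<in> {1..n} \<Longrightarrow> (w, n + 1) \<in> P"
  using margin_subset by (auto simp: margin_def)

text \<open>The point found is the foot of the wall: on the highest crossing row by
  \<open>base\<close>, or on the bottom margin if no row crosses.\<close>

lemma wall_below:
  assumes "w \<in> {1..n}" "touches {1..n} l r w t" "\<And>c. crosses {1..n} l r w c \<Longrightarrow> c < y" "0 < y"
  shows "\<exists>y0<y. (w, y0) \<in> P \<and> wall n l r w y0"
proof (cases "\<exists>c. crosses {1..n} l r w c")
  case True
  define c where "c = (GREATEST c. crosses {1..n} l r w c)"
  have le: "d \<le> n" if "crosses {1..n} l r w d" for d
    using that by (auto simp: crosses_def)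
  have c: "crosses {1..n} l r w c"
    unfolding c_def using True le by (metis (mono_tags) GreatestI_ex_nat)
  have max: "d \<le> c" if "crosses {1..n} l r w d" for d
    unfolding c_def by (rule Greatest_le_nat[of "crosses {1..n} l r w", OF that le])
  have "(w, c) \<in> P" by (rule base[OF assms(2) c max assms(1)])
  then show ?thesis
    using assms(2,3) c max unfolding wall_def by blast
next
  case False
  then show ?thesis
    using assms bottom unfolding wall_def by blast
qed

lemma cover: "cover n P l r (wall n l r)"
proof
  fix w y assume wy: "(w, y) \<in> P" "w \<in> {1..n}" "y \<in> {1..n}"
  from P_covered[OF this] show "crosses {1..n} l r w y \<or> (\<exists>y0<y. (w, y0) \<in> P \<and> wall n l r w y0)"
    using wall_below[OF wy(2), of y y] crosses_less_touches wy(3) by fastforce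
next
  fix w y y0
  assume "crosses {1..n} l r w y" "wall n l r w y0" "y0 < y"
  then show "(w, y) \<in> P" unfolding wall_def by fastforce
next
  show "wall n l r w y'" if "wall n l r w y" "y \<le> y'" for w y y'
    using that unfolding wall_def by (meson order_trans)
qed (use P_subset margin_subset bounds ends in \<open>auto intro: order_trans\<close>)

lemmas valid = cover.valid[OF cover]

end

text \<open>The row of \<open>y\<close> is extended from its end \<open>e\<close> to the next wall \<open>z\<close> at height \<open>y\<close>.\<close>

locale extension = config +
  fixes y e z :: nat
  assumes y: "y \<in> {1..n}"
    and ez: "z < l y \<and> e = l y \<or> r y < z \<and> e = r y" and z: "z \<le> n + 1"
    and target: "z \<in> {1..n} \<Longrightarrow>
      (\<exists>t. touches {1..n} l r z t) \<and> (\<forall>c. crosses {1..n} l r z c \<longrightarrow> c < y)"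
    and free: "min e z < w \<Longrightarrow> w < max e z \<Longrightarrow> touches {1..n} l r w t \<Longrightarrow>
      \<exists>c. crosses {1..n} l r w c \<and> y < c"
    and higher: "l y < r y \<Longrightarrow> touches {1..n} l r e t \<Longrightarrow> t \<noteq> y \<Longrightarrow> y < t"
begin

abbreviation (input) "l' \<equiv> l(y := min (l y) z)"
abbreviation (input) "r' \<equiv> r(y := max (r y) z)"
abbreviation (input) "P' \<equiv> insert (z, y) P"

text \<open>Besides the open stretch from \<open>e\<close> to \<open>z\<close>, the old end
  \<open>e\<close> becomes a crossed column, unless the row was a single point; then
  \<open>e\<close> remains its other end.\<close>

lemma crosses': "crosses {1..n} l' r' w c \<longleftrightarrow>
    crosses {1..n} l r w c \<or> c = y \<and> (min e z < w \<and> w < max e z \<or> w = e \<and> l y < r y)"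
  using ez bounds[OF y] y by (auto simp: crosses_def)

lemma touches': "touches {1..n} l' r' w t \<longleftrightarrow>
    touches {1..n} l r w t \<and> (t = y \<longrightarrow> w \<noteq> e \<or> l y = r y) \<or> t = y \<and> w = z"
  using ez bounds[OF y] y by (auto simp: touches_def)

lemma new_point:
  assumes "(w, y) \<in> P" "w \<in> {1..n}"
  shows "l y \<le> w" "w \<le> r y"
  using P_covered[OF assms y] bounds[OF y] by (auto simp: touches_def crosses_def)

text \<open>On the columns that row \<open>y\<close> newly crosses, \<open>free\<close> and
  \<open>higher\<close> put the rows ending there above \<open>y\<close>; at its new end,
  \<open>target\<close> puts the crossing rows below \<open>y\<close>. A wall can get its foot on
  row \<open>y\<close> by this extension only at the old end \<open>e\<close>, which is already a
  point.\<close>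

lemma config': "config n x P' l' r'"
proof
  show "P' \<subseteq> grid n - corners n"
    using P_subset y z by (auto simp: grid_def corners_def)
  show "c < t" if c: "crosses {1..n} l' r' w c" and t: "touches {1..n} l' r' w t" for w c t
  proof -
    from c consider "crosses {1..n} l r w c" | "c = y" "min e z < w" "w < max e z"
      | "c = y" "w = e" "l y < r y" unfolding crosses' by blast
    then show ?thesis
    proof cases
      case 1
      then have "w \<in> {1..n}"
        using bounds[of c] by (auto simp: crosses_def)
      then show ?thesis
        using 1 t crosses_less_touches target unfolding touches' by blast
    next
      case 2
      then have "touches {1..n} l r w t"
        using t unfolding touches' by auto
      then show ?thesis
        using free[OF 2(2,3)] crosses_less_touches 2(1) by (meson less_trans)
    next
      case 3
      then show ?thesis
        using t higher[of t] ez unfolding touches' by auto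
    qed
  qed
  show "(w, c) \<in> P'" if t: "touches {1..n} l' r' w t" and c: "crosses {1..n} l' r' w c"
    and max: "\<And>d. crosses {1..n} l' r' w d \<Longrightarrow> d \<le> c" and w: "w \<in> {1..n}" for w t c
  proof -
    obtain t' where t': "touches {1..n} l r w t'"
      using t target w unfolding touches' by blast
    have max': "d \<le> c" if "crosses {1..n} l r w d" for d
      using max[of d] that unfolding crosses' by blast
    from c consider "crosses {1..n} l r w c" | "c = y" "min e z < w" "w < max e z"
      | "c = y" "w = e" unfolding crosses' by blast
    then show ?thesis
    proof cases
      case 1
      then show ?thesis using base[OF t' 1 max' w] by simp
    next
      case 2
      then show ?thesis using free[OF 2(2,3) t'] max' by fastforce
    next
      case 3
      then show ?thesis using ends[OF y] ez by auto
    qed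
  qed
  show "crosses {1..n} l' r' w c \<or> touches {1..n} l' r' w c"
    if "(w, c) \<in> P'" "w \<in> {1..n}" "c \<in> {1..n}" for w c
    using that P_covered[of w c] bounds[OF y] unfolding crosses' touches'
    by (auto simp: touches_def)
  show "l' c \<le> x c \<and> x c \<le> r' c \<and> r' c \<le> n + 1" if "c \<in> {1..n}" for c
    using bounds[OF that] z by (cases "c = y") (auto simp: min_def max_def)
  show "(l' c, c) \<in> P' \<and> (r' c, c) \<in> P'" if "c \<in> {1..n}" for c
    using ends[OF that] by (cases "c = y") (auto simp: min_def max_def)
qed (use margin_subset x_in in auto)

text \<open>This is the state between flip and removal: rows extended, walls still the old ones.
  Walls strictly between \<open>e\<close> and \<open>z\<close> start above \<open>y\<close>, so the
  only old wall that row \<open>y\<close> newly crosses can stand at \<open>e\<close>, a point of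
  \<open>P\<close>.\<close>

lemma cover': "cover n P' l' r' (wall n l r)"
proof -
  interpret C: config n x P' l' r' by (rule config')
  have W: "wall n l r w y0 \<Longrightarrow> y0 \<le> y1 \<Longrightarrow> wall n l r w y1" for w y0 y1
    unfolding wall_def by (meson order_trans)
  show ?thesis
  proof
    fix w c y0 assume w: "w \<in> {1..n}" "crosses {1..n} l' r' w c" "wall n l r w y0" "y0 < c"
    then have "\<not> crosses {1..n} l r w c" unfolding wall_def by fastforce
    then have "c = y \<and> (min e z < w \<and> w < max e z \<or> w = e)"
      using w(2) unfolding crosses' by blast
    moreover have "\<not> (min e z < w \<and> w < max e z)" if "c = y"
      using free[of w] w(3,4) that unfolding wall_def by fastforce
    ultimately show "(w, c) \<in> P'" using ends[OF y] ez by auto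
  next
    fix w c assume w: "(w, c) \<in> P'" "w \<in> {1..n}" "c \<in> {1..n}"
    show "crosses {1..n} l' r' w c \<or> (\<exists>y0<c. (w, y0) \<in> P' \<and> wall n l r w y0)"
    proof (cases "(w, c) \<in> P")
      case True
      have "crosses {1..n} l r w c \<or> (\<exists>y0<c. (w, y0) \<in> P \<and> wall n l r w y0)"
        by (rule cover.straight[OF cover True w(2,3)])
      then show ?thesis unfolding crosses' by blast
    next
      case False
      then have "w = z" "c = y" using w by auto
      then show ?thesis
        using wall_below[of z _ y] target w by (metis atLeastAtMost_iff insert_iff less_le_trans zero_less_one)
    qed
  next
    show "l' c \<le> r' c" if "c \<in> {1..n}" for c
      using C.bounds[OF that] by linarith
  qed (use W C.P_subset C.margin_subset C.bounds C.ends in blast)+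
qed

text \<open>No point of row \<open>y\<close> lies strictly between \<open>e\<close> and
  \<open>z\<close>, so the extension is a single segment, and the split at its end
  \<open>(z, y)\<close> changes no row.\<close>

lemma split_row_segs:
  "split_at (z, y) (insert (mk_seg (e, y) (z, y)) (row_segs n P l r)) = row_segs n P' l' r'"
proof -
  let ?s = "((min e z, y), (max e z, y))"
  have mk: "mk_seg (e, y) (z, y) = ?s"
    using ez by (auto simp: mk_seg_def)
  have nz: "(w, y) \<notin> P" if "min e z < w" "w < max e z" for w
    using new_point[of w] that ez z bounds[OF y] by auto
  have "split_at (z, y) (insert ?s (row_segs n P l r)) = insert ?s (row_segs n P l r)"
    using ez by (intro split_at_id) (auto simp: seg_points_def endpoints_def row_segs_def)
  also have "\<dots> = row_segs n P' l' r'"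
  proof (intro equalityI subsetI)
    fix s assume s: "s \<in> insert ?s (row_segs n P l r)"
    show "s \<in> row_segs n P' l' r'"
    proof (cases "s = ?s")
      case True
      have "consec {v. (v, y) = (z, y) \<or> (v, y) \<in> P} (min e z) (max e z)"
        using ends[OF y] ez nz by (auto simp: consec_def min_def max_def)
      then show ?thesis
        using True y ez bounds[OF y] unfolding row_segs_def insert_iff
        by (intro CollectI exI[of _ "min e z"] exI[of _ "max e z"] exI[of _ y]) auto
    next
      case False
      then obtain u v c where s: "s = ((u, c), (v, c))" "c \<in> {1..n}" "l c \<le> u" "v \<le> r c"
        "consec {w. (w, c) \<in> P} u v" using s unfolding row_segs_def by blast
      then have "consec {w. (w, c) = (z, y) \<or> (w, c) \<in> P} u v"
        using ez by (auto simp: consec_def)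
      then show ?thesis
        using s unfolding row_segs_def insert_iff
        by (intro CollectI exI[of _ u] exI[of _ v] exI[of _ c]) auto
    qed
  next
    fix s assume "s \<in> row_segs n P' l' r'"
    then obtain u v c where s: "s = ((u, c), (v, c))" "c \<in> {1..n}" "l' c \<le> u" "v \<le> r' c"
        "consec {w. (w, c) = (z, y) \<or> (w, c) \<in> P} u v" unfolding row_segs_def insert_iff by blast
    have old: "s \<in> row_segs n P l r" if "l c \<le> u" "v \<le> r c"
    proof -
      have "consec {w. (w, c) \<in> P} u v"
        using s(5) that ez by (auto simp: consec_def)
      then show ?thesis using s(1,2) that unfolding row_segs_def by blast
    qed
    show "s \<in> insert ?s (row_segs n P l r)"
    proof (cases "l c \<le> u \<and> v \<le> r c")
      case False
      then have c: "c = y" using s(3,4) by (auto split: if_splits)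
      have uv: "u < v" "(u, y) \<in> P \<or> u = z" "(v, y) \<in> P \<or> v = z"
        "\<not> (u < e \<and> e < v)" "\<not> (u < z \<and> z < v)"
        using s(5) ends[OF y] ez unfolding c by (auto simp: consec_def)
      have "u = min e z \<and> v = max e z"
      proof (cases "z < l y")
        case True
        then have e: "e = l y" using ez bounds[OF y] by auto
        have "u < e" using False s(4) True e bounds[OF y] unfolding c by auto
        have "z \<le> u" using s(3) True unfolding c by auto
        moreover have "u = z \<or> \<not> z < u"
          using nz[of u] uv(2) \<open>u < e\<close> by auto
        ultimately have "u = z" "v \<le> e"
          using \<open>u < e\<close> uv(4) by linarith+
        moreover from this have "v = e"
          using uv nz[of v] by (cases "v < e") auto
        ultimately show ?thesis
          using True e by simp
      next
        case z': False
        then have e: "e = r y" "r y < z" using ez by auto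
        have "e < v" using False s(3) z' e bounds[OF y] unfolding c by auto
        have "v \<le> z" using s(4) e unfolding c by auto
        moreover have "v = z \<or> \<not> v < z"
          using nz[of v] uv(3) \<open>e < v\<close> by auto
        ultimately have "v = z" "e \<le> u"
          using \<open>e < v\<close> uv(4) by linarith+
        moreover from this have "u = e"
          using uv nz[of u] by (cases "e < u") auto
        ultimately show ?thesis
          using e by simp
      qed
      then show ?thesis using s c by simp
    qed (use old in blast)
  qed
  finally show ?thesis by (simp only: mk)
qed

lemma split_cols: "split_at (z, y) (col_segs n P (wall n l r)) = col_segs n P' (wall n l r)"
proof (rule split_col_segs)
  show "wall n l r w y0 \<Longrightarrow> y0 \<le> y1 \<Longrightarrow> wall n l r w y1" for w y0 y1
    unfolding wall_def by (meson order_trans)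
  show "(z, n + 1) \<in> P \<and> (\<exists>y0<y. (z, y0) \<in> P \<and> wall n l r z y0)" if "z \<in> {1..n}"
    using top[OF that] wall_below[OF that, of _ y] target[OF that] y
    by (meson atLeastAtMost_iff less_le_trans zero_less_one)
  show "y < n + 1" using y by simp
qed

lemma flip_result:
  "flip_result (P, segs n P l r (wall n l r)) (e, y) (z, y) = (P', segs n P' l' r' (wall n l r))"
proof -
  have e: "(e, y) \<in> P" using ends[OF y] ez by auto
  have "split_at (e, y) (insert (mk_seg (e, y) (z, y)) (segs n P l r (wall n l r))) =
      insert (mk_seg (e, y) (z, y)) (segs n P l r (wall n l r))"
  proof (rule split_at_id)
    fix s assume "s \<in> insert (mk_seg (e, y) (z, y)) (segs n P l r (wall n l r))"
    then consider "s = mk_seg (e, y) (z, y)" | "s \<in> segs n P l r (wall n l r)" by blast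
    then show "(e, y) \<notin> seg_points s - endpoints s"
    proof cases
      case 1
      then show ?thesis by (simp add: mk_seg_def endpoints_def)
    next
      case 2
      then show ?thesis using cover.seg_props(3)[OF cover 2] e by blast
    qed
  qed
  moreover have "split_at (z, y) (insert (mk_seg (e, y) (z, y)) (segs n P l r (wall n l r))) =
      segs n P' l' r' (wall n l r)"
    unfolding segs_def Un_insert_left[symmetric] split_at_Un by (simp only: split_row_segs split_cols)
  ultimately show ?thesis
    using e unfolding flip_result_def by (simp add: insert_absorb)
qed

text \<open>Walls only shrink: the extension adds crossings, and by \<open>target\<close> the one
  new end \<open>z\<close> was a wall column before. So the passage to the new walls is a pure
  removal.\<close>

lemma wall': "(w, y0) \<in> P' \<Longrightarrow> w \<in> {1..n} \<Longrightarrow> wall n l' r' w y0 \<Longrightarrow> wall n l r w y0"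
  using target unfolding wall_def crosses' touches' by blast

lemma remaining:
  "segs n P' l' r' (wall n l' r') =
    segs n P' l' r' (wall n l r) -
      {((w, u), (w', v)) | w u w' v. ((w, u), (w', v)) \<in> col_segs n P' (wall n l r) \<and> \<not> wall n l' r' w u}"
proof -
  have "s \<notin> col_segs n P' W" if "s \<in> row_segs n P' l' r'" for s W
    using that unfolding row_segs_def col_segs_def by (auto simp: consec_def)
  moreover have "col_segs n P' (wall n l' r') =
    col_segs n P' (wall n l r) -
      {((w, u), (w', v)) | w u w' v. ((w, u), (w', v)) \<in> col_segs n P' (wall n l r) \<and> \<not> wall n l' r' w u}"
    using wall' unfolding col_segs_def by (auto simp: consec_def)
  ultimately show ?thesis unfolding segs_def by blast
qed

lemma rect_step:
  assumes "set R = {((w, u), (w', v)) | w u w' v.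
    ((w, u), (w', v)) \<in> split_at (z, y) (col_segs n P (wall n l r)) \<and> \<not> wall n l' r' w u}"
  shows "rect_step n (P, segs n P l r (wall n l r)) ((e, y), (z, y), R)
    (P', segs n P' l' r' (wall n l' r'))"
proof -
  interpret C: config n x P' l' r' by (rule config')
  have "(e, y) \<in> grid n - corners n" "(z, y) \<in> grid n - corners n"
    using C.P_subset ends[OF y] ez by auto
  moreover have "axis_parallel (e, y) (z, y)"
    using ez bounds[OF y] by (auto simp: axis_parallel_def)
  moreover have "set R \<subseteq> segs n P' l' r' (wall n l r)"
    unfolding assms split_cols segs_def by blast
  moreover have "segs n P' l' r' (wall n l' r') = segs n P' l' r' (wall n l r) - set R"
    unfolding assms split_cols by (rule remaining)
  ultimately show ?thesis
    using C.valid cover.valid[OF cover'] unfolding rect_step_def by (simp add: flip_result)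
qed

end

section \<open>The transformation\<close>

type_synonym rows = "(nat \<times> nat \<times> nat) list"

text \<open>Neither the points nor the horizontal segments are recorded: a move has to list the
  removed segments, and only vertical ones are ever removed.\<close>

type_synonym progress = "rows \<times> segment list \<times> rect_move list"

definition extend_rows :: "nat \<times> nat \<Rightarrow> rows \<Rightarrow> rows" where
  "extend_rows i = map (\<lambda>q. if fst q = fst i
     then (fst q, min (fst (snd q)) (snd i), max (snd (snd q)) (snd i)) else q)"

text \<open>This is \<open>wall\<close> at the lower end of \<open>s\<close>, in a form computable
  from the list of rows.\<close>

definition keeps :: "rows \<Rightarrow> segment \<Rightarrow> bool" where
  "keeps rows s \<longleftrightarrow>
     list_ex (\<lambda>q. fst (snd q) = fst (fst s) \<or> snd (snd q) = fst (fst s)) rows \<and>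
     \<not> list_ex (\<lambda>q. fst (snd q) < fst (fst s) \<and> fst (fst s) < snd (snd q) \<and> snd (fst s) < fst q) rows"

definition split_list :: "nat \<times> nat \<Rightarrow> segment list \<Rightarrow> segment list" where
  "split_list i V = concat (map (\<lambda>s.
     if fst (fst s) = snd i \<and> snd (fst s) < fst i \<and> fst i < snd (snd s)
     then [(fst s, snd i, fst i), ((snd i, fst i), snd s)] else [s]) V)"

text \<open>The empty list covers targets that the row already reaches, as when the intervals of
  \<open>a\<close> and \<open>b\<close> share an end.\<close>

definition moves :: "nat \<times> nat \<Rightarrow> rows \<Rightarrow> segment list \<Rightarrow> rect_move list" where
  "moves i rows R = concat (map (\<lambda>q.
     if fst q = fst i \<and> (snd i < fst (snd q) \<or> snd (snd q) < snd i)
     then [((if snd i < fst (snd q) then fst (snd q) else snd (snd q), fst q), (snd i, fst q), R)]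
     else []) rows)"

text \<open>Extends row \<open>y\<close> to column \<open>z\<close> for \<open>i = (y, z)\<close>; the moves are collected in reverse.\<close>

definition extend :: "nat \<times> nat \<Rightarrow> progress \<Rightarrow> progress" where
  "extend i S =
     (extend_rows i (fst S),
      filter (keeps (extend_rows i (fst S))) (split_list i (fst (snd S))),
      moves i (fst S)
        (filter (\<lambda>s. \<not> keeps (extend_rows i (fst S)) s) (split_list i (fst (snd S)))) @
      snd (snd S))"

text \<open>The maximum merely reads off the single entry of row \<open>y\<close>; \<open>0\<close>
  is the default for a row that is missing.\<close>

definition low :: "nat \<Rightarrow> rows \<Rightarrow> nat" where
  "low y rows = fold max (map (\<lambda>q. fst (snd q)) (filter (\<lambda>q. fst q = y) rows)) 0"

definition high :: "nat \<Rightarrow> rows \<Rightarrow> nat" where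
  "high y rows = fold max (map (\<lambda>q. snd (snd q)) (filter (\<lambda>q. fst q = y) rows)) 0"

text \<open>The nearer end of \<open>b\<close> comes first: the wall there stands at the height of
  row \<open>a\<close>, and an extension has to stop at it.\<close>

definition extend_flip :: "point \<times> point \<Rightarrow> progress \<Rightarrow> progress" where
  "extend_flip f S =
     (if fst (fst f) < fst (snd f)
      then extend (snd (fst f), high (snd (snd f)) (fst S))
        (extend (snd (fst f), low (snd (snd f)) (fst S)) S)
      else extend (snd (fst f), low (snd (snd f)) (fst S))
        (extend (snd (fst f), high (snd (snd f)) (fst S)) S))"

text \<open>The last three assumptions of \<open>extension\<close>, bundled so that they can be
  established before the point set is fixed.\<close>

definition next_wall :: "nat \<Rightarrow> (nat \<Rightarrow> nat) \<Rightarrow> (nat \<Rightarrow> nat) \<Rightarrow> nat \<Rightarrow> nat \<Rightarrow> nat \<Rightarrow> bool" where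
  "next_wall n l r y e z \<longleftrightarrow>
     (z \<in> {1..n} \<longrightarrow>
        (\<exists>t. touches {1..n} l r z t) \<and> (\<forall>c. crosses {1..n} l r z c \<longrightarrow> c < y)) \<and>
     (\<forall>w t. min e z < w \<and> w < max e z \<and> touches {1..n} l r w t \<longrightarrow>
        (\<exists>c. crosses {1..n} l r w c \<and> y < c)) \<and>
     (l y < r y \<longrightarrow> (\<forall>t. touches {1..n} l r e t \<and> t \<noteq> y \<longrightarrow> y < t))"

locale progress =
  fixes n :: nat and x :: "nat \<Rightarrow> nat" and P0 :: "point set" and L0 :: "segment set"
begin

text \<open>The point set is hidden by a quantifier since it depends on the history: points remain
  when the walls through them are removed. Everything else is determined by \<open>l\<close>,
  \<open>r\<close> and this set.\<close>

definition reaches :: "(nat \<Rightarrow> nat) \<Rightarrow> (nat \<Rightarrow> nat) \<Rightarrow> progress \<Rightarrow> nat \<Rightarrow> bool" where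
  "reaches l r S k \<longleftrightarrow> (\<exists>P. config n x P l r \<and> P0 \<subseteq> P \<and>
     fst S = map (\<lambda>y. (y, l y, r y)) (rev [1..<n+1]) \<and>
     set (fst (snd S)) = col_segs n P (wall n l r) \<and>
     exec (rect_step n) (P0, L0) (rev (snd (snd S))) (P, segs n P l r (wall n l r)) \<and>
     length (snd (snd S)) \<le> k)"

end

section \<open>Agreement of the list operations with interval configurations\<close>

lemma extend_rows_map:
  "extend_rows (y, z) (map (\<lambda>y. (y, l y, r y)) ys) =
    map (\<lambda>t. (t, (l(y := min (l y) z)) t, (r(y := max (r y) z)) t)) ys"
  by (induction ys) (simp_all add: extend_rows_def)

lemma keeps_map:
  "keeps (map (\<lambda>y. (y, l y, r y)) (rev [1..<n+1])) s = wall n l r (fst (fst s)) (snd (fst s))"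
proof -
  have ex: "list_ex Q (map (\<lambda>y. (y, l y, r y)) (rev [1..<n+1])) \<longleftrightarrow> (\<exists>y\<in>{1..n}. Q (y, l y, r y))" for Q
    by (auto simp: list_ex_iff simp del: upt_Suc)
  show ?thesis
    unfolding keeps_def ex wall_def touches_def crosses_def fst_conv snd_conv
    by (intro arg_cong2[where f = "(\<and>)"]) (blast, meson not_le)
qed

lemma set_split_list:
  assumes "set V = col_segs n P W"
  shows "set (split_list (y, z) V) = split_at (z, y) (col_segs n P W)"
proof -
  have interior: "(z, y) \<in> seg_points s - endpoints s \<longleftrightarrow>
      fst (fst s) = z \<and> snd (fst s) < y \<and> y < snd (snd s)" if "s \<in> col_segs n P W" for s
    using that by (auto simp: col_segs_def seg_points_def endpoints_def)
  have "set (split_list (y, z) V) = (\<Union>s\<in>col_segs n P W. set (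
      if fst (fst s) = z \<and> snd (fst s) < y \<and> y < snd (snd s)
      then [(fst s, z, y), ((z, y), snd s)] else [s]))"
    by (simp only: split_list_def set_concat set_map image_image assms fst_conv snd_conv)
  also have "\<dots> = split_at (z, y) (col_segs n P W)"
    unfolding split_at_def by (rule SUP_cong[OF refl]) (auto simp only: interior list.set split: if_split)
  finally show ?thesis .
qed

lemma concat_map_singleton:
  assumes "distinct xs" "y \<in> set xs"
  shows "concat (map (\<lambda>x. if x = y then f x else []) xs) = f y"
  using assms
proof (induction xs)
  case (Cons a xs)
  have "concat (map (\<lambda>x. if x = y then f x else []) xs) = []" if "y \<notin> set xs"
    using that by (induction xs) auto
  then show ?case using Cons by auto
qed simp

lemma moves_map:
  assumes "y \<in> {1..n}"
  shows "moves (y, z) (map (\<lambda>y. (y, l y, r y)) (rev [1..<n+1])) R =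
    (if z < l y \<or> r y < z then [((if z < l y then l y else r y, y), (z, y), R)] else [])"
proof -
  let ?f = "\<lambda>t. if z < l t \<or> r t < z then [((if z < l t then l t else r t, t), (z, t), R)] else []"
  have "moves (y, z) (map (\<lambda>y. (y, l y, r y)) (rev [1..<n+1])) R =
      concat (map (\<lambda>t. if t = y then ?f t else []) (rev [1..<n+1]))"
    unfolding moves_def by (rule arg_cong[where f = concat]) auto
  also have "\<dots> = ?f y"
    by (rule concat_map_singleton) (use assms in auto)
  finally show ?thesis .
qed

lemma filter_rows:
  assumes "y \<in> {1..n}"
  shows "filter (\<lambda>q. fst q = y) (map (\<lambda>y. (y, l y, r y)) (rev [1..<n+1])) = [(y, l y, r y)]"
proof -
  have "filter (\<lambda>q. fst q = y) (map (\<lambda>y. (y, l y, r y)) ys) =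
      concat (map (\<lambda>t. if t = y then [(t, l t, r t)] else []) ys)" for ys
    by (induction ys) auto
  moreover have "concat (map (\<lambda>t. if t = y then [(t, l t, r t)] else []) (rev [1..<n+1])) = [(y, l y, r y)]"
    by (rule concat_map_singleton) (use assms in auto)
  ultimately show ?thesis by simp
qed

lemma exec_snoc: "exec step s ms t \<Longrightarrow> step t m u \<Longrightarrow> exec step s (ms @ [m]) u"
  by (induction rule: exec.induct) (auto intro: exec.intros)

context progress
begin

lemma reaches_low_high:
  assumes "reaches l r S k" "y \<in> {1..n}"
  shows "low y (fst S) = l y" "high y (fst S) = r y"
  using assms filter_rows[of y n l r] unfolding reaches_def low_def high_def by auto

text \<open>The case \<open>inside\<close> admits void extensions, for which no move is emitted:
  \<open>(z, y)\<close> is already a point, so splitting and filtering leave the walls as they are.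
  The budget is raised by one in either case.\<close>

lemma reaches_extend:
  assumes S: "reaches l r S k" and y: "y \<in> {1..n}" and z: "z \<le> n + 1"
    and left: "z < l y \<Longrightarrow> next_wall n l r y (l y) z"
    and right: "r y < z \<Longrightarrow> next_wall n l r y (r y) z"
    and inside: "l y \<le> z \<Longrightarrow> z \<le> r y \<Longrightarrow> z = l y \<or> z = r y"
  shows "reaches (l(y := min (l y) z)) (r(y := max (r y) z)) (extend (y, z) S) (k + 1)"
proof -
  from S obtain P where P: "config n x P l r" "P0 \<subseteq> P"
    and rows: "fst S = map (\<lambda>y. (y, l y, r y)) (rev [1..<n+1])"
    and V: "set (fst (snd S)) = col_segs n P (wall n l r)"
    and ex: "exec (rect_step n) (P0, L0) (rev (snd (snd S))) (P, segs n P l r (wall n l r))"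
    and len: "length (snd (snd S)) \<le> k"
    unfolding reaches_def by blast
  interpret config n x P l r by (rule P(1))
  let ?l = "l(y := min (l y) z)" and ?r = "r(y := max (r y) z)"
  let ?V = "split_list (y, z) (fst (snd S))"
  let ?R = "filter (\<lambda>s. \<not> keeps (extend_rows (y, z) (fst S)) s) ?V"
  have rows': "extend_rows (y, z) (fst S) = map (\<lambda>t. (t, ?l t, ?r t)) (rev [1..<n+1])"
    unfolding rows by (rule extend_rows_map)
  have keeps: "keeps (extend_rows (y, z) (fst S)) s = wall n ?l ?r (fst (fst s)) (snd (fst s))" for s
    unfolding rows' by (rule keeps_map)
  have V': "set ?V = split_at (z, y) (col_segs n P (wall n l r))"
    by (rule set_split_list[OF V])
  show ?thesis
  proof (cases "z < l y \<or> r y < z")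
    case True
    let ?e = "if z < l y then l y else r y"
    have nw: "next_wall n l r y ?e z" using left right True by auto
    interpret extension n x P l r y ?e z
    proof
      show "\<exists>c. crosses {1..n} l r w c \<and> y < c"
        if "min ?e z < w" "w < max ?e z" "touches {1..n} l r w t" for w t
        using nw that unfolding next_wall_def by blast
    qed (use nw y z True in \<open>auto simp: next_wall_def\<close>)
    have "rect_step n (P, segs n P l r (wall n l r)) ((?e, y), (z, y), ?R)
        (insert (z, y) P, segs n (insert (z, y) P) ?l ?r (wall n ?l ?r))"
      by (rule rect_step) (force simp: V' keeps)
    moreover have "snd (snd (extend (y, z) S)) = ((?e, y), (z, y), ?R) # snd (snd S)"
      using moves_map[OF y, of z l r ?R] True unfolding rows[symmetric] by (simp add: extend_def)
    moreover have "set (filter (keeps (extend_rows (y, z) (fst S))) ?V) =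
        col_segs n (insert (z, y) P) (wall n ?l ?r)"
    proof -
      have "col_segs n (insert (z, y) P) (wall n ?l ?r) =
          {s \<in> col_segs n (insert (z, y) P) (wall n l r). wall n ?l ?r (fst (fst s)) (snd (fst s))}"
        using wall' unfolding col_segs_def by (auto simp: consec_def)
      then show ?thesis using V' split_cols by (simp add: keeps)
    qed
    ultimately show ?thesis
      using config' P(2) len rows' exec_snoc[OF ex]
      unfolding reaches_def by (intro exI[of _ "insert (z, y) P"]) (auto simp: extend_def)
  next
    case False
    then have id: "?l = l" "?r = r" by auto
    have zy: "(z, y) \<in> P" using inside False ends[OF y] by auto
    have "split_at (z, y) (col_segs n P (wall n l r)) = col_segs n P (wall n l r)"
      using cover.seg_props(3)[OF cover] zy unfolding segs_def by (intro split_at_id) blast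
    then have "set (filter (keeps (extend_rows (y, z) (fst S))) ?V) = col_segs n P (wall n l r)"
      using V' unfolding set_filter keeps id by (auto simp: col_segs_def)
    moreover have "snd (snd (extend (y, z) S)) = snd (snd S)"
      using moves_map[OF y, of z l r] False unfolding rows[symmetric] by (simp add: extend_def)
    ultimately show ?thesis
      unfolding reaches_def id using P ex len rows'[unfolded id]
      by (intro exI[of _ P]) (auto simp: extend_def)
  qed
qed

end

text \<open>\<open>l0 y\<close> and \<open>r0 y\<close> are the columns of the nearest lower points to the left and right of point \<open>y\<close>.\<close>

locale nearest_lower =
  fixes n :: nat and x l0 r0 :: "nat \<Rightarrow> nat"
  assumes bij: "bij_betw x {1..n} {1..n}"
    and l0: "y \<in> {1..n} \<Longrightarrow> l0 y < x y"
      "y \<in> {1..n} \<Longrightarrow> u \<in> {1..n} \<Longrightarrow> u < y \<Longrightarrow> x u < x y \<Longrightarrow> x u \<le> l0 y"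
      "y \<in> {1..n} \<Longrightarrow> l0 y = 0 \<or> (\<exists>u\<in>{1..n}. u < y \<and> l0 y = x u)"
    and r0: "y \<in> {1..n} \<Longrightarrow> x y < r0 y"
      "y \<in> {1..n} \<Longrightarrow> u \<in> {1..n} \<Longrightarrow> u < y \<Longrightarrow> x y < x u \<Longrightarrow> r0 y \<le> x u"
      "y \<in> {1..n} \<Longrightarrow> r0 y = n + 1 \<or> (\<exists>u\<in>{1..n}. u < y \<and> r0 y = x u)"
begin

lemma x_in: "y \<in> {1..n} \<Longrightarrow> x y \<in> {1..n}"
  using bij by (auto simp: bij_betw_def)

lemma x_eq: "u \<in> {1..n} \<Longrightarrow> v \<in> {1..n} \<Longrightarrow> x u = x v \<longleftrightarrow> u = v"
  using bij by (meson bij_betw_def inj_on_eq_iff)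

lemma x_surj: "w \<in> {1..n} \<Longrightarrow> \<exists>u\<in>{1..n}. x u = w"
  using bij unfolding bij_betw_def by (metis imageE)

lemma not_inside:
  assumes "u \<in> {1..n}" "c \<in> {1..n}" "u < c"
  shows "\<not> (l0 c < x u \<and> x u < r0 c)"
  using l0(2)[OF assms(2,1,3)] r0(2)[OF assms(2,1,3)] x_eq[OF assms(1,2)] assms(3)
  by (metis leD linorder_neqE_nat nat_neq_iff)

text \<open>Lower points never lie strictly inside the interval of \<open>k\<close>, so a column
  there belongs to a higher point.\<close>

lemma inside:
  assumes "k \<in> {1..n}" "l0 k < w" "w < r0 k" "w \<noteq> x k"
  shows "\<exists>u\<in>{1..n}. k < u \<and> x u = w"
proof -
  have "w \<in> {1..n}" using assms r0(3)[OF assms(1)] x_in by fastforce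
  then obtain u where u: "u \<in> {1..n}" "x u = w" using x_surj by blast
  moreover have "k < u"
    using not_inside[OF u(1) assms(1)] u(2) assms(2-4) by (metis linorder_neqE_nat)
  ultimately show ?thesis by blast
qed

end

section \<open>Drawing the rows for the treap and completing nested rows\<close>

context progress
begin

text \<open>Only the rows \<open>1\<close> to \<open>n\<close> matter; this absorbs the values of
  the total functions \<open>l\<close> and \<open>r\<close> elsewhere.\<close>

lemma reaches_cong:
  assumes "reaches l r S k" "\<And>y. y \<in> {1..n} \<Longrightarrow> l y = l' y \<and> r y = r' y" "k \<le> k'"
  shows "reaches l' r' S k'"
proof -
  have eq: "touches {1..n} l r w t \<longleftrightarrow> touches {1..n} l' r' w t"
    "crosses {1..n} l r w t \<longleftrightarrow> crosses {1..n} l' r' w t" for w t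
    using assms(2)[of t] by (auto simp: touches_def crosses_def)
  then have "wall n l r = wall n l' r'" by (simp add: wall_def fun_eq_iff)
  moreover have "config n x P l r \<longleftrightarrow> config n x P l' r'" for P
    using assms(2) unfolding config_def eq by auto
  moreover have "row_segs n P l r = row_segs n P l' r'" for P
  proof -
    have "y \<in> {1..n} \<and> l y \<le> u \<and> v \<le> r y \<and> Q \<longleftrightarrow> y \<in> {1..n} \<and> l' y \<le> u \<and> v \<le> r' y \<and> Q"
      for y u v Q using assms(2)[of y] by auto
    then show ?thesis unfolding row_segs_def by (simp only:)
  qed
  moreover have "map (\<lambda>y. (y, l y, r y)) (rev [1..<n+1]) = map (\<lambda>y. (y, l' y, r' y)) (rev [1..<n+1])"
    using assms(2) by (intro map_cong) auto
  ultimately show ?thesis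
    using assms(1,3) order_trans unfolding reaches_def segs_def by (simp only:) blast
qed

text \<open>The rows are drawn from top to bottom; a row \<open>y \<le> k\<close> not yet drawn is the single point \<open>x y\<close>.\<close>

lemma draw_row:
  assumes "nearest_lower n x l0 r0" and k: "k \<in> {1..n}"
    and S: "reaches (\<lambda>y. if k < y then l0 y else x y) (\<lambda>y. if k < y then r0 y else x y) S m"
  shows "reaches (\<lambda>y. if k - 1 < y then l0 y else x y) (\<lambda>y. if k - 1 < y then r0 y else x y)
    (extend (k, r0 k) (extend (k, l0 k) S)) (m + 2)"
proof -
  interpret nearest_lower n x l0 r0 by fact
  define l where "l y = (if k < y then l0 y else x y)" for y
  define r where "r y = (if k < y then r0 y else x y)" for y
  let ?l = "l(k := l0 k)"
  have x_k: "l k = x k" "r k = x k" by (auto simp: l_def r_def)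
  \<comment> \<open>Row \<open>u\<close> is still a single point and therefore ends in its own
    column, which makes that column a wall. By \<open>not_inside\<close> no row above
    \<open>k\<close> crosses it.\<close>
  have target: "(\<exists>t. touches {1..n} l' r z t) \<and> (\<forall>c. crosses {1..n} l' r z c \<longrightarrow> c < k)"
    if "u \<in> {1..n}" "u < k" "z = x u" "l' = l \<or> l' = ?l" "l' = ?l \<longrightarrow> x k < z" for z u l'
  proof (intro conjI exI allI impI)
    show "touches {1..n} l' r z u"
      using that by (auto simp: touches_def l_def)
    fix c assume "crosses {1..n} l' r z c"
    then have c: "c \<in> {1..n}" "l' c < z" "z < r c" by (auto simp: crosses_def)
    have "\<not> k < c"
      using not_inside[OF that(1) c(1)] that c by (auto simp: l_def r_def)
    moreover have "c \<noteq> k" using c that by (auto simp: r_def l_def)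
    ultimately show "c < k" by simp
  qed
  \<comment> \<open>Such a column belongs to a higher point, whose row is drawn already and crosses
    it above \<open>k\<close>.\<close>
  have free: "\<exists>c. crosses {1..n} l' r w c \<and> k < c"
    if "l0 k < w" "w < r0 k" "w \<noteq> x k" "l' = l \<or> l' = ?l" for w l'
  proof -
    from inside[OF k that(1-3)] obtain u where "u \<in> {1..n}" "k < u" "x u = w" by blast
    then show ?thesis
      using that(4) l0(1) r0(1) by (intro exI[of _ u]) (auto simp: crosses_def l_def r_def)
  qed
  have "reaches (l(k := min (l k) (l0 k))) (r(k := max (r k) (l0 k))) (extend (k, l0 k) S) (m + 1)"
  proof (rule reaches_extend)
    show "reaches l r S m" using S by (simp add: l_def[abs_def] r_def[abs_def])
    show "l0 k \<le> n + 1" using l0(1)[OF k] x_in[OF k] by auto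
    show "next_wall n l r k (l k) (l0 k)"
      unfolding next_wall_def
    proof (rule conjI, rule impI, goal_cases)
      case 1
      then obtain u where "u \<in> {1..n}" "u < k" "l0 k = x u"
        using l0(3)[OF k] by auto
      \<comment> \<open>\<open>target\<close> asks for \<open>x k < z\<close> only once the left
        part of row \<open>k\<close> is drawn.\<close>
      moreover have "l \<noteq> ?l"
        using l0(1)[OF k] x_k(1) by (metis fun_upd_same less_irrefl)
      ultimately show ?case by (intro target) auto
    next
      case 2
      have "\<exists>c. crosses {1..n} l r w c \<and> k < c" if "min (l k) (l0 k) < w" "w < max (l k) (l0 k)" for w
        using that l0(1)[OF k] r0(1)[OF k] by (intro free) (auto simp: x_k)
      then show ?case using x_k by auto
    qed
  qed (use k l0(1)[OF k] x_k in auto)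
  then have S1: "reaches ?l r (extend (k, l0 k) S) (m + 1)"
    using l0(1)[OF k] x_k by (simp add: min_absorb2 max_absorb1 fun_upd_idem)
  have "reaches (?l(k := min (?l k) (r0 k))) (r(k := max (r k) (r0 k)))
      (extend (k, r0 k) (extend (k, l0 k) S)) (m + 1 + 1)"
  proof (rule reaches_extend[OF S1 k])
    show "r0 k \<le> n + 1" using r0(3)[OF k] x_in by fastforce
    \<comment> \<open>Undrawn rows are points in distinct columns, so any other row ending at
      \<open>x k\<close> is drawn and hence higher.\<close>
    have "k < t" if "touches {1..n} ?l r (x k) t" "t \<noteq> k" for t
      using that x_eq[OF k, of t] by (auto simp: touches_def l_def r_def split: if_splits)
    then show "next_wall n ?l r k (r k) (r0 k)"
      unfolding next_wall_def
    proof (intro conjI, rule_tac impI, goal_cases)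
      case 1
      then obtain u where "u \<in> {1..n}" "u < k" "r0 k = x u"
        using r0(3)[OF k] by auto
      then show ?case using r0(1)[OF k] by (intro target) auto
    next
      case 2
      have "\<exists>c. crosses {1..n} ?l r w c \<and> k < c" if "min (r k) (r0 k) < w" "w < max (r k) (r0 k)" for w
        using that l0(1)[OF k] r0(1)[OF k] by (intro free) (auto simp: x_k)
      then show ?case by blast
    next
      case 3
      then show ?case by (simp add: x_k)
    qed
  qed (use r0(1)[OF k] l0(1)[OF k] x_k in auto)
  moreover have "?l(k := min (?l k) (r0 k)) = (\<lambda>y. if k - 1 < y then l0 y else x y)"
    "r(k := max (r k) (r0 k)) = (\<lambda>y. if k - 1 < y then r0 y else x y)"
    using r0(1)[OF k] l0(1)[OF k] k by (auto simp: l_def r_def fun_eq_iff)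
  ultimately show ?thesis by simp
qed

lemma draw_rows:
  assumes "nearest_lower n x l0 r0" and S: "reaches x x S 0" and "k \<le> n"
    and "\<And>y. y \<in> {1..n} \<Longrightarrow> g y = [(y, l0 y), (y, r0 y)]"
  shows "reaches (\<lambda>y. if k < y then l0 y else x y) (\<lambda>y. if k < y then r0 y else x y)
    (fold extend (concat (map g (rev [k+1..<n+1]))) S) (2 * (n - k))"
  using \<open>k \<le> n\<close>
proof (induction k rule: inc_induct)
  case base
  have "reaches (\<lambda>y. if n < y then l0 y else x y) (\<lambda>y. if n < y then r0 y else x y) S 0"
    by (rule reaches_cong[OF S]) auto
  then show ?case by simp
next
  case (step k)
  have "[k+1..<n+1] = (k + 1) # [Suc k + 1..<n+1]"
    using step.hyps by (simp add: upt_conv_Cons del: upt_Suc)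
  then have "concat (map g (rev [k+1..<n+1])) =
      concat (map g (rev [Suc k + 1..<n+1])) @ [(k + 1, l0 (k + 1)), (k + 1, r0 (k + 1))]"
    using assms(4)[of "k + 1"] step.hyps by simp
  moreover have "reaches (\<lambda>y. if k + 1 - 1 < y then l0 y else x y)
    (\<lambda>y. if k + 1 - 1 < y then r0 y else x y)
    (extend (k + 1, r0 (k + 1)) (extend (k + 1, l0 (k + 1))
      (fold extend (concat (map g (rev [Suc k + 1..<n+1]))) S))) (2 * (n - Suc k) + 2)"
    by (rule draw_row[OF assms(1)]) (use step in simp_all)
  moreover have "2 * (n - Suc k) + 2 = 2 * (n - k)"
    using step.hyps by simp
  ultimately show ?case
    by (simp only: fold_append comp_def fold_simps add_diff_cancel_right')
qed

text \<open>If the intervals are nested, the walls left over can be crossed one at a time from bottom to top.\<close>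

lemma finish_row:
  assumes k: "k \<in> {1..n}" and x: "\<And>y. y \<in> {1..n} \<Longrightarrow> l y < x y \<and> x y < r y"
    and nested: "\<And>u v. u \<in> {1..n} \<Longrightarrow> v \<in> {1..n} \<Longrightarrow> u \<le> v \<Longrightarrow> nested l r v u"
    and r_le: "\<And>y. y \<in> {1..n} \<Longrightarrow> r y \<le> n + 1"
    and S: "reaches (\<lambda>y. if y < k then 0 else l y) (\<lambda>y. if y < k then n + 1 else r y) S m"
  shows "reaches (\<lambda>y. if y < k + 1 then 0 else l y) (\<lambda>y. if y < k + 1 then n + 1 else r y)
    (extend (k, n + 1) (extend (k, 0) S)) (m + 2)"
proof -
  define l1 where "l1 y = (if y < k then 0 else l y)" for y
  define r1 where "r1 y = (if y < k then n + 1 else r y)" for y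
  let ?l = "l1(k := 0)"
  \<comment> \<open>Rows from \<open>k\<close> on have no end left of \<open>l k\<close> by nesting,
    and the lower ones already end in the margin columns.\<close>
  have free: "\<not> touches {1..n} l1 r1 w t" if "0 < w" "w < l k" for w t
    using that nested[OF k, of t] x[OF k] x[of t] r_le[OF k]
    by (auto simp: touches_def l1_def r1_def nested_def)
  have free': "\<not> touches {1..n} ?l r1 w t" if "r k < w" "w < n + 1" for w t
    using that nested[OF k, of t] x[OF k] x[of t] r_le[OF k]
    by (auto simp: touches_def l1_def r1_def nested_def split: if_splits)
  have "reaches (l1(k := min (l1 k) 0)) (r1(k := max (r1 k) 0)) (extend (k, 0) S) (m + 1)"
  proof (rule reaches_extend)
    show "reaches l1 r1 S m" using S by (simp add: l1_def[abs_def] r1_def[abs_def])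
    show "next_wall n l1 r1 k (l1 k) 0" if "0 < l1 k"
      unfolding next_wall_def
    proof (intro conjI allI impI)
      fix w t assume "min (l1 k) 0 < w \<and> w < max (l1 k) 0 \<and> touches {1..n} l1 r1 w t"
      then show "\<exists>c. crosses {1..n} l1 r1 w c \<and> k < c"
        using free[of w t] by (auto simp: l1_def)
    next
      fix t assume "touches {1..n} l1 r1 (l1 k) t \<and> t \<noteq> k"
      then show "k < t"
        using that x[OF k] r_le[OF k] by (auto simp: touches_def l1_def r1_def split: if_splits)
    qed auto
  qed (use k in \<open>auto simp: l1_def\<close>)
  then have S1: "reaches ?l r1 (extend (k, 0) S) (m + 1)"
    by simp
  have "reaches (?l(k := min (?l k) (n + 1))) (r1(k := max (r1 k) (n + 1)))
      (extend (k, n + 1) (extend (k, 0) S)) (m + 1 + 1)"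
  proof (rule reaches_extend[OF S1 k])
    show "next_wall n ?l r1 k (r1 k) (n + 1)" if "r1 k < n + 1"
      unfolding next_wall_def
    proof (intro conjI allI impI)
      fix w t assume "min (r1 k) (n + 1) < w \<and> w < max (r1 k) (n + 1) \<and> touches {1..n} ?l r1 w t"
      then show "\<exists>c. crosses {1..n} ?l r1 w c \<and> k < c"
        using free'[of w t] that by (auto simp: r1_def split: if_splits)
    next
      fix t assume "touches {1..n} ?l r1 (r1 k) t \<and> t \<noteq> k"
      then show "k < t"
        using that x[OF k] by (auto simp: touches_def l1_def r1_def split: if_splits)
    qed auto
  qed (use r_le[OF k] x[OF k] in \<open>auto simp: r1_def\<close>)
  moreover have "?l(k := min (?l k) (n + 1)) = (\<lambda>y. if y < k + 1 then 0 else l y)"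
    "r1(k := max (r1 k) (n + 1)) = (\<lambda>y. if y < k + 1 then n + 1 else r y)"
    using r_le[OF k] by (auto simp: l1_def r1_def fun_eq_iff)
  ultimately show ?thesis by simp
qed

lemma finish_rows:
  assumes "\<And>y. y \<in> {1..n} \<Longrightarrow> l y < x y \<and> x y < r y"
    and "\<And>u v. u \<in> {1..n} \<Longrightarrow> v \<in> {1..n} \<Longrightarrow> u \<le> v \<Longrightarrow> nested l r v u"
    and "\<And>y. y \<in> {1..n} \<Longrightarrow> r y \<le> n + 1"
    and S: "reaches l r S m" and "k \<le> n"
    and "\<And>y. y \<in> {1..n} \<Longrightarrow> g y = [(y, 0), (y, n + 1)]"
  shows "reaches (\<lambda>y. if y < k + 1 then 0 else l y) (\<lambda>y. if y < k + 1 then n + 1 else r y)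
    (fold extend (concat (map g [1..<k+1])) S) (m + 2 * k)"
  using \<open>k \<le> n\<close>
proof (induction k)
  case 0
  have "reaches (\<lambda>y. if y < 0 + 1 then 0 else l y) (\<lambda>y. if y < 0 + 1 then n + 1 else r y) S m"
    by (rule reaches_cong[OF S]) auto
  then show ?case by simp
next
  case (Suc k)
  have "concat (map g [1..<Suc k + 1]) =
      concat (map g [1..<k+1]) @ [(k + 1, 0), (k + 1, n + 1)]"
    using assms(6)[of "k + 1"] Suc.prems by simp
  moreover have "reaches (\<lambda>y. if y < (k + 1) + 1 then 0 else l y)
    (\<lambda>y. if y < (k + 1) + 1 then n + 1 else r y)
    (extend (k + 1, n + 1) (extend (k + 1, 0)
      (fold extend (concat (map g [1..<k+1])) S))) (m + 2 * k + 2)"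
    by (rule finish_row) (use Suc assms in auto)
  ultimately show ?case by simp
qed

end

section \<open>Edge-flips as extensions of intervals\<close>

definition tree_of :: "nat \<Rightarrow> (nat \<Rightarrow> nat) \<Rightarrow> (nat \<Rightarrow> nat) \<Rightarrow> (nat \<Rightarrow> nat) \<Rightarrow> edge set" where
  "tree_of n x l r = {((x u, u), (x v, v)) | u v. parent {1..n} l r u v}"

lemma embed:
  "touches Y (\<lambda>y. int (l y)) (\<lambda>y. int (r y)) (int w) t = touches Y l r w t"
  "crosses Y (\<lambda>y. int (l y)) (\<lambda>y. int (r y)) (int w) t = crosses Y l r w t"
  "parent Y (\<lambda>y. int (l y)) (\<lambda>y. int (r y)) u v = parent Y l r u v"
  by (simp_all add: touches_def crosses_def parent_def nested_def)

lemma embed_mirror: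
  "touches Y (\<lambda>y. - int (r y)) (\<lambda>y. - int (l y)) (- int w) t = touches Y l r w t"
  "crosses Y (\<lambda>y. - int (r y)) (\<lambda>y. - int (l y)) (- int w) t = crosses Y l r w t"
  "parent Y (\<lambda>y. - int (r y)) (\<lambda>y. - int (l y)) u v = parent Y l r u v"
  by (auto simp: touches_def crosses_def parent_def nested_def)

lemma laminar_embed:
  assumes "\<And>y. y \<in> Y \<Longrightarrow> l y < x y \<and> x y < (r y :: nat)"
    and "\<And>w c t. crosses Y l r w c \<Longrightarrow> touches Y l r w t \<Longrightarrow> c < t"
  shows "laminar Y (\<lambda>y. int (x y)) (\<lambda>y. int (l y)) (\<lambda>y. int (r y))"
proof
  show "c < t" if c: "crosses Y (\<lambda>y. int (l y)) (\<lambda>y. int (r y)) w c"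
      and t: "touches Y (\<lambda>y. int (l y)) (\<lambda>y. int (r y)) w t" for w c t
  proof -
    obtain w' where "w = int w'" using t by (auto simp: touches_def)
    then show ?thesis using c t assms(2) by (simp add: embed)
  qed
qed (use assms(1) in simp)

context progress
begin

lemma reaches_config: "reaches l r S m \<Longrightarrow> \<exists>P. config n x P l r"
  unfolding reaches_def by blast

text \<open>Row \<open>a\<close> is extended to \<open>l b\<close>, which is void if
  \<open>r a = l b\<close>, and then across the interval of \<open>b\<close>. The second extension
  is unobstructed since every column strictly inside that interval is crossed by the higher row
  \<open>b\<close> itself.\<close>

lemma flip_right:
  assumes S: "reaches l r S m" and x: "\<And>y. y \<in> {1..n} \<Longrightarrow> l y < x y \<and> x y < r y"
    and p: "parent {1..n} l r p a" "parent {1..n} l r p b" and ab: "a < b" "x a < x b"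
    and adj: "\<And>c. parent {1..n} l r p c \<Longrightarrow> \<not> (x a < x c \<and> x c < x b)"
  shows "reaches l (r(a := r b)) (extend (a, r b) (extend (a, l b) S)) (m + 2)"
    and "parent {1..n} l (r(a := r b)) u v \<longleftrightarrow>
      parent {1..n} l r u v \<and> (u, v) \<noteq> (p, b) \<or> (u, v) = (a, b)"
proof -
  from reaches_config[OF S] obtain P where "config n x P l r" by blast
  then interpret config n x P l r .
  interpret I: laminar "{1..n}" "\<lambda>y. int (x y)" "\<lambda>y. int (l y)" "\<lambda>y. int (r y)"
    by (rule laminar_embed[OF x crosses_less_touches])
  interpret I: adjacent_children "{1..n}" "\<lambda>y. int (x y)" "\<lambda>y. int (l y)" "\<lambda>y. int (r y)" p a b
    using p ab adj by unfold_locales (simp_all add: embed)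
  have fun_upd: "(\<lambda>y. int (r y))(a := int (r b)) = (\<lambda>y. int ((r(a := r b)) y))" by auto
  show "parent {1..n} l (r(a := r b)) u v \<longleftrightarrow>
      parent {1..n} l r u v \<and> (u, v) \<noteq> (p, b) \<or> (u, v) = (a, b)"
    using I.flip_parent[of u v] unfolding fun_upd embed .
  have a: "a \<in> {1..n}" and b: "b \<in> {1..n}" using I.in_Y by auto
  have le: "r a \<le> l b" using I.r_le_l by simp
  have gap: "a < t \<and> (w = r a \<or> w = l b)"
    if "touches {1..n} l r w t" "r a \<le> w" "w \<le> l b" "t \<noteq> a" for w t
    using I.touches_gap[of "int w" t] that unfolding embed by simp
  have ends_b: "c < a" if "crosses {1..n} l r w c" "w = l b \<or> w = r b" for w c
    using I.crosses_ends[of "int w" c] that unfolding embed by auto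
  have lr: "l a < x a" "x a < r a" "l b < x b" "x b < r b" using x a b by auto
  have "reaches (l(a := min (l a) (l b))) (r(a := max (r a) (l b))) (extend (a, l b) S) (m + 1)"
  proof (rule reaches_extend[OF S a])
    show "next_wall n l r a (r a) (l b)" if "r a < l b"
      unfolding next_wall_def
    proof (intro conjI allI impI)
      show "\<exists>t. touches {1..n} l r (l b) t" using b by (auto simp: touches_def)
      show "c < a" if "crosses {1..n} l r (l b) c" for c using ends_b that by blast
      show "\<exists>c. crosses {1..n} l r w c \<and> a < c"
        if "min (r a) (l b) < w \<and> w < max (r a) (l b) \<and> touches {1..n} l r w t" for w t
        using gap[of w t] that le lr by (cases "t = a") (auto simp: touches_def)
      show "a < t" if "touches {1..n} l r (r a) t \<and> t \<noteq> a" for t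
        using gap[of "r a" t] that le by auto
    qed
  qed (use le lr bounds[OF b] in auto)
  then have S1: "reaches l (r(a := l b)) (extend (a, l b) S) (m + 1)"
    using le lr by (simp add: min_absorb1 max_absorb2 fun_upd_idem)
  let ?r = "r(a := l b)"
  have "reaches (l(a := min (l a) (r b))) (?r(a := max (?r a) (r b)))
      (extend (a, r b) (extend (a, l b) S)) (m + 1 + 1)"
  proof (rule reaches_extend[OF S1 a])
    show "next_wall n l ?r a (?r a) (r b)"
      unfolding next_wall_def
    proof (intro conjI allI impI)
      show "\<exists>t. touches {1..n} l ?r (r b) t" using b ab by (auto simp: touches_def)
      show "c < a" if "crosses {1..n} l ?r (r b) c" for c
        using ends_b[of "r b" c] that lr by (auto simp: crosses_def split: if_splits)
      show "\<exists>c. crosses {1..n} l ?r w c \<and> a < c"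
        if "min (?r a) (r b) < w \<and> w < max (?r a) (r b) \<and> touches {1..n} l ?r w t" for w t
        using that lr ab b by (intro exI[of _ b]) (auto simp: crosses_def)
      show "a < t" if "touches {1..n} l ?r (?r a) t \<and> t \<noteq> a" for t
        using gap[of "l b" t] that le by (auto simp: touches_def)
    qed
  qed (use le lr bounds[OF b] in auto)
  moreover have "l(a := min (l a) (r b)) = l" "?r(a := max (?r a) (r b)) = r(a := r b)"
    using le lr by auto
  ultimately show "reaches l (r(a := r b)) (extend (a, r b) (extend (a, l b) S)) (m + 2)"
    by simp
qed

text \<open>Negating columns exchanges the two ends of an interval, so the facts about adjacent
  children apply to the reflected family.\<close>

lemma flip_left:
  assumes S: "reaches l r S m" and x: "\<And>y. y \<in> {1..n} \<Longrightarrow> l y < x y \<and> x y < r y"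
    and p: "parent {1..n} l r p a" "parent {1..n} l r p b" and ab: "a < b" "x b < x a"
    and adj: "\<And>c. parent {1..n} l r p c \<Longrightarrow> \<not> (x b < x c \<and> x c < x a)"
  shows "reaches (l(a := l b)) r (extend (a, l b) (extend (a, r b) S)) (m + 2)"
    and "parent {1..n} (l(a := l b)) r u v \<longleftrightarrow>
      parent {1..n} l r u v \<and> (u, v) \<noteq> (p, b) \<or> (u, v) = (a, b)"
proof -
  from reaches_config[OF S] obtain P where "config n x P l r" by blast
  then interpret config n x P l r .
  interpret I: laminar "{1..n}" "\<lambda>y. - int (x y)" "\<lambda>y. - int (r y)" "\<lambda>y. - int (l y)"
    by (rule laminar.mirror[OF laminar_embed[OF x crosses_less_touches]])
  interpret I: adjacent_children "{1..n}" "\<lambda>y. - int (x y)" "\<lambda>y. - int (r y)" "\<lambda>y. - int (l y)" p a b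
    using p ab adj by unfold_locales (auto simp: embed_mirror)
  have fun_upd: "(\<lambda>y. - int (l y))(a := - int (l b)) = (\<lambda>y. - int ((l(a := l b)) y))" by auto
  show "parent {1..n} (l(a := l b)) r u v \<longleftrightarrow>
      parent {1..n} l r u v \<and> (u, v) \<noteq> (p, b) \<or> (u, v) = (a, b)"
    using I.flip_parent[of u v] unfolding fun_upd embed_mirror .
  have a: "a \<in> {1..n}" and b: "b \<in> {1..n}" using I.in_Y by auto
  have le: "r b \<le> l a" using I.r_le_l by simp
  have gap: "a < t \<and> (w = l a \<or> w = r b)"
    if "touches {1..n} l r w t" "r b \<le> w" "w \<le> l a" "t \<noteq> a" for w t
    using I.touches_gap[of "- int w" t] that unfolding embed_mirror by auto
  have ends_b: "c < a" if "crosses {1..n} l r w c" "w = l b \<or> w = r b" for w c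
    using I.crosses_ends[of "- int w" c] that unfolding embed_mirror by auto
  have lr: "l a < x a" "x a < r a" "l b < x b" "x b < r b" using x a b by auto
  have "reaches (l(a := min (l a) (r b))) (r(a := max (r a) (r b))) (extend (a, r b) S) (m + 1)"
  proof (rule reaches_extend[OF S a])
    show "next_wall n l r a (l a) (r b)" if "r b < l a"
      unfolding next_wall_def
    proof (intro conjI allI impI)
      show "\<exists>t. touches {1..n} l r (r b) t" using b by (auto simp: touches_def)
      show "c < a" if "crosses {1..n} l r (r b) c" for c using ends_b that by blast
      show "\<exists>c. crosses {1..n} l r w c \<and> a < c"
        if "min (l a) (r b) < w \<and> w < max (l a) (r b) \<and> touches {1..n} l r w t" for w t
        using gap[of w t] that le lr by (cases "t = a") (auto simp: touches_def)
      show "a < t" if "touches {1..n} l r (l a) t \<and> t \<noteq> a" for t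
        using gap[of "l a" t] that le by auto
    qed
  qed (use le lr bounds[OF b] in auto)
  then have S1: "reaches (l(a := r b)) r (extend (a, r b) S) (m + 1)"
    using le lr by (simp add: min_absorb2 max_absorb1 fun_upd_idem)
  let ?l = "l(a := r b)"
  have "reaches (?l(a := min (?l a) (l b))) (r(a := max (r a) (l b)))
      (extend (a, l b) (extend (a, r b) S)) (m + 1 + 1)"
  proof (rule reaches_extend[OF S1 a])
    show "next_wall n ?l r a (?l a) (l b)"
      unfolding next_wall_def
    proof (intro conjI allI impI)
      show "\<exists>t. touches {1..n} ?l r (l b) t" using b ab by (auto simp: touches_def)
      show "c < a" if "crosses {1..n} ?l r (l b) c" for c
        using ends_b[of "l b" c] that lr by (auto simp: crosses_def split: if_splits)
      show "\<exists>c. crosses {1..n} ?l r w c \<and> a < c"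
        if "min (?l a) (l b) < w \<and> w < max (?l a) (l b) \<and> touches {1..n} ?l r w t" for w t
        using that lr ab b by (intro exI[of _ b]) (auto simp: crosses_def)
      show "a < t" if "touches {1..n} ?l r (?l a) t \<and> t \<noteq> a" for t
        using gap[of "r b" t] that le by (auto simp: touches_def)
    qed
  qed (use le lr bounds[OF b] in auto)
  moreover have "?l(a := min (?l a) (l b)) = l(a := l b)" "r(a := max (r a) (l b)) = r"
    using le lr by auto
  ultimately show "reaches (l(a := l b)) r (extend (a, l b) (extend (a, r b) S)) (m + 2)"
    by simp
qed

lemma reaches_flip:
  assumes flip: "edge_flip X (tree_of n x l r) f E'"
    and S: "reaches l r S m" and x: "\<And>y. y \<in> {1..n} \<Longrightarrow> l y < x y \<and> x y < r y"
    and inj: "inj_on x {1..n}"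
  obtains l' r' where "reaches l' r' (extend_flip f S) (m + 2)"
    "\<And>y. y \<in> {1..n} \<Longrightarrow> l' y < x y \<and> x y < r' y" "E' = tree_of n x l' r'"
proof -
  from flip obtain q where q: "(q, fst f) \<in> tree_of n x l r" "(q, snd f) \<in> tree_of n x l r"
    "snd (fst f) < snd (snd f)"
    "\<nexists>c. (q, c) \<in> tree_of n x l r \<and> min (fst (fst f)) (fst (snd f)) < fst c \<and>
       fst c < max (fst (fst f)) (fst (snd f))"
    "E' = insert (fst f, snd f) (tree_of n x l r) - {(q, snd f)}"
    unfolding edge_flip_def by (auto split: prod.splits)
  from q(1) obtain p a where pa: "q = (x p, p)" "fst f = (x a, a)" "parent {1..n} l r p a"
    by (auto simp: tree_of_def)
  from q(2) obtain b where pb: "snd f = (x b, b)" "parent {1..n} l r p b"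
    by (auto simp: tree_of_def pa)
  have ab: "a < b" "p < a" "a \<in> {1..n}" "b \<in> {1..n}"
    using q(3) pa pb by (auto simp: parent_def)
  have adj: "\<not> (min (x a) (x b) < x c \<and> x c < max (x a) (x b))" if "parent {1..n} l r p c" for c
    using q(4) that by (auto simp: tree_of_def pa pb)
  have E': "E' = tree_of n x l' r'"
    if "\<And>u v. parent {1..n} l' r' u v \<longleftrightarrow>
      parent {1..n} l r u v \<and> (u, v) \<noteq> (p, b) \<or> (u, v) = (a, b)" for l' r'
    unfolding q(5) tree_of_def that pa pb using ab by auto
  have rows: "low b (fst S) = l b" "high b (fst S) = r b"
    using reaches_low_high[OF S ab(4)] by auto
  consider "x a < x b" | "x b < x a"
    using inj ab by (metis inj_on_eq_iff linorder_neqE_nat nat_neq_iff)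
  then show ?thesis
  proof cases
    case 1
    then have adj': "\<not> (x a < x c \<and> x c < x b)" if "parent {1..n} l r p c" for c
      using adj[OF that] by simp
    note R = flip_right[OF S x pa(3) pb(2) ab(1) 1 adj']
    have "extend_flip f S = extend (a, r b) (extend (a, l b) S)"
      using 1 by (simp add: extend_flip_def pa pb rows)
    moreover have "l y < x y \<and> x y < (r(a := r b)) y" if "y \<in> {1..n}" for y
      using x[OF that] x[OF ab(4)] 1 by auto
    ultimately show ?thesis
      using that[of l "r(a := r b)"] R(1) E'[OF R(2)] by presburger
  next
    case 2
    then have adj': "\<not> (x b < x c \<and> x c < x a)" if "parent {1..n} l r p c" for c
      using adj[OF that] by simp
    note R = flip_left[OF S x pa(3) pb(2) ab(1) 2 adj']
    have "extend_flip f S = extend (a, l b) (extend (a, r b) S)"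
      using 2 by (simp add: extend_flip_def pa pb rows)
    moreover have "(l(a := l b)) y < x y \<and> x y < r y" if "y \<in> {1..n}" for y
      using x[OF that] x[OF ab(4)] 2 by auto
    ultimately show ?thesis
      using that[of "l(a := l b)" r] R(1) E'[OF R(2)] by presburger
  qed
qed

lemma reaches_flips:
  assumes "exec (edge_flip X) E fs E'" and "E = tree_of n x l r"
    and "reaches l r S m" and "\<And>y. y \<in> {1..n} \<Longrightarrow> l y < x y \<and> x y < r y"
    and inj: "inj_on x {1..n}"
  shows "\<exists>l' r'. reaches l' r' (fold extend_flip fs S) (m + 2 * length fs) \<and>
    (\<forall>y\<in>{1..n}. l' y < x y \<and> x y < r' y) \<and> E' = tree_of n x l' r'"
  using assms(1-4)
proof (induction arbitrary: l r S m rule: exec.induct)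
  case (exec_Nil E)
  then show ?case by (intro exI[of _ l] exI[of _ r]) auto
next
  case (exec_Cons E f E1 fs E')
  from exec_Cons.hyps(1) exec_Cons.prems(1) have "edge_flip X (tree_of n x l r) f E1" by simp
  from reaches_flip[OF this exec_Cons.prems(2,3) inj] obtain l' r' where
    *: "reaches l' r' (extend_flip f S) (m + 2)"
    "\<And>y. y \<in> {1..n} \<Longrightarrow> l' y < x y \<and> x y < r' y" "E1 = tree_of n x l' r'" by blast
  show ?case
    using exec_Cons.IH[OF *(3,1,2)] by (simp add: add.assoc)
qed

end

section \<open>The treap\<close>

text \<open>The treap recursion confines a subtree to the columns between two borders;
  \<open>lo\<close> is the left one and takes the place of a missing lower point on that
  side.\<close>

definition low_bound :: "nat \<Rightarrow> point set \<Rightarrow> point \<Rightarrow> nat" where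
  "low_bound lo Q p = Max (insert lo (fst ` {q \<in> Q. snd q < snd p \<and> fst q < fst p}))"

definition high_bound :: "nat \<Rightarrow> point set \<Rightarrow> point \<Rightarrow> nat" where
  "high_bound hi Q p = Min (insert hi (fst ` {q \<in> Q. snd q < snd p \<and> fst p < fst q}))"

lemma low_bound_ge:
  assumes "finite Q"
  shows "lo \<le> low_bound lo Q p"
    and "q \<in> Q \<Longrightarrow> snd q < snd p \<Longrightarrow> fst q < fst p \<Longrightarrow> fst q \<le> low_bound lo Q p"
  unfolding low_bound_def using assms by (auto intro!: Max_ge)

lemma high_bound_le:
  assumes "finite Q"
  shows "high_bound hi Q p \<le> hi"
    and "q \<in> Q \<Longrightarrow> snd q < snd p \<Longrightarrow> fst p < fst q \<Longrightarrow> high_bound hi Q p \<le> fst q"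
  unfolding high_bound_def using assms by (auto intro!: Min_le)

lemma low_bound_cases:
  assumes "finite Q"
  shows "low_bound lo Q p = lo \<or>
    (\<exists>q\<in>Q. snd q < snd p \<and> fst q < fst p \<and> low_bound lo Q p = fst q)"
proof -
  have "low_bound lo Q p \<in> insert lo (fst ` {q \<in> Q. snd q < snd p \<and> fst q < fst p})"
    unfolding low_bound_def by (rule Max_in) (use assms in auto)
  then show ?thesis by auto
qed

lemma high_bound_cases:
  assumes "finite Q"
  shows "high_bound hi Q p = hi \<or>
    (\<exists>q\<in>Q. snd q < snd p \<and> fst p < fst q \<and> high_bound hi Q p = fst q)"
proof -
  have "high_bound hi Q p \<in> insert hi (fst ` {q \<in> Q. snd q < snd p \<and> fst p < fst q})"
    unfolding high_bound_def by (rule Min_in) (use assms in auto)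
  then show ?thesis by auto
qed

text \<open>Since \<open>p'\<close> is itself a lower point to the left of \<open>p\<close>, points
  further left cannot determine the bound, and the column of \<open>p'\<close> can serve as the new
  border.\<close>

lemma low_bound_restrict:
  assumes "finite Q" "p' \<in> Q" "snd p' < snd p" "fst p' < fst p" "lo \<le> fst p'"
  shows "low_bound (fst p') {q \<in> Q. fst p' < fst q} p = low_bound lo Q p"
proof (rule antisym)
  let ?Q = "{q \<in> Q. fst p' < fst q}"
  have fin: "finite ?Q" using assms by simp
  show "low_bound (fst p') ?Q p \<le> low_bound lo Q p"
    using low_bound_cases[OF fin, of "fst p'" p] low_bound_ge(2)[OF assms(1), of _ p lo] low_bound_ge(2)[OF assms(1-4)]
    by auto
  show "low_bound lo Q p \<le> low_bound (fst p') ?Q p"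
    using low_bound_cases[OF assms(1), of lo p] low_bound_ge(1)[OF fin, of "fst p'" p]
      low_bound_ge(2)[OF fin, of _ p "fst p'"] assms(5)
    by (smt (verit, best) le_trans linorder_not_less mem_Collect_eq)
qed

lemma high_bound_restrict:
  assumes "finite Q" "p' \<in> Q" "snd p' < snd p" "fst p < fst p'" "fst p' \<le> hi"
  shows "high_bound (fst p') {q \<in> Q. fst q < fst p'} p = high_bound hi Q p"
proof (rule antisym)
  let ?Q = "{q \<in> Q. fst q < fst p'}"
  have fin: "finite ?Q" using assms by simp
  show "high_bound hi Q p \<le> high_bound (fst p') ?Q p"
    using high_bound_cases[OF fin, of "fst p'" p] high_bound_le(2)[OF assms(1), of _ p hi] high_bound_le(2)[OF assms(1-4)]
    by auto
  show "high_bound (fst p') ?Q p \<le> high_bound hi Q p"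
    using high_bound_cases[OF assms(1), of hi p] high_bound_le(1)[OF fin, of "fst p'" p]
      high_bound_le(2)[OF fin, of _ p "fst p'"] assms(5)
    by (smt (verit, best) le_trans linorder_not_less mem_Collect_eq)
qed

lemma low_bound_left:
  "fst p < fst p' \<Longrightarrow> low_bound lo {q \<in> Q. fst q < fst p'} p = low_bound lo Q p"
  unfolding low_bound_def by (intro arg_cong[where f = Max] arg_cong2[where f = insert] refl) force

lemma high_bound_right:
  "fst p' < fst p \<Longrightarrow> high_bound hi {q \<in> Q. fst p' < fst q} p = high_bound hi Q p"
  unfolding high_bound_def by (intro arg_cong[where f = Min] arg_cong2[where f = insert] refl) force

text \<open>This is \<open>parent\<close> for the intervals between nearest lower points, relative
  to a point set and its borders, as the induction over subtrees requires.\<close>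

definition point_parent :: "nat \<Rightarrow> nat \<Rightarrow> point set \<Rightarrow> point \<Rightarrow> point \<Rightarrow> bool" where
  "point_parent lo hi Q p q \<longleftrightarrow> p \<in> Q \<and> q \<in> Q \<and> snd p < snd q \<and>
     low_bound lo Q p \<le> low_bound lo Q q \<and> high_bound hi Q q \<le> high_bound hi Q p \<and>
     (\<forall>w\<in>Q. snd p < snd w \<and> snd w < snd q \<longrightarrow>
        \<not> (low_bound lo Q w \<le> low_bound lo Q q \<and> high_bound hi Q q \<le> high_bound hi Q w))"

lemma treap_root: "p \<in> root_set (treap ps) \<Longrightarrow> \<exists>qs. ps = p # qs"
  by (cases ps) auto

text \<open>Passing to a subtree leaves the intervals of its points unchanged, because the column of
  the root becomes a border. That column also separates the sides, so no row of one side contains a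
  row of the other. Filtering keeps the order by height, so the root of each subtree is its lowest
  point.\<close>

lemma treap_parent:
  assumes "sorted_wrt (\<lambda>p q. snd p < snd q) ps" "distinct (map fst ps)"
    and "\<And>p. p \<in> set ps \<Longrightarrow> lo < fst p \<and> fst p < hi"
    and "(p, q) \<in> tree_edges (treap ps)"
  shows "point_parent lo hi (set ps) p q"
  using assms
proof (induction ps arbitrary: lo hi rule: treap.induct)
  case (2 a ps)
  let ?Q = "set (a # ps)"
  let ?L = "filter (\<lambda>q. fst q < fst a) ps" and ?R = "filter (\<lambda>q. fst q > fst a) ps"
  have fin: "finite ?Q" by simp
  have L: "set ?L = {q \<in> ?Q. fst q < fst a}" and R: "set ?R = {q \<in> ?Q. fst a < fst q}" by auto
  have lower: "snd a < snd w" if "w \<in> set ps" for w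
    using "2.prems" that by auto
  have lo: "lo < fst a" and hi: "fst a < hi" using "2.prems"(3) by auto
  have neq: "fst w \<noteq> fst a" if "w \<in> set ps" for w
  proof -
    have "fst a \<notin> fst ` set ps" using "2.prems"(2) by simp
    then show ?thesis using that by (metis image_eqI)
  qed
  have other: "w = a \<or> w \<in> set ?L \<or> w \<in> set ?R" if "w \<in> ?Q" for w
    using neq[of w] that by (auto simp: neq_iff)
  have low_a: "low_bound lo ?Q a = lo" and high_a: "high_bound hi ?Q a = hi"
  proof -
    have "\<not> snd w < snd a" if "w \<in> ?Q" for w using lower[of w] that by auto
    then show "low_bound lo ?Q a = lo" "high_bound hi ?Q a = hi"
      using low_bound_cases[OF fin, of lo a] high_bound_cases[OF fin, of hi a] by blast+
  qed
  have low_L: "low_bound lo ?Q w = low_bound lo (set ?L) w" if "w \<in> set ?L" for w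
    unfolding L using that by (intro low_bound_left[symmetric]) simp
  have high_L: "high_bound hi ?Q w = high_bound (fst a) (set ?L) w" if "w \<in> set ?L" for w
    unfolding L using that lower hi by (intro high_bound_restrict[symmetric]) auto
  have low_R: "low_bound lo ?Q w = low_bound (fst a) (set ?R) w" if "w \<in> set ?R" for w
    unfolding R using that lower lo by (intro low_bound_restrict[symmetric]) auto
  have high_R: "high_bound hi ?Q w = high_bound hi (set ?R) w" if "w \<in> set ?R" for w
    unfolding R using that by (intro high_bound_right[symmetric]) simp
  have below: "high_bound hi ?Q w \<le> fst a" "low_bound lo ?Q w < fst a" if "w \<in> set ?L" for w
    using that lower high_bound_le(2)[OF fin, of a w hi] low_bound_cases[OF fin, of lo w] lo by auto
  have above: "fst a \<le> low_bound lo ?Q w" "fst a < high_bound hi ?Q w" if "w \<in> set ?R" for w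
    using that lower low_bound_ge(2)[OF fin, of a w lo] high_bound_cases[OF fin, of hi w] hi by auto
  have sub: "sorted_wrt (\<lambda>p q. snd p < snd q) ?L" "distinct (map fst ?L)"
      "sorted_wrt (\<lambda>p q. snd p < snd q) ?R" "distinct (map fst ?R)"
    using "2.prems"(1,2) by (auto simp: sorted_wrt_filter distinct_map_filter)
  from "2.prems"(4) consider
      "p = a" "q \<in> root_set (treap ?L)" | "p = a" "q \<in> root_set (treap ?R)"
    | "(p, q) \<in> tree_edges (treap ?L)" | "(p, q) \<in> tree_edges (treap ?R)" by auto
  then show ?case
  proof cases
    case 1
    then obtain qs where qs: "?L = q # qs" using treap_root by blast
    then have q: "q \<in> set ?L" by simp
    have first: "snd q < snd w" if "w \<in> set ?L" "w \<noteq> q" for w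
      using sub(1) that unfolding qs by auto
    show ?thesis
      unfolding point_parent_def
    proof (intro conjI ballI impI)
      fix w assume w: "w \<in> ?Q" "snd p < snd w \<and> snd w < snd q"
      then have "w \<in> set ?R" using other[OF w(1)] first 1 by force
      then show "\<not> (low_bound lo ?Q w \<le> low_bound lo ?Q q \<and> high_bound hi ?Q q \<le> high_bound hi ?Q w)"
        using above(1)[of w] below(2)[OF q] by simp
    qed (use 1 q lower low_a high_a low_bound_ge(1)[OF fin] high_bound_le(1)[OF fin] in auto)
  next
    case 2
    then obtain qs where qs: "?R = q # qs" using treap_root by blast
    then have q: "q \<in> set ?R" by simp
    have first: "snd q < snd w" if "w \<in> set ?R" "w \<noteq> q" for w
      using sub(3) that unfolding qs by auto
    show ?thesis
      unfolding point_parent_def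
    proof (intro conjI ballI impI)
      fix w assume w: "w \<in> ?Q" "snd p < snd w \<and> snd w < snd q"
      then have "w \<in> set ?L" using other[OF w(1)] first 2 by force
      then show "\<not> (low_bound lo ?Q w \<le> low_bound lo ?Q q \<and> high_bound hi ?Q q \<le> high_bound hi ?Q w)"
        using below(1)[of w] above(2)[OF q] by simp
    qed (use 2 q lower low_a high_a low_bound_ge(1)[OF fin] high_bound_le(1)[OF fin] in auto)
  next
    case 3
    have pq: "point_parent lo (fst a) (set ?L) p q"
      by (rule "2.IH"(1)[OF sub(1,2) _ 3]) (use "2.prems"(3) in auto)
    then have p: "p \<in> set ?L" and q: "q \<in> set ?L" by (simp_all add: point_parent_def)
    have pq': "p \<in> ?Q" "q \<in> ?Q" "snd p < snd q" "low_bound lo ?Q p \<le> low_bound lo ?Q q"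
        "high_bound hi ?Q q \<le> high_bound hi ?Q p"
      using pq p q unfolding point_parent_def low_L[OF p] low_L[OF q] high_L[OF p] high_L[OF q]
      by simp_all
    show ?thesis
      unfolding point_parent_def
    proof (intro conjI ballI impI)
      fix w assume w: "w \<in> ?Q" "snd p < snd w \<and> snd w < snd q"
      have "snd a < snd p" using lower[of p] p by simp
      then have "w \<noteq> a" using w(2) by auto
      then consider "w \<in> set ?L" | "w \<in> set ?R" using other[OF w(1)] by blast
      then show "\<not> (low_bound lo ?Q w \<le> low_bound lo ?Q q \<and> high_bound hi ?Q q \<le> high_bound hi ?Q w)"
      proof cases
        case 1
        then show ?thesis
          using pq w q unfolding point_parent_def low_L[OF 1] high_L[OF 1] low_L[OF q] high_L[OF q] by blast
      next
        case 2
        then show ?thesis using above(1)[of w] below(2)[OF q] by simp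
      qed
    qed (rule pq')+
  next
    case 4
    have pq: "point_parent (fst a) hi (set ?R) p q"
      by (rule "2.IH"(2)[OF sub(3,4) _ 4]) (use "2.prems"(3) in auto)
    then have p: "p \<in> set ?R" and q: "q \<in> set ?R" by (simp_all add: point_parent_def)
    have pq': "p \<in> ?Q" "q \<in> ?Q" "snd p < snd q" "low_bound lo ?Q p \<le> low_bound lo ?Q q"
        "high_bound hi ?Q q \<le> high_bound hi ?Q p"
      using pq p q unfolding point_parent_def low_R[OF p] low_R[OF q] high_R[OF p] high_R[OF q]
      by simp_all
    show ?thesis
      unfolding point_parent_def
    proof (intro conjI ballI impI)
      fix w assume w: "w \<in> ?Q" "snd p < snd w \<and> snd w < snd q"
      have "snd a < snd p" using lower[of p] p by simp
      then have "w \<noteq> a" using w(2) by auto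
      then consider "w \<in> set ?L" | "w \<in> set ?R" using other[OF w(1)] by blast
      then show "\<not> (low_bound lo ?Q w \<le> low_bound lo ?Q q \<and> high_bound hi ?Q q \<le> high_bound hi ?Q w)"
      proof cases
        case 1
        then show ?thesis using below(1)[of w] above(2)[OF q] by simp
      next
        case 2
        then show ?thesis
          using pq w q unfolding point_parent_def low_R[OF 2] high_R[OF 2] low_R[OF q] high_R[OF q] by blast
      qed
    qed (rule pq')+
  qed
qed simp

text \<open>Combined with uniqueness of \<open>parent\<close>, this yields the converse inclusion of
  edges without a second induction over intervals.\<close>

lemma treap_has_parent:
  assumes "distinct (map fst ps)" "q \<in> set ps" "q \<noteq> hd ps"
  shows "\<exists>p. (p, q) \<in> tree_edges (treap ps)"
  using assms
proof (induction ps rule: treap.induct)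
  case (2 a ps)
  let ?L = "filter (\<lambda>q. fst q < fst a) ps" and ?R = "filter (\<lambda>q. fst q > fst a) ps"
  have root: "hd qs \<in> root_set (treap qs)" if "qs \<noteq> []" for qs
    using that by (cases qs) auto
  have "q \<in> set ps" using "2.prems" by simp
  moreover have "fst a \<notin> fst ` set ps" using "2.prems"(1) by simp
  ultimately have "fst q \<noteq> fst a" by (metis image_eqI)
  then have "q \<in> set ?L \<or> q \<in> set ?R"
    using \<open>q \<in> set ps\<close> by (auto simp: neq_iff)
  then show ?case
  proof
    assume q: "q \<in> set ?L"
    then have "?L \<noteq> []" by (cases ?L) simp_all
    have "(a, q) \<in> tree_edges (treap (a # ps))" if "q = hd ?L"
      using root[OF \<open>?L \<noteq> []\<close>] that by simp
    moreover have "\<exists>p. (p, q) \<in> tree_edges (treap (a # ps))" if "q \<noteq> hd ?L"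
      using "2.IH"(1)[OF _ q that] "2.prems"(1) by (auto simp: distinct_map_filter)
    ultimately show ?case by blast
  next
    assume q: "q \<in> set ?R"
    then have "?R \<noteq> []" by (cases ?R) simp_all
    have "(a, q) \<in> tree_edges (treap (a # ps))" if "q = hd ?R"
      using root[OF \<open>?R \<noteq> []\<close>] that by simp
    moreover have "\<exists>p. (p, q) \<in> tree_edges (treap (a # ps))" if "q \<noteq> hd ?R"
      using "2.IH"(2)[OF _ q that] "2.prems"(1) by (auto simp: distinct_map_filter)
    ultimately show ?case by blast
  qed
qed simp

section \<open>Correctness of the transformation\<close>

definition left_of :: "point list \<Rightarrow> point \<Rightarrow> nat" where
  "left_of ps p = fold max (map fst (filter (\<lambda>q. snd q < snd p \<and> fst q < fst p) ps)) 0"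

definition right_of :: "nat \<Rightarrow> point list \<Rightarrow> point \<Rightarrow> nat" where
  "right_of m ps p = fold min (map fst (filter (\<lambda>q. snd q < snd p \<and> fst p < fst q) ps)) m"

text \<open>One pass numbers the entries. Accumulation puts the highest point first, which is the
  order of drawing, and the counter ends at \<open>n + 1\<close>.\<close>

definition scan :: "nat list \<Rightarrow> nat \<times> point list" where
  "scan xs = fold (\<lambda>a s. (Suc (fst s), (a, fst s) # snd s)) xs (1, [])"

definition initial :: "nat \<Rightarrow> point list \<Rightarrow> progress" where
  "initial m ps =
     (map (\<lambda>p. (snd p, fst p, fst p)) ps,
      concat (map (\<lambda>p. [((fst p, 0), p), (p, (fst p, m))]) ps), [])"

definition draw_list :: "nat \<Rightarrow> point list \<Rightarrow> (nat \<times> nat) list" where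
  "draw_list m ps = concat (map (\<lambda>p. [(snd p, left_of ps p), (snd p, right_of m ps p)]) ps)"

definition finish_list :: "nat \<Rightarrow> point list \<Rightarrow> (nat \<times> nat) list" where
  "finish_list m ps = concat (map (\<lambda>p. [(snd p, 0), (snd p, m)]) (rev ps))"

definition transform :: "nat list \<times> (point \<times> point) list \<Rightarrow> rect_move list" where
  "transform i = (let m = fst (scan (fst i)); ps = snd (scan (fst i)) in
     rev (snd (snd (fold extend (finish_list m ps)
       (fold extend_flip (snd i) (fold extend (draw_list m ps) (initial m ps)))))))"

lemma left_of: "left_of ps p = low_bound 0 (set ps) p"
  unfolding left_of_def low_bound_def
  by (simp add: Max.set_eq_fold[symmetric] del: Max_insert)

lemma right_of: "right_of m ps p = high_bound m (set ps) p"
  unfolding right_of_def high_bound_def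
  by (simp add: Min.set_eq_fold[symmetric] del: Min_insert)

lemma points_map: "points xs = map (\<lambda>y. (xs ! (y - 1), y)) [1..<length xs + 1]"
  by (rule nth_equalityI) (auto simp: points_def simp del: upt_Suc)

lemma scan: "scan xs = (length xs + 1, rev (points xs))"
proof -
  have "fold (\<lambda>a s. (Suc (fst s), (a, fst s) # snd s)) xs (i, ps) =
      (length xs + i, rev (zip xs [i..<i + length xs]) @ ps)" for i ps
  proof (induction xs arbitrary: i ps)
    case (Cons a xs)
    have "[i..<i + length (a # xs)] = i # [Suc i..<Suc i + length xs]"
      by (simp add: upt_conv_Cons del: upt_Suc)
    then show ?case using Cons[of "Suc i"] by (simp del: upt_Suc)
  qed simp
  from this[of 1 "[]"] show ?thesis
    by (simp add: scan_def points_def del: upt_Suc)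
qed

section \<open>A fixed permutation: its treap, its initial state and its end state\<close>

locale permutation =
  fixes xs :: "nat list"
  assumes perm: "is_perm xs"
begin

definition n :: nat where "n = length xs"
definition col :: "nat \<Rightarrow> nat" where "col y = xs ! (y - 1)"
definition pts :: "point set" where "pts = set (points xs)"
definition l0 :: "nat \<Rightarrow> nat" where "l0 y = low_bound 0 pts (col y, y)"
definition r0 :: "nat \<Rightarrow> nat" where "r0 y = high_bound (n + 1) pts (col y, y)"

lemma n_pos: "0 < n"
  using perm by (simp add: is_perm_def n_def)

lemma points_eq: "points xs = map (\<lambda>y. (col y, y)) [1..<n+1]"
  unfolding col_def n_def by (rule points_map)

lemma pts: "pts = (\<lambda>y. (col y, y)) ` {1..n}"
  unfolding pts_def points_eq by auto

lemma finite_pts: "finite pts" by (simp add: pts_def)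

lemma bij: "bij_betw col {1..n} {1..n}"
proof -
  have "xs = map col [1..<n+1]"
    unfolding n_def col_def by (rule nth_equalityI) (auto simp del: upt_Suc)
  then have "set (map col [1..<n+1]) = {1..n}" "distinct (map col [1..<n+1])"
    using perm unfolding is_perm_def n_def by metis+
  then have "inj_on col (set [1..<n+1])" "col ` set [1..<n+1] = {1..n}"
    unfolding distinct_map by simp_all
  moreover have "set [1..<n+1] = {1..n}" by auto
  ultimately show ?thesis by (simp add: bij_betw_def)
qed

sublocale nearest_lower n col l0 r0
proof
  fix y assume y: "y \<in> {1..n}"
  then have col: "col y \<in> {1..n}" using bij by (auto simp: bij_betw_def)
  show "l0 y < col y"
    using low_bound_cases[OF finite_pts, of 0 "(col y, y)"] col by (auto simp: l0_def)
  show "col y < r0 y"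
    using high_bound_cases[OF finite_pts, of "n + 1" "(col y, y)"] col by (auto simp: r0_def)
  show "l0 y = 0 \<or> (\<exists>u\<in>{1..n}. u < y \<and> l0 y = col u)"
    using low_bound_cases[OF finite_pts, of 0 "(col y, y)"] unfolding l0_def pts by auto
  show "r0 y = n + 1 \<or> (\<exists>u\<in>{1..n}. u < y \<and> r0 y = col u)"
    using high_bound_cases[OF finite_pts, of "n + 1" "(col y, y)"] unfolding r0_def pts by auto
  fix u assume u: "u \<in> {1..n}" "u < y"
  then have "(col u, u) \<in> pts" by (simp add: pts)
  then show "col u \<le> l0 y" if "col u < col y"
    using low_bound_ge(2)[OF finite_pts, of "(col u, u)" "(col y, y)" 0] that u by (simp add: l0_def)
  show "r0 y \<le> col u" if "col y < col u"
    using high_bound_le(2)[OF finite_pts, of "(col u, u)" "(col y, y)" "n + 1"] that u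
      \<open>(col u, u) \<in> pts\<close> by (simp add: r0_def)
qed (rule bij)

lemma treap_eq: "tree_edges (treap (points xs)) = tree_of n col l0 r0"
proof -
  have sorted: "sorted_wrt (\<lambda>p q. snd p < snd q) (points xs)"
    unfolding points_eq by (simp add: sorted_wrt_map del: upt_Suc)
  have "map fst (points xs) = xs" by (simp add: points_def del: upt_Suc)
  then have dist: "distinct (map fst (points xs))"
    using perm by (simp add: is_perm_def)
  have bounds: "0 < fst p \<and> fst p < n + 1" if "p \<in> set (points xs)" for p
    using that x_in pts by (fastforce simp: pts_def[symmetric])
  have to_parent: "\<exists>u v. p = (col u, u) \<and> q = (col v, v) \<and> parent {1..n} l0 r0 u v"
    if "(p, q) \<in> tree_edges (treap (points xs))" for p q
  proof -
    have pq: "point_parent 0 (n + 1) pts p q"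
      unfolding pts_def by (rule treap_parent[OF sorted dist bounds that])
    then obtain u v where uv: "u \<in> {1..n}" "v \<in> {1..n}" "p = (col u, u)" "q = (col v, v)"
      unfolding point_parent_def pts by auto
    have "parent {1..n} l0 r0 u v"
      using pq uv unfolding point_parent_def parent_def nested_def l0_def r0_def
      by (auto simp: pts)
    then show ?thesis using uv by blast
  qed
  show ?thesis
  proof (intro equalityI subrelI)
    fix p q assume "(p, q) \<in> tree_of n col l0 r0"
    then obtain u v where uv: "p = (col u, u)" "q = (col v, v)" "parent {1..n} l0 r0 u v"
      by (auto simp: tree_of_def)
    then have "q \<in> set (points xs)" "1 < v"
      using pts unfolding pts_def parent_def by auto
    moreover have "hd (points xs) = (col 1, 1)"
      using n_pos by (simp add: points_eq upt_conv_Cons del: upt_Suc)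
    ultimately obtain p' where p': "(p', q) \<in> tree_edges (treap (points xs))"
      using treap_has_parent[OF dist, of q] uv by auto
    from to_parent[OF this] uv obtain u' where "p' = (col u', u')" "parent {1..n} l0 r0 u' v"
      by auto
    then show "(p, q) \<in> tree_edges (treap (points xs))"
      using p' uv parent_unique by metis
  qed (use to_parent in \<open>force simp: tree_of_def\<close>)
qed

sublocale progress n col "pts \<union> margin n" "snd (init_state xs)" .

lemma init_state: "init_state xs = (pts \<union> margin n, snd (init_state xs))"
  by (simp add: init_state_def Let_def pts_def n_def)

lemma init_config: "config n col (pts \<union> margin n) col col"
proof
  have no_cross: "\<not> crosses {1..n} col col w c" for w c by (simp add: crosses_def)
  show "c < t" if "crosses {1..n} col col w c" for w c t using that no_cross by blast
  show "(w, c) \<in> pts \<union> margin n" if "crosses {1..n} col col w c" for w c using that no_cross by blast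
  show "pts \<union> margin n \<subseteq> grid n - corners n"
    using x_in by (force simp: pts margin_def grid_def corners_def)
  show "crosses {1..n} col col w y \<or> touches {1..n} col col w y"
    if "(w, y) \<in> pts \<union> margin n" "w \<in> {1..n}" "y \<in> {1..n}" for w y
    using that by (auto simp: touches_def pts margin_def)
  show "col y \<le> col y \<and> col y \<le> col y \<and> col y \<le> n + 1" if "y \<in> {1..n}" for y
    using x_in[OF that] by simp
  show "(col y, y) \<in> pts \<union> margin n \<and> (col y, y) \<in> pts \<union> margin n" if "y \<in> {1..n}" for y
    using that by (simp add: pts)
qed (use x_in in auto)

text \<open>Single-point rows cross nothing, so every inner column is a wall from bottom to top,
  interrupted only by its own point.\<close>

lemma init_cols:
  "col_segs n (pts \<union> margin n) (wall n col col) = 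
    (\<Union>y\<in>{1..n}. {((col y, 0), (col y, y)), ((col y, y), (col y, n + 1))})"
proof -
  have column: "{z. (col y, z) \<in> pts \<union> margin n} = {0, y, n + 1}" if "y \<in> {1..n}" for y
  proof -
    have "u = y" if "u \<in> {1..n}" "col u = col y" for u
      using x_eq[OF that(1) \<open>y \<in> {1..n}\<close>] that(2) by simp
    then have "(col y, z) \<in> pts \<longleftrightarrow> z = y" for z
      using that unfolding pts by (metis (no_types, lifting) Pair_inject imageE image_eqI)
    moreover have "(col y, z) \<in> margin n \<longleftrightarrow> z = 0 \<or> z = n + 1" for z
      using x_in[OF that] by (auto simp: margin_def)
    ultimately show ?thesis by auto
  qed
  have consec: "consec {0, y, n + 1} u v \<longleftrightarrow> u = 0 \<and> v = y \<or> u = y \<and> v = n + 1"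
    if "y \<in> {1..n}" for y u v
    using that by (auto simp: consec_def)
  have wall: "wall n col col (col y) u" if "y \<in> {1..n}" for y u
    using that by (auto simp: wall_def touches_def crosses_def)
  show ?thesis
  proof (intro equalityI subsetI)
    fix s assume "s \<in> col_segs n (pts \<union> margin n) (wall n col col)"
    then obtain w u v where s: "s = ((w, u), (w, v))" "w \<in> {1..n}"
        "consec {z. (w, z) \<in> pts \<union> margin n} u v"
      unfolding col_segs_def by blast
    from x_surj[OF s(2)] obtain y where y: "y \<in> {1..n}" "w = col y" by blast
    then show "s \<in> (\<Union>y\<in>{1..n}. {((col y, 0), (col y, y)), ((col y, y), (col y, n + 1))})"
      using s(1,3) unfolding y(2) column[OF y(1)] consec[OF y(1)] by blast
  next
    fix s assume "s \<in> (\<Union>y\<in>{1..n}. {((col y, 0), (col y, y)), ((col y, y), (col y, n + 1))})"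
    then obtain y u v where y: "y \<in> {1..n}" and s: "s = ((col y, u), (col y, v))"
        "u = 0 \<and> v = y \<or> u = y \<and> v = n + 1" by blast
    then have "consec {z. (col y, z) \<in> pts \<union> margin n} u v" "v \<le> n + 1"
      unfolding column[OF y] consec[OF y] by auto
    then show "s \<in> col_segs n (pts \<union> margin n) (wall n col col)"
      using s(1) x_in[OF y] wall[OF y] unfolding col_segs_def by blast
  qed
qed

lemma init_segs: "snd (init_state xs) = segs n (pts \<union> margin n) col col (wall n col col)"
proof -
  have "row_segs n (pts \<union> margin n) col col = {}"
    by (auto simp: row_segs_def consec_def)
  moreover have "snd (init_state xs) = (\<Union>(x, y)\<in>pts. {((x, 0), (x, y)), ((x, y), (x, n + 1))})"
    by (simp add: init_state_def Let_def pts_def n_def)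
  ultimately show ?thesis
    unfolding segs_def init_cols by (simp add: pts)
qed

lemma rev_points: "rev (points xs) = map (\<lambda>y. (col y, y)) (rev [1..<n+1])"
  unfolding points_eq by (rule rev_map)

lemma reaches_initial: "reaches col col (initial (n + 1) (rev (points xs))) 0"
  unfolding reaches_def
proof (intro exI[of _ "pts \<union> margin n"] conjI)
  show "fst (initial (n + 1) (rev (points xs))) = map (\<lambda>y. (y, col y, col y)) (rev [1..<n+1])"
    unfolding initial_def rev_points by (simp del: upt_Suc)
  show "set (fst (snd (initial (n + 1) (rev (points xs))))) =
      col_segs n (pts \<union> margin n) (wall n col col)"
    unfolding init_cols initial_def by (force simp: pts_def[symmetric] pts)
  show "exec (rect_step n) (pts \<union> margin n, snd (init_state xs))
      (rev (snd (snd (initial (n + 1) (rev (points xs))))))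
      (pts \<union> margin n, segs n (pts \<union> margin n) col col (wall n col col))"
    by (simp add: initial_def init_segs[symmetric] exec_Nil)
qed (simp_all add: init_config initial_def)

lemma draw_list:
  "draw_list (n + 1) (rev (points xs)) = concat (map (\<lambda>y. [(y, l0 y), (y, r0 y)]) (rev [1..<n+1]))"
  unfolding draw_list_def rev_points left_of right_of l0_def r0_def
  by (simp add: pts_def points_eq comp_def del: upt_Suc)

lemma finish_list:
  "finish_list (n + 1) (rev (points xs)) = concat (map (\<lambda>y. [(y, 0), (y, n + 1)]) [1..<n+1])"
  unfolding finish_list_def rev_points by (simp add: rev_map comp_def del: upt_Suc)

text \<open>On the path each row is the parent of the next one, and inclusion is transitive.\<close>

lemma path_parent:
  assumes "path_edges (points xs) = tree_of n col l r" "u \<in> {1..n}" "v \<in> {1..n}" "u \<le> v"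
  shows "nested l r v u"
  using \<open>u \<le> v\<close> \<open>v \<in> {1..n}\<close>
proof (induction v rule: dec_induct)
  case base
  then show ?case by (simp add: nested_def)
next
  case (step v)
  have v: "v \<in> {1..n}" "Suc v \<le> n" using step assms(2) by auto
  have "length (points xs) = n" by (simp add: points_eq)
  \<comment> \<open>Row \<open>v\<close> is at list position \<open>v - 1\<close>.\<close>
  then have "(points xs ! (v - 1), points xs ! v) \<in> path_edges (points xs)"
    using v by (force simp: path_edges_def set_zip nth_tl intro!: exI[of _ "v - 1"])
  moreover have "points xs ! (v - 1) = (col v, v)" "points xs ! v = (col (Suc v), Suc v)"
    using v nth_upt[of 1 "v - 1" "n + 1"] by (simp_all add: points_eq del: upt_Suc)
  ultimately have "parent {1..n} l r v (Suc v)"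
    using assms(1) by (auto simp: tree_of_def)
  then show ?case
    using step v by (auto simp: parent_def nested_def)
qed

text \<open>When all ends are in the margin columns, no inner column supports an end, so no wall is
  left. Each row is a chain of gaps from \<open>0\<close> to \<open>n + 1\<close> and covers every
  column.\<close>

lemma reaches_end:
  assumes "reaches l r S m" and lr: "\<And>y. y \<in> {1..n} \<Longrightarrow> l y = 0 \<and> r y = n + 1"
  shows "rect_solution xs (rev (snd (snd S)))" "length (snd (snd S)) \<le> m"
proof -
  from assms(1) obtain P where P: "config n col P l r" "pts \<union> margin n \<subseteq> P"
    and ex: "exec (rect_step n) (pts \<union> margin n, snd (init_state xs)) (rev (snd (snd S)))
      (P, segs n P l r (wall n l r))"
    and len: "length (snd (snd S)) \<le> m"
    unfolding reaches_def by blast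
  then interpret C: config n col P l r by simp
  have "\<not> wall n l r w y" if "w \<in> {1..n}" for w y
    using that lr by (auto simp: wall_def touches_def)
  then have no_cols: "col_segs n P (wall n l r) = {}"
    by (auto simp: col_segs_def)
  have "(u, y) \<in> (\<Union>s\<in>row_segs n P l r. seg_points s)" if "y \<in> {1..n}" and u: "u \<le> n + 1" for u y
  proof -
    let ?S = "{z. (z, y) \<in> P}"
    have ends: "0 \<in> ?S" "n + 1 \<in> ?S"
      using C.ends[OF that(1)] lr[OF that(1)] by auto
    have "\<exists>a b. consec ?S a b \<and> b \<le> n + 1 \<and> a \<le> u \<and> u \<le> b"
    proof (cases "u = n + 1")
      case True
      obtain a where "consec ?S a (n + 1)" by (rule consec_below[OF ends(2,1)]) simp
      moreover from this have "a \<le> n + 1" by (simp add: consec_def)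
      ultimately show ?thesis using True by blast
    next
      case False
      \<comment> \<open>Adjoining \<open>Suc u\<close> to the set makes its predecessor the last
        point of the row at or before \<open>u\<close>.\<close>
      obtain a where a: "consec (insert (Suc u) ?S) a (Suc u)"
        by (rule consec_below[of "Suc u" "insert (Suc u) ?S" 0]) (use ends in auto)
      then have a': "a \<in> ?S" "a \<le> u" by (auto simp: consec_def)
      obtain b where b: "consec ?S a b" "b \<le> n + 1"
        by (rule consec_above[OF a'(1) ends(2)]) (use a' u False in auto)
      moreover have "u \<le> b"
      proof (rule ccontr)
        assume "\<not> u \<le> b"
        then show False using a b by (auto simp: consec_def)
      qed
      ultimately show ?thesis using a' by blast
    qed
    then obtain a b where "consec ?S a b" "b \<le> n + 1" "a \<le> u" "u \<le> b" by blast
    then have "((a, y), (b, y)) \<in> row_segs n P l r" "(u, y) \<in> seg_points ((a, y), (b, y))"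
      using that(1) lr[OF that(1)] by (auto simp: row_segs_def seg_points_def)
    then show ?thesis by blast
  qed
  then have "{0..n + 1} \<times> {1..n} \<subseteq> (\<Union>s\<in>segs n P l r (wall n l r). seg_points s)"
    unfolding segs_def no_cols by auto
  moreover have "horizontal s" if "s \<in> segs n P l r (wall n l r)" for s
    using that unfolding segs_def no_cols row_segs_def by (auto simp: horizontal_def consec_def)
  moreover have "fst (init_state xs) \<subseteq> P"
    using P(2) init_state by (metis fst_conv)
  ultimately have "end_state xs (P, segs n P l r (wall n l r))"
    using C.valid unfolding end_state_def n_def by simp
  then show "rect_solution xs (rev (snd (snd S)))"
    unfolding rect_solution_def using ex init_state by (metis n_def)
  show "length (snd (snd S)) \<le> m" by (rule len)
qed

text \<open>At most two moves per row for drawing, two per edge-flip and two per row for finishing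
  give \<open>2 * n + 2 * length fs + 2 * n\<close>.\<close>

lemma transform:
  assumes "tree_solution xs fs"
  shows "rect_solution xs (transform (xs, fs))"
    and "length (transform (xs, fs)) \<le> 4 * n + 2 * length fs"
proof -
  have reach1: "reaches (\<lambda>y. if 0 < y then l0 y else col y) (\<lambda>y. if 0 < y then r0 y else col y)
      (fold extend (draw_list (n + 1) (rev (points xs))) (initial (n + 1) (rev (points xs)))) (2 * n)"
    unfolding draw_list
    using draw_rows[OF nearest_lower_axioms reaches_initial, of 0 "\<lambda>y. [(y, l0 y), (y, r0 y)]"]
    by (simp del: upt_Suc)
  have reach2: "reaches l0 r0
      (fold extend (draw_list (n + 1) (rev (points xs))) (initial (n + 1) (rev (points xs)))) (2 * n)"
    by (rule reaches_cong[OF reach1]) auto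
  from assms have "exec (edge_flip pts) (tree_edges (treap (points xs))) fs (path_edges (points xs))"
    by (simp add: tree_solution_def pts_def)
  from reaches_flips[OF this treap_eq reach2] bij obtain l r where
    reach3: "reaches l r (fold extend_flip fs (fold extend (draw_list (n + 1) (rev (points xs)))
      (initial (n + 1) (rev (points xs))))) (2 * n + 2 * length fs)"
    and x: "\<forall>y\<in>{1..n}. l y < col y \<and> col y < r y"
    and path: "path_edges (points xs) = tree_of n col l r"
    using l0(1) r0(1) by (auto simp: bij_betw_def)
  obtain P where "config n col P l r" using reaches_config[OF reach3] by blast
  then have r_le: "r y \<le> n + 1" if "y \<in> {1..n}" for y
    using config.bounds that by blast
  note reach4 = finish_rows[of l r _ _ n "\<lambda>y. [(y, 0), (y, n + 1)]",
      OF bspec[OF x] path_parent[OF path] r_le reach3 order_refl refl]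
  have eq: "transform (xs, fs) = rev (snd (snd (fold extend (finish_list (n + 1) (rev (points xs)))
      (fold extend_flip fs (fold extend (draw_list (n + 1) (rev (points xs)))
        (initial (n + 1) (rev (points xs))))))))"
    by (simp add: transform_def scan n_def Let_def)
  show "rect_solution xs (transform (xs, fs))"
    unfolding eq finish_list by (rule reaches_end(1)[OF reach4]) auto
  have "length (snd (snd (fold extend (finish_list (n + 1) (rev (points xs)))
      (fold extend_flip fs (fold extend (draw_list (n + 1) (rev (points xs)))
        (initial (n + 1) (rev (points xs)))))))) \<le> 2 * n + 2 * length fs + 2 * n"
    unfolding finish_list by (rule reaches_end(2)[OF reach4]) auto
  then show "length (transform (xs, fs)) \<le> 4 * n + 2 * length fs"
    unfolding eq by simp
qed

end

section \<open>Running time of the transformation\<close>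

lemma ptime_comp2:
  assumes "ptime (\<lambda>p. h (fst p) (snd p))" "ptime f" "ptime g"
  shows "ptime (\<lambda>x. h (f x) (g x))"
  using ptime_comp[OF ptime_Pair[OF assms(2,3)] assms(1)] by simp

lemmas ptime_basic =
  ptime_id ptime_fst ptime_snd ptime_Pair ptime_Cons ptime_Nil ptime_nat ptime_If ptime_less
  ptime_eq ptime_conj ptime_disj ptime_Not ptime_max ptime_min ptime_append ptime_rev
  ptime_concat_map ptime_map ptime_filter ptime_list_ex ptime_fold_max ptime_fold_min

lemma ptime_extend_rows:
  "ptime f \<Longrightarrow> ptime g \<Longrightarrow> ptime (\<lambda>x. extend_rows (f x) (g x))"
  by (rule ptime_comp2[of extend_rows]) (unfold extend_rows_def, intro ptime_basic)

lemma ptime_keeps: "ptime f \<Longrightarrow> ptime g \<Longrightarrow> ptime (\<lambda>x. keeps (f x) (g x))"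
  by (rule ptime_comp2[of keeps]) (unfold keeps_def, intro ptime_basic)

lemma ptime_split_list: "ptime f \<Longrightarrow> ptime g \<Longrightarrow> ptime (\<lambda>x. split_list (f x) (g x))"
  by (rule ptime_comp2[of split_list]) (unfold split_list_def, intro ptime_basic)

lemma ptime_moves:
  assumes "ptime f" "ptime g" "ptime h"
  shows "ptime (\<lambda>x. moves (f x) (g x) (h x))"
proof -
  have "ptime (\<lambda>p. moves (fst p) (fst (snd p)) (snd (snd p)))"
    unfolding moves_def by (intro ptime_basic)
  from ptime_comp[OF ptime_Pair[OF assms(1) ptime_Pair[OF assms(2,3)]] this] show ?thesis by simp
qed

lemma ptime_extend: "ptime f \<Longrightarrow> ptime g \<Longrightarrow> ptime (\<lambda>x. extend (f x) (g x))"
  by (rule ptime_comp2[of extend])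
    (unfold extend_def,
      intro ptime_extend_rows ptime_keeps ptime_split_list ptime_moves ptime_basic)

lemma ptime_low: "ptime f \<Longrightarrow> ptime g \<Longrightarrow> ptime (\<lambda>x. low (f x) (g x))"
  by (rule ptime_comp2[of low]) (unfold low_def, intro ptime_basic)

lemma ptime_high: "ptime f \<Longrightarrow> ptime g \<Longrightarrow> ptime (\<lambda>x. high (f x) (g x))"
  by (rule ptime_comp2[of high]) (unfold high_def, intro ptime_basic)

lemma ptime_extend_flip: "ptime f \<Longrightarrow> ptime g \<Longrightarrow> ptime (\<lambda>x. extend_flip (f x) (g x))"
  by (rule ptime_comp2[of extend_flip])
    (unfold extend_flip_def, intro ptime_extend ptime_low ptime_high ptime_basic)

lemma ptime_left_of: "ptime f \<Longrightarrow> ptime g \<Longrightarrow> ptime (\<lambda>x. left_of (f x) (g x))"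
  by (rule ptime_comp2[of left_of]) (unfold left_of_def, intro ptime_basic)

lemma ptime_right_of:
  assumes "ptime f" "ptime g" "ptime h"
  shows "ptime (\<lambda>x. right_of (f x) (g x) (h x))"
proof -
  have "ptime (\<lambda>p. right_of (fst p) (fst (snd p)) (snd (snd p)))"
    unfolding right_of_def by (intro ptime_basic)
  from ptime_comp[OF ptime_Pair[OF assms(1) ptime_Pair[OF assms(2,3)]] this] show ?thesis by simp
qed

lemma ptime_initial: "ptime f \<Longrightarrow> ptime g \<Longrightarrow> ptime (\<lambda>x. initial (f x) (g x))"
  by (rule ptime_comp2[of initial]) (unfold initial_def, intro ptime_basic)

lemma ptime_draw_list: "ptime f \<Longrightarrow> ptime g \<Longrightarrow> ptime (\<lambda>x. draw_list (f x) (g x))"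
  by (rule ptime_comp2[of draw_list])
    (unfold draw_list_def, intro ptime_left_of ptime_right_of ptime_basic)

lemma ptime_finish_list: "ptime f \<Longrightarrow> ptime g \<Longrightarrow> ptime (\<lambda>x. finish_list (f x) (g x))"
  by (rule ptime_comp2[of finish_list]) (unfold finish_list_def, intro ptime_basic)

text \<open>Each step stores one entry and one row number, both bounded by the input size, so the
  list grows by at most \<open>2 * size_enc x + 6\<close>.\<close>

lemma ptime_scan: "ptime scan"
proof -
  have "ptime (\<lambda>xs :: nat list. fold (\<lambda>a s. (Suc (fst s), (a, fst s) # snd s)) xs (1, []))"
  proof (rule ptime_fold[where g = "\<lambda>x. (size_enc x + 2) + (size_enc x * (2 * size_enc x + 6) + 1) + 1"
        and I = "\<lambda>x k s. fst s = k + 1 \<and> size_enc (snd s) \<le> k * (2 * size_enc x + 6) + 1"])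
    fix xs :: "nat list" and k and s :: "nat \<times> point list"
    assume s: "fst s = k + 1 \<and> size_enc (snd s) \<le> k * (2 * size_enc xs + 6) + 1" "k \<le> length xs"
    then have "k \<le> size_enc xs" using length_less_size_enc[of xs] by simp
    moreover from this have "k * (2 * size_enc xs + 6) \<le> size_enc xs * (2 * size_enc xs + 6)"
      by (rule mult_right_mono) simp
    ultimately have "size_enc (snd s) \<le> size_enc xs * (2 * size_enc xs + 6) + 1"
      "fst s \<le> size_enc xs + 1" using s(1) by linarith+
    then show "size_enc s \<le> (size_enc xs + 2) + (size_enc xs * (2 * size_enc xs + 6) + 1) + 1"
      by (cases s) simp
  next
    fix xs :: "nat list" and k a and s :: "nat \<times> point list"
    assume "fst s = k + 1 \<and> size_enc (snd s) \<le> k * (2 * size_enc xs + 6) + 1"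
      "k < length xs" "a \<in> set xs"
    then show "fst (Suc (fst s), (a, fst s) # snd s) = Suc k + 1 \<and>
        size_enc (snd (Suc (fst s), (a, fst s) # snd s)) \<le> Suc k * (2 * size_enc xs + 6) + 1"
      using length_less_size_enc[of xs] size_enc_mem[of a xs] by simp
  qed (intro ptime_Suc ptime_basic poly_bounded_intros | simp)+
  then show ?thesis by (simp add: scan_def[abs_def])
qed

text \<open>Bounds what one call of \<open>extend\<close> adds to the output: moves with four
  coordinates up to \<open>M\<close> and a removal list of size at most
  \<open>M * M * (4 * M + 8) + 1\<close>. The leading factor \<open>M\<close> allows one move per
  row, which spares an argument that row numbers are distinct.\<close>

definition move_bound :: "nat \<Rightarrow> nat" where
  "move_bound M = M * (4 * M + 8 + (M * M * (4 * M + 8) + 1) + 1)"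

abbreviation (input) seg_length :: "segment \<Rightarrow> nat" where
  "seg_length s \<equiv> snd (snd s) - snd (fst s)"

text \<open>Splitting a segment preserves the total length, which therefore bounds the number of segments.\<close>

definition bounded_by :: "nat \<Rightarrow> nat \<Rightarrow> progress \<Rightarrow> bool" where
  "bounded_by M k S \<longleftrightarrow>
     length (fst S) \<le> M \<and>
     (\<forall>q\<in>set (fst S). fst q \<le> M \<and> fst (snd q) \<le> M \<and> snd (snd q) \<le> M) \<and>
     (\<forall>s\<in>set (fst (snd S)). fst (fst s) \<le> M \<and> fst (snd s) \<le> M \<and>
        snd (fst s) < snd (snd s) \<and> snd (snd s) \<le> M) \<and>
     sum_list (map seg_length (fst (snd S))) \<le> M * M \<and>
     size_enc (snd (snd S)) \<le> k * move_bound M + 1"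

lemma bounded_by_mono:
  assumes "bounded_by M k S" "k \<le> k'"
  shows "bounded_by M k' S"
proof -
  have "k * move_bound M \<le> k' * move_bound M" using assms(2) by simp
  then show ?thesis using assms(1) unfolding bounded_by_def by linarith
qed

lemma length_le_sum_list:
  "(\<And>s. s \<in> set V \<Longrightarrow> 0 < f s) \<Longrightarrow> length V \<le> sum_list (map f V :: nat list)"
  by (induction V) (auto simp: Suc_le_eq add_strict_increasing)

text \<open>Segments of positive length are at most as many as their total length.\<close>

lemma size_segs:
  assumes "\<And>s. s \<in> set V \<Longrightarrow> fst (fst s) \<le> M \<and> fst (snd s) \<le> M \<and>
      snd (fst s) < snd (snd s) \<and> snd (snd s) \<le> M"
    and "sum_list (map seg_length V) \<le> M * M"
  shows "size_enc V \<le> M * M * (4 * M + 8) + 1"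
proof -
  have "size_enc s \<le> 4 * M + 7" if "s \<in> set V" for s
  proof -
    obtain a b c d where "s = ((a, b), (c, d))" by (metis prod.collapse)
    then show ?thesis using assms(1)[OF that] by auto
  qed
  then have "size_enc V \<le> length V * (4 * M + 7 + 1) + 1"
    by (rule size_enc_list_le)
  then have "size_enc V \<le> length V * (4 * M + 8) + 1"
    by (simp add: add.commute)
  moreover have "length V \<le> M * M"
    using length_le_sum_list[of V seg_length] assms by fastforce
  then have "length V * (4 * M + 8) \<le> M * M * (4 * M + 8)"
    by (rule mult_right_mono) simp
  ultimately show ?thesis by linarith
qed

lemma size_bounded_by:
  assumes "bounded_by M k S" "k \<le> K"
  shows "size_enc S \<le> (M * (3 * M + 6) + 1) + (M * M * (4 * M + 8) + 1) + (K * move_bound M + 1) + 2"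
proof -
  have "size_enc (fst S) \<le> length (fst S) * (3 * M + 5 + 1) + 1"
  proof (rule size_enc_list_le)
    fix q assume "q \<in> set (fst S)"
    then have "fst q \<le> M \<and> fst (snd q) \<le> M \<and> snd (snd q) \<le> M"
      using assms(1) unfolding bounded_by_def by blast
    then show "size_enc q \<le> 3 * M + 5" by (cases q) auto
  qed
  also have "\<dots> \<le> M * (3 * M + 5 + 1) + 1"
    using assms(1) unfolding bounded_by_def by (intro add_right_mono mult_right_mono) auto
  finally have "size_enc (fst S) \<le> M * (3 * M + 6) + 1"
    by (simp add: add.commute)
  moreover have "size_enc (fst (snd S)) \<le> M * M * (4 * M + 8) + 1"
    using assms(1) unfolding bounded_by_def by (intro size_segs) auto
  moreover have "size_enc (snd (snd S)) \<le> K * move_bound M + 1"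
    using bounded_by_mono[OF assms] unfolding bounded_by_def by blast
  ultimately show ?thesis by (cases S) simp
qed

lemma sum_list_split_list:
  "sum_list (map seg_length (split_list i V)) = sum_list (map seg_length V)"
  unfolding split_list_def by (induction V) auto

lemma bounded_by_extend:
  assumes S: "bounded_by M k S" and i: "snd i \<le> M"
  shows "bounded_by M (Suc k) (extend i S)"
proof -
  let ?rows = "extend_rows i (fst S)" and ?V = "split_list i (fst (snd S))"
  have rows: "length ?rows \<le> M"
      "q \<in> set ?rows \<Longrightarrow> fst q \<le> M \<and> fst (snd q) \<le> M \<and> snd (snd q) \<le> M" for q
    using S i unfolding bounded_by_def extend_rows_def by (auto simp: min_le_iff_disj)
  have V: "fst (fst s) \<le> M \<and> fst (snd s) \<le> M \<and> snd (fst s) < snd (snd s) \<and> snd (snd s) \<le> M"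
    if "s \<in> set ?V" for s
    using S i that unfolding bounded_by_def split_list_def by (fastforce split: if_splits)
  have sum: "sum_list (map seg_length (filter Q ?V)) \<le> M * M" for Q
    using sum_list_filter_le_nat[of seg_length Q ?V] S
    unfolding sum_list_split_list bounded_by_def by linarith
  let ?R = "filter (\<lambda>s. \<not> keeps ?rows s) ?V"
  have R: "size_enc ?R \<le> M * M * (4 * M + 8) + 1"
    by (rule size_segs) (use V sum in auto)
  have "size_enc (moves i (fst S) ?R) \<le>
      length (moves i (fst S) ?R) * (4 * M + 8 + (M * M * (4 * M + 8) + 1) + 1) + 1"
  proof (rule size_enc_list_le)
    fix m assume "m \<in> set (moves i (fst S) ?R)"
    then obtain q where q: "q \<in> set (fst S)"
      "m = ((if snd i < fst (snd q) then fst (snd q) else snd (snd q), fst q), (snd i, fst q), ?R)"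
      unfolding moves_def by (auto split: if_splits)
    then have "fst q \<le> M" "fst (snd q) \<le> M" "snd (snd q) \<le> M"
      using S unfolding bounded_by_def by auto
    then show "size_enc m \<le> 4 * M + 8 + (M * M * (4 * M + 8) + 1)"
      using R i unfolding q(2) by auto
  qed
  moreover have "length (moves i rows R) \<le> length rows" for rows R
    unfolding moves_def by (induction rows) auto
  then have "length (moves i (fst S) ?R) \<le> M"
    using S unfolding bounded_by_def by (meson order_trans)
  then have "length (moves i (fst S) ?R) * (4 * M + 8 + (M * M * (4 * M + 8) + 1) + 1) \<le> move_bound M"
    unfolding move_bound_def by (rule mult_right_mono) simp
  ultimately have "size_enc (moves i (fst S) ?R @ snd (snd S)) \<le> Suc k * move_bound M + 1"
    using size_enc_append[of "moves i (fst S) ?R" "snd (snd S)"] S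
    unfolding bounded_by_def by simp
  then show ?thesis
    using rows V sum unfolding bounded_by_def extend_def by simp
qed

lemma fold_max_le: "(\<And>a. a \<in> set as \<Longrightarrow> a \<le> M) \<Longrightarrow> m \<le> M \<Longrightarrow> fold max as m \<le> (M :: nat)"
  by (induction as arbitrary: m) auto

lemma fold_min_le: "fold min as m \<le> (m :: nat)"
proof (induction as arbitrary: m)
  case (Cons a as)
  from Cons[of "min a m"] show ?case by simp
qed simp

text \<open>\<open>low\<close> and \<open>high\<close> return an entry of the rows or
  \<open>0\<close>, so even a meaningless flip cannot enlarge the coordinates.\<close>

lemma bounded_by_extend_flip:
  assumes "bounded_by M k S"
  shows "bounded_by M (Suc (Suc k)) (extend_flip f S)"
proof -
  have "low y (fst S) \<le> M" "high y (fst S) \<le> M" for y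
    unfolding low_def high_def using assms
    by (intro fold_max_le; force simp: bounded_by_def)+
  then show ?thesis
    unfolding extend_flip_def using assms by (auto intro!: bounded_by_extend)
qed

lemma bounded_by_fold:
  assumes "bounded_by M k S" "\<And>i. i \<in> set is \<Longrightarrow> snd i \<le> M"
  shows "bounded_by M (k + length is) (fold extend is S)"
  using assms
proof (induction "is" arbitrary: k S)
  case (Cons i "is")
  then show ?case using Cons.IH[of "Suc k" "extend i S"] bounded_by_extend[of M k S i] by simp
qed simp

lemma bounded_by_fold_flips:
  "bounded_by M k S \<Longrightarrow> bounded_by M (k + 2 * length fs) (fold extend_flip fs S)"
proof (induction fs arbitrary: k S)
  case (Cons f fs)
  then show ?case
    using Cons.IH[of "Suc (Suc k)" "extend_flip f S"] bounded_by_extend_flip[of M k S f] by simp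
qed simp

lemma points_mem: "p \<in> set (points xs) \<Longrightarrow> fst p \<in> set xs \<and> 0 < snd p \<and> snd p \<le> length xs"
  by (cases p) (auto simp: points_def dest: set_zip_leftD set_zip_rightD simp del: upt_Suc)

lemma bounded_by_initial:
  assumes "size_enc xs \<le> M"
  shows "bounded_by M 0 (initial (length xs + 1) (rev (points xs)))"
proof -
  have len: "length (points xs) = length xs" by (simp add: points_def del: upt_Suc)
  have n: "length xs + 1 \<le> M" using length_less_size_enc[of xs] assms by simp
  have p: "fst p \<le> M \<and> 0 < snd p \<and> snd p \<le> length xs" if "p \<in> set (points xs)" for p
    using points_mem[OF that] size_enc_mem[of "fst p" xs] assms by simp
  \<comment> \<open>The two segments of a point together span the whole height
    \<open>m\<close>.\<close>
  have "sum_list (map seg_length (concat (map (\<lambda>p. [((fst p, 0), p), (p, (fst p, m))]) ps))) =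
      length ps * m" if "\<And>p. p \<in> set ps \<Longrightarrow> snd p \<le> m" for ps :: "point list" and m
    using that
  proof (induction ps)
    case (Cons p ps)
    have "snd p \<le> m" using Cons.prems by simp
    moreover note Cons.IH[OF Cons.prems]
    ultimately show ?case by simp
  qed simp
  from this[of "rev (points xs)" "length xs + 1"]
  have "sum_list (map seg_length (concat (map (\<lambda>p. [((fst p, 0), p), (p, (fst p, length xs + 1))])
      (rev (points xs))))) = length xs * (length xs + 1)"
    using p len by fastforce
  also have "\<dots> \<le> M * M" using n by (intro mult_mono) auto
  finally have "sum_list (map seg_length (fst (snd (initial (length xs + 1) (rev (points xs)))))) \<le> M * M"
    by (simp add: initial_def)
  then show ?thesis
    using n p len unfolding bounded_by_def initial_def by fastforce
qed

lemma draw_list_le: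
  assumes "size_enc xs \<le> M"
  shows "i \<in> set (draw_list (length xs + 1) (rev (points xs))) \<Longrightarrow> snd i \<le> M"
    and "length (draw_list (length xs + 1) (rev (points xs))) \<le> 2 * M"
proof -
  have len: "length (points xs) = length xs" by (simp add: points_def del: upt_Suc)
  have n: "length xs + 1 \<le> M" using length_less_size_enc[of xs] assms by simp
  have p: "fst p \<le> M" if "p \<in> set (points xs)" for p
    using points_mem[OF that] size_enc_mem[of "fst p" xs] assms by simp
  have "left_of (rev (points xs)) q \<le> M" "right_of (length xs + 1) (rev (points xs)) q \<le> M" for q
    unfolding left_of_def right_of_def using p order_trans[OF fold_min_le n]
    by (auto intro!: fold_max_le)
  then show "snd i \<le> M" if "i \<in> set (draw_list (length xs + 1) (rev (points xs)))"
    using that by (auto simp: draw_list_def)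
  have "length (concat (map (\<lambda>p. [f p, g p]) ps)) = 2 * length ps" for f g :: "point \<Rightarrow> nat \<times> nat" and ps
    by (induction ps) auto
  then show "length (draw_list (length xs + 1) (rev (points xs))) \<le> 2 * M"
    using n len by (simp add: draw_list_def)
qed

lemma finish_list_le:
  assumes "size_enc xs \<le> M"
  shows "i \<in> set (finish_list (length xs + 1) (rev (points xs))) \<Longrightarrow> snd i \<le> M"
    and "length (finish_list (length xs + 1) (rev (points xs))) \<le> 2 * M"
proof -
  have len: "length (points xs) = length xs" by (simp add: points_def del: upt_Suc)
  have n: "length xs + 1 \<le> M" using length_less_size_enc[of xs] assms by simp
  show "snd i \<le> M" if "i \<in> set (finish_list (length xs + 1) (rev (points xs)))"
    using that n by (auto simp: finish_list_def)
  have "length (concat (map (\<lambda>p. [f p, g p]) ps)) = 2 * length ps" for f g :: "point \<Rightarrow> nat \<times> nat" and ps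
    by (induction ps) auto
  then show "length (finish_list (length xs + 1) (rev (points xs))) \<le> 2 * M"
    using n len by (simp add: finish_list_def)
qed

text \<open>Each of the three phases makes at most twice the input size many calls of
  \<open>extend\<close>; this is the origin of the factors 2, 4 and 6 in the invariants.\<close>

lemma ptime_transform: "ptime transform"
proof -
  define m where "m x = fst (scan (fst x))" for x :: "nat list \<times> (point \<times> point) list"
  define ps where "ps x = snd (scan (fst x))" for x :: "nat list \<times> (point \<times> point) list"
  define S1 where "S1 x = fold extend (draw_list (m x) (ps x)) (initial (m x) (ps x))" for x
  define S2 where "S2 x = fold extend_flip (snd x) (S1 x)" for x
  define S3 where "S3 x = fold extend (finish_list (m x) (ps x)) (S2 x)" for x
  define G where "G K x = (size_enc x * (3 * size_enc x + 6) + 1) +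
    (size_enc x * size_enc x * (4 * size_enc x + 8) + 1) + (K x * move_bound (size_enc x) + 1) + 2"
    for K and x :: "nat list \<times> (point \<times> point) list"
  have G: "poly_bounded (G K)" if "poly_bounded K" for K
    unfolding G_def[abs_def] move_bound_def by (intro poly_bounded_intros that poly_bounded_size)
  have size_G: "size_enc S \<le> G K x" if "bounded_by (size_enc x) k S" "k \<le> K x" for S k K x
    unfolding G_def by (rule size_bounded_by[OF that])
  have m: "ptime m" and ps: "ptime ps"
    unfolding m_def[abs_def] ps_def[abs_def]
    by (intro ptime_fst ptime_snd ptime_comp[OF ptime_fst[OF ptime_id] ptime_scan])+
  have xs: "size_enc (fst x) \<le> size_enc x" for x :: "nat list \<times> (point \<times> point) list"
    by (cases x) simp
  have m_eq: "m x = length (fst x) + 1" and ps_eq: "ps x = rev (points (fst x))" for x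
    by (simp_all add: m_def ps_def scan)
  note initial = bounded_by_initial[OF xs, folded m_eq ps_eq]
  note draw = draw_list_le[OF xs, folded m_eq ps_eq]
  note finish = finish_list_le[OF xs, folded m_eq ps_eq]
  have bounded1: "bounded_by (size_enc x) (2 * size_enc x) (S1 x)" for x
    unfolding S1_def
    by (rule bounded_by_mono[OF bounded_by_fold[OF initial]]) (use draw(1) draw(2)[of x] in auto)
  have flips: "length (snd x) \<le> size_enc x" for x :: "nat list \<times> (point \<times> point) list"
    using length_less_size_enc[of "snd x"] by (cases x) simp
  have bounded2: "bounded_by (size_enc x) (4 * size_enc x) (S2 x)" for x
    unfolding S2_def
    by (rule bounded_by_mono[OF bounded_by_fold_flips[OF bounded1]]) (use flips[of x] in simp)
  have S1: "ptime S1"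
    unfolding S1_def[abs_def]
  proof (rule ptime_fold[where I = "\<lambda>x k S. bounded_by (size_enc x) k S"
        and g = "G (\<lambda>x. 2 * size_enc x)"])
    show "size_enc S \<le> G (\<lambda>x. 2 * size_enc x) x"
      if "bounded_by (size_enc x) k S" "k \<le> length (draw_list (m x) (ps x))" for x k S
      using size_G[of x k S "\<lambda>x. 2 * size_enc x"] that draw(2)[of x] by simp
    show "bounded_by (size_enc x) (Suc k) (extend a S)"
      if "bounded_by (size_enc x) k S" "a \<in> set (draw_list (m x) (ps x))" for x k a S
      by (rule bounded_by_extend[OF that(1) draw(1)[OF that(2)]])
  qed (intro initial G ptime_draw_list ptime_initial ptime_extend m ps ptime_basic
      poly_bounded_intros poly_bounded_size)+
  have S2: "ptime S2"
    unfolding S2_def[abs_def]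
  proof (rule ptime_fold[where I = "\<lambda>x k S. bounded_by (size_enc x) (2 * size_enc x + 2 * k) S"
        and g = "G (\<lambda>x. 4 * size_enc x)"])
    show "size_enc S \<le> G (\<lambda>x. 4 * size_enc x) x"
      if "bounded_by (size_enc x) (2 * size_enc x + 2 * k) S" "k \<le> length (snd x)" for x k S
      using size_G[of x "2 * size_enc x + 2 * k" S "\<lambda>x. 4 * size_enc x"] that flips[of x] by simp
    show "bounded_by (size_enc x) (2 * size_enc x + 2 * Suc k) (extend_flip a S)"
      if "bounded_by (size_enc x) (2 * size_enc x + 2 * k) S" for x k a S
      using bounded_by_extend_flip[OF that] by simp
    show "bounded_by (size_enc x) (2 * size_enc x + 2 * 0) (S1 x)" for x
      using bounded1 by simp
  qed (intro S1 G ptime_extend_flip ptime_basic poly_bounded_intros poly_bounded_size)+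
  have "ptime S3"
    unfolding S3_def[abs_def]
  proof (rule ptime_fold[where I = "\<lambda>x k S. bounded_by (size_enc x) (4 * size_enc x + k) S"
        and g = "G (\<lambda>x. 6 * size_enc x)"])
    show "size_enc S \<le> G (\<lambda>x. 6 * size_enc x) x"
      if "bounded_by (size_enc x) (4 * size_enc x + k) S" "k \<le> length (finish_list (m x) (ps x))"
      for x k S
      using size_G[of x "4 * size_enc x + k" S "\<lambda>x. 6 * size_enc x"] that finish(2)[of x] by simp
    show "bounded_by (size_enc x) (4 * size_enc x + Suc k) (extend a S)"
      if "bounded_by (size_enc x) (4 * size_enc x + k) S" "a \<in> set (finish_list (m x) (ps x))"
      for x k a S
      using bounded_by_extend[OF that(1) finish(1)[OF that(2)]] by simp
    show "bounded_by (size_enc x) (4 * size_enc x + 0) (S2 x)" for x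
      using bounded2 by simp
  qed (intro S2 G ptime_finish_list ptime_extend m ps ptime_basic poly_bounded_intros
      poly_bounded_size)+
  then have "ptime (\<lambda>x. rev (snd (snd (S3 x))))"
    by (intro ptime_rev ptime_snd)
  moreover have "transform = (\<lambda>x. rev (snd (snd (S3 x))))"
    by (simp add: fun_eq_iff transform_def S3_def S2_def S1_def m_def ps_def Let_def)
  ultimately show ?thesis by simp
qed

lemma poly_time_transform: "poly_time_transformation transform"
proof -
  have input: "(encode :: nat list \<times> (point \<times> point) list \<Rightarrow> val) = enc_tree_run"
    by (simp add: encode_prod_def encode_list_def enc_tree_run_def enc_point_def encode_nat_def)
  have moves: "(encode :: rect_move list \<Rightarrow> val) = enc_rect_run"
    by (simp add: encode_prod_def encode_list_def enc_rect_run_def enc_point_def encode_nat_def)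
  from ptime_transform obtain p b where
    "\<And>x. run p (encode x) = encode (transform x)"
    "\<And>x :: nat list \<times> (point \<times> point) list. prog_time p (encode x) \<le> poly b (size_enc x)"
    by (rule ptime_obtain) blast
  then have "computes_in_poly_time p enc_tree_run enc_rect_run
      {(xs, fs). is_perm xs \<and> tree_solution xs fs} transform"
    unfolding computes_in_poly_time_def size_enc_def input moves by blast
  then show ?thesis
    unfolding poly_time_transformation_def by blast
qed

theorem theorem4:
  shows "\<exists>F (c :: nat). poly_time_transformation F \<and>
    (\<forall>A. tree_algorithm A \<longrightarrow>
       (let A' = (\<lambda>xs. F (xs, A xs))
        in rect_algorithm A' \<and>
           (\<forall>xs. is_perm xs \<longrightarrow> length (A' xs) \<le> c * (length (A xs) + length xs))))"
proof (rule exI[of _ transform], rule exI[of _ 4], unfold Let_def,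
    intro conjI allI impI)
  show "poly_time_transformation transform" by (rule poly_time_transform)
next
  fix A assume A: "tree_algorithm A"
  show "rect_algorithm (\<lambda>xs. transform (xs, A xs))"
    unfolding rect_algorithm_def
  proof (intro allI impI)
    fix xs assume "is_perm xs"
    then interpret permutation xs by unfold_locales
    show "rect_solution xs (transform (xs, A xs))"
      using A \<open>is_perm xs\<close> by (intro transform) (simp add: tree_algorithm_def)
  qed
next
  fix A xs assume A: "tree_algorithm A" and "is_perm xs"
  then interpret permutation xs by unfold_locales
  have "length (transform (xs, A xs)) \<le> 4 * n + 2 * length (A xs)"
    using A \<open>is_perm xs\<close> by (intro transform) (simp add: tree_algorithm_def)
  \<comment> \<open>The constant \<open>4\<close> is the larger of the two coefficients.\<close>
  then show "length (transform (xs, A xs)) \<le> 4 * (length (A xs) + length xs)"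
    by (simp add: n_def)
qed

end
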